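(* Let $s\in(0,1)$, $\gamma\in(1,2]$, and let $\mathscr{U}$ solve the extended problem $$\begin{cases}-\mathrm{div}(y^\alpha\mathbf{A}\nabla\mathscr{U})+y^\alpha c\,\mathscr{U}=0\ \text{ in }\mathcal{C}\times(0,T),\qquad \mathscr{U}=0\ \text{ on }\partial_L\mathcal{C}\times(0,T),\\ d_s\partial_t^\gamma\mathscr{U}+\partial_\nu^\alpha\mathscr{U}=d_sf\ \text{ on }(\Omega\times\{0\})\times(0,T),\\ \mathscr{U}=g,\quad\partial_t\mathscr{U}=h\ \text{ on }\Omega\times\{0\},\ t=0.\end{cases}$$ Let $u=\mathrm{tr}_\Omega\mathscr{U}$, $0\le\theta<2\sqrt{\lambda_1}$, $0\le\sigma<s$ and $0\le\nu<1+s$. Then there exist $\kappa>1$ and $C>0$, with $C$ independent of $\mathscr{U}$ and $\ell$, such that for every integer $\ell\ge0$ and a.e. $t\in(0,T)$, $$\|\partial_y^{\ell+1}\mathscr{U}(\cdot,t)\|^2_{L^2(\omega_{\alpha+2\ell-2\sigma,\theta},\mathcal{C})}\le C\kappa^{2(\ell+1)}((\ell+1)!)^2\|u(\cdot,t)\|^2_{\mathbb{H}^{\sigma+s}(\Omega)},$$ $$\|\nabla_{x'}\partial_y^{\ell+1}\mathscr{U}(\cdot,t)\|^2_{L^2(\omega_{\alpha+2(\ell+1)-2\nu,\theta},\mathcal{C})}\le C\kappa^{2(\ell+1)}((\ell+1)!)^2\|u(\cdot,t)\|^2_{\mathbb{H}^{\nu+s}(\Omega)},$$ $$\|\mathcal{L}_{x'}\partial_y^{\ell+1}\mathscr{U}(\cdot,t)\|^2_{L^2(\omega_{\alpha+2(\ell+1)-2\nu,\theta},\mathcal{C})}\le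 C\kappa^{2(\ell+1)}((\ell+1)!)^2\|u(\cdot,t)\|^2_{\mathbb{H}^{1+\nu+s}(\Omega)},$$ each bound being understood whenever its right-hand side is finite.
   Context: $\Omega\subset\mathbb{R}^n$ ($n\ge1$) is open, bounded and convex; $T>0$. $\mathcal{L}w=-\mathrm{div}(A\nabla w)+cw$ with homogeneous Dirichlet boundary conditions, where $0\le c\in L^\infty(\Omega)$ and $A$ is a Lipschitz ($C^{0,1}$), symmetric, uniformly positive definite matrix field on $\Omega$; $\mathcal{L}_{x'}$ denotes $\mathcal{L}$ acting in $x'\in\Omega$. $\{(\lambda_k,\varphi_k)\}_{k\ge1}\subset\mathbb{R}_+\times H_0^1(\Omega)$ are the eigenpairs of $\mathcal{L}$, with $\lambda_1$ the smallest eigenvalue and $\{\varphi_k\}$ an orthonormal basis of $L^2(\Omega)$. For $r\ge0$, $\mathbb{H}^r(\Omega)=\{w=\sum_kw_k\varphi_k:\|w\|_{\mathbb{H}^r(\Omega)}^2=\sum_k\lambda_k^r|w_k|^2<\infty\}$. Extension notation: $\mathcal{C}=\Omega\times(0,\infty)$ with points $(x',y)$; $\partial_L\mathcal{C}=\partial\Omega\times[0,\infty)$; $\alpha=1-2s$; $d_s=2^\alpha\Gamma(1-s)/\Gamma(s)$; $\mathbf{A}=\mathrm{diag}\{A,1\}$; $\partial_\nu^\alpha\mathscr{U}=-\lim_{y\downarrow0}y^\alpha\mathscr{U}_y$; $\mathrm{tr}_\Omega$ is the trace onto $\Omega\times\{0\}$; $\partial_t^\gamma$ is the left-sided Caputo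 derivative $\frac1{\Gamma(2-\gamma)}\int_0^t(t-r)^{1-\gamma}\frac{d^2u(r)}{dr^2}\,dr$ if $\gamma\in(1,2)$ and the usual second derivative if $\gamma=2$. The solution is $\mathscr{U}(x',y,t)=\sum_{k\ge1}u_k(t)\varphi_k(x')\psi_k(y)$, where $u(\cdot,t)=\sum_ku_k(t)\varphi_k$ is the solution of $\partial_t^\gamma u+\mathcal{L}^su=f$, $u(0)=g$, $\partial_tu(0)=h$ (with $\mathcal{L}^sw=\sum_k\lambda_k^sw_k\varphi_k$), and $\psi_k$ solves $\psi_k''+\frac\alpha y\psi_k'=\lambda_k\psi_k$ on $(0,\infty)$, $\psi_k(0)=1$, $\lim_{y\to\infty}\psi_k(y)=0$; explicitly $\psi_k(y)=c_s(\sqrt{\lambda_k}y)^sK_s(\sqrt{\lambda_k}y)$, $c_s=2^{1-s}/\Gamma(s)$, $K_s$ the modified Bessel function of the second kind. Weights: $\omega_{\beta,\theta}(y)=y^\beta e^{\theta y}$ and $\|v\|_{L^2(\omega_{\beta,\theta},\mathcal{C})}^2=\int_0^\infty\int_\Omega\omega_{\beta,\theta}(y)|v(x',y)|^2\,dx'\,dy$. *)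

theory Defs
  imports "HOL-Analysis.Analysis"
begin

section \<open>Test functions, weak derivatives, weighted L2 norms\<close>

text \<open>\<open>partials [b1, ..., bm] f\<close> is the iterated directional derivative of \<open>f\<close> along \<open>b1, ..., bm\<close>.\<close>

fun partials :: "'a::euclidean_space list \<Rightarrow> ('a \<Rightarrow> real) \<Rightarrow> 'a \<Rightarrow> real" where
  "partials [] f = f"
| "partials (b # bs) f = (\<lambda>x. frechet_derivative (partials bs f) (at x) b)"

definition grad :: "('a::euclidean_space \<Rightarrow> real) \<Rightarrow> 'a \<Rightarrow> 'a" where
  "grad f x = (\<Sum>b\<in>Basis. frechet_derivative f (at x) b *\<^sub>R b)"

definition smooth :: "('a::euclidean_space \<Rightarrow> real) \<Rightarrow> bool" where
  "smooth f \<longleftrightarrow> (\<forall>bs x. partials bs f differentiable (at x))"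

definition test_function :: "'a::euclidean_space set \<Rightarrow> ('a \<Rightarrow> real) \<Rightarrow> bool" where
  "test_function S \<eta> \<longleftrightarrow> smooth \<eta> \<and> (\<exists>K. compact K \<and> K \<subseteq> S \<and> (\<forall>x. x \<notin> K \<longrightarrow> \<eta> x = 0))"

definition locally_integrable :: "'a::euclidean_space set \<Rightarrow> ('a \<Rightarrow> real) \<Rightarrow> bool" where
  "locally_integrable S w \<longleftrightarrow> (\<forall>K. compact K \<longrightarrow> K \<subseteq> S \<longrightarrow> set_integrable lborel K w)"

text \<open>\<open>v\<close> is the distributional derivative of \<open>w\<close> on \<open>S\<close> along the directions \<open>bs\<close>.\<close>

definition weak_deriv ::
    "'a::euclidean_space set \<Rightarrow> 'a list \<Rightarrow> ('a \<Rightarrow> real) \<Rightarrow> ('a \<Rightarrow> real) \<Rightarrow> bool" where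
  "weak_deriv S bs w v \<longleftrightarrow> locally_integrable S w \<and> locally_integrable S v \<and>
     (\<forall>\<eta>. test_function S \<eta> \<longrightarrow>
        (LINT x:S|lborel. w x * partials bs \<eta> x)
          = (- 1) ^ length bs * (LINT x:S|lborel. v x * \<eta> x))"

definition wnorm_sq ::
    "('a::euclidean_space \<Rightarrow> real) \<Rightarrow> 'a set \<Rightarrow> ('a \<Rightarrow> 'b::euclidean_space) \<Rightarrow> ennreal" where
  "wnorm_sq \<rho> S v = (\<integral>\<^sup>+x\<in>S. ennreal (\<rho> x * (norm (v x))\<^sup>2) \<partial>lborel)"

definition in_wL2 ::
    "('a::euclidean_space \<Rightarrow> real) \<Rightarrow> 'a set \<Rightarrow> ('a \<Rightarrow> 'b::euclidean_space) \<Rightarrow> bool" where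
  "in_wL2 \<rho> S v \<longleftrightarrow> set_borel_measurable lborel S v \<and> wnorm_sq \<rho> S v < \<infinity>"

abbreviation L2norm_sq :: "'a::euclidean_space set \<Rightarrow> ('a \<Rightarrow> 'b::euclidean_space) \<Rightarrow> ennreal" where
  "L2norm_sq S v \<equiv> wnorm_sq (\<lambda>_. 1) S v"

abbreviation in_L2 :: "'a::euclidean_space set \<Rightarrow> ('a \<Rightarrow> 'b::euclidean_space) \<Rightarrow> bool" where
  "in_L2 S v \<equiv> in_wL2 (\<lambda>_. 1) S v"

definition L2_inner :: "'a::euclidean_space set \<Rightarrow> ('a \<Rightarrow> real) \<Rightarrow> ('a \<Rightarrow> real) \<Rightarrow> real" where
  "L2_inner S v w = (LINT x:S|lborel. v x * w x)"


section \<open>The Dirichlet operator and its eigenpairs\<close>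

text \<open>\<open>w\<close> belongs to the closure of the test functions in the first-order Sobolev norm,
  and \<open>G\<close> is its weak gradient.\<close>

definition H01 :: "'a::euclidean_space set \<Rightarrow> ('a \<Rightarrow> real) \<Rightarrow> ('a \<Rightarrow> 'a) \<Rightarrow> bool" where
  "H01 \<Omega> w G \<longleftrightarrow> in_L2 \<Omega> w \<and> in_L2 \<Omega> G \<and>
     (\<exists>\<eta>. (\<forall>j::nat. test_function \<Omega> (\<eta> j)) \<and>
        (\<lambda>j. L2norm_sq \<Omega> (\<lambda>x. \<eta> j x - w x)) \<longlonglongrightarrow> 0 \<and>
        (\<lambda>j. L2norm_sq \<Omega> (\<lambda>x. grad (\<eta> j) x - G x)) \<longlonglongrightarrow> 0)"

definition coeff_A ::
    "(real ^ 'n) set \<Rightarrow> (real ^ 'n \<Rightarrow> real ^ 'n ^ 'n) \<Rightarrow> bool" where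
  "coeff_A \<Omega> A \<longleftrightarrow> (\<exists>L. L-lipschitz_on \<Omega> A) \<and> (\<forall>x\<in>\<Omega>. transpose (A x) = A x) \<and>
     (\<exists>a>0. \<forall>x\<in>\<Omega>. \<forall>\<xi>. a * (norm \<xi>)\<^sup>2 \<le> \<xi> \<bullet> (A x *v \<xi>))"

definition coeff_c :: "(real ^ 'n) set \<Rightarrow> (real ^ 'n \<Rightarrow> real) \<Rightarrow> bool" where
  "coeff_c \<Omega> c \<longleftrightarrow> set_borel_measurable lborel \<Omega> c \<and>
     (\<exists>M. AE x in lborel. x \<in> \<Omega> \<longrightarrow> 0 \<le> c x \<and> c x \<le> M)"

text \<open>\<open>- div (A \<nabla>w) + c w = z\<close> in \<open>\<Omega>\<close> with homogeneous Dirichlet conditions, in the weak sense.\<close>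

definition dirichlet_op ::
    "(real ^ 'n) set \<Rightarrow> (real ^ 'n \<Rightarrow> real ^ 'n ^ 'n) \<Rightarrow> (real ^ 'n \<Rightarrow> real) \<Rightarrow>
     (real ^ 'n \<Rightarrow> real) \<Rightarrow> (real ^ 'n \<Rightarrow> real) \<Rightarrow> bool" where
  "dirichlet_op \<Omega> A c w z \<longleftrightarrow> in_L2 \<Omega> z \<and>
     (\<exists>G. H01 \<Omega> w G \<and>
       (\<forall>v Gv. H01 \<Omega> v Gv \<longrightarrow>
          (LINT x:\<Omega>|lborel. (A x *v G x) \<bullet> Gv x + c x * w x * v x) = L2_inner \<Omega> z v))"

text \<open>The sequences are indexed from 0, so \<open>lam 0\<close> is the smallest eigenvalue.\<close>

definition eigensystem ::
    "(real ^ 'n) set \<Rightarrow> (real ^ 'n \<Rightarrow> real ^ 'n ^ 'n) \<Rightarrow> (real ^ 'n \<Rightarrow> real) \<Rightarrow>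
     (nat \<Rightarrow> real) \<Rightarrow> (nat \<Rightarrow> real ^ 'n \<Rightarrow> real) \<Rightarrow> bool" where
  "eigensystem \<Omega> A c lam \<phi> \<longleftrightarrow>
     (\<forall>k. 0 < lam k \<and> lam 0 \<le> lam k) \<and>
     (\<forall>k. dirichlet_op \<Omega> A c (\<phi> k) (\<lambda>x. lam k * \<phi> k x)) \<and>
     (\<forall>j k. L2_inner \<Omega> (\<phi> j) (\<phi> k) = (if j = k then 1 else 0)) \<and>
     (\<forall>w. in_L2 \<Omega> w \<longrightarrow>
        (\<lambda>N. L2norm_sq \<Omega> (\<lambda>x. w x - (\<Sum>k<N. L2_inner \<Omega> w (\<phi> k) * \<phi> k x))) \<longlonglongrightarrow> 0)"

definition in_Hr ::
    "(real ^ 'n) set \<Rightarrow> (nat \<Rightarrow> real) \<Rightarrow> (nat \<Rightarrow> real ^ 'n \<Rightarrow> real) \<Rightarrow> real \<Rightarrow>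
     (real ^ 'n \<Rightarrow> real) \<Rightarrow> bool" where
  "in_Hr \<Omega> lam \<phi> r w \<longleftrightarrow> in_L2 \<Omega> w \<and>
     summable (\<lambda>k. lam k powr r * (L2_inner \<Omega> w (\<phi> k))\<^sup>2)"

definition Hr_norm ::
    "(real ^ 'n) set \<Rightarrow> (nat \<Rightarrow> real) \<Rightarrow> (nat \<Rightarrow> real ^ 'n \<Rightarrow> real) \<Rightarrow> real \<Rightarrow>
     (real ^ 'n \<Rightarrow> real) \<Rightarrow> real" where
  "Hr_norm \<Omega> lam \<phi> r w = sqrt (\<Sum>k. lam k powr r * (L2_inner \<Omega> w (\<phi> k))\<^sup>2)"


section \<open>The cylinder\<close>

definition cylinder :: "(real ^ 'n) set \<Rightarrow> ((real ^ 'n) \<times> real) set" where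
  "cylinder \<Omega> = \<Omega> \<times> {0<..}"

abbreviation dir_y :: "(real ^ 'n) \<times> real" where
  "dir_y \<equiv> (0, 1)"

definition weak_grad_x ::
    "((real ^ 'n) \<times> real) set \<Rightarrow> ((real ^ 'n) \<times> real \<Rightarrow> real) \<Rightarrow>
     ((real ^ 'n) \<times> real \<Rightarrow> real ^ 'n) \<Rightarrow> bool" where
  "weak_grad_x S V G \<longleftrightarrow> (\<forall>i. weak_deriv S [(axis i 1, 0)] V (\<lambda>z. G z $ i))"

text \<open>\<open>W\<close> is the result of applying the Dirichlet operator to \<open>V\<close> in the \<open>x\<close> variable only.\<close>

definition dirichlet_op_x ::
    "(real ^ 'n) set \<Rightarrow> (real ^ 'n \<Rightarrow> real ^ 'n ^ 'n) \<Rightarrow> (real ^ 'n \<Rightarrow> real) \<Rightarrow>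
     ((real ^ 'n) \<times> real \<Rightarrow> real) \<Rightarrow> ((real ^ 'n) \<times> real \<Rightarrow> real) \<Rightarrow> bool" where
  "dirichlet_op_x \<Omega> A c V W \<longleftrightarrow> set_borel_measurable lborel (cylinder \<Omega>) W \<and>
     (AE y in lborel. 0 < y \<longrightarrow> dirichlet_op \<Omega> A c (\<lambda>x. V (x, y)) (\<lambda>x. W (x, y)))"

definition weight :: "real \<Rightarrow> real \<Rightarrow> (real ^ 'n) \<times> real \<Rightarrow> real" where
  "weight \<beta> \<theta> z = snd z powr \<beta> * exp (\<theta> * snd z)"

text \<open>\<open>w\<close> belongs to the closure, in the first-order Sobolev norm with weight \<open>y powr \<alpha>\<close>, of the
  functions that are smooth up to \<open>y = 0\<close> and vanish near the lateral boundary and for large \<open>y\<close>;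
  \<open>G\<close> is its full weak gradient and \<open>u\<close> its trace on \<open>y = 0\<close>.\<close>

definition energy_space ::
    "(real ^ 'n) set \<Rightarrow> real \<Rightarrow> ((real ^ 'n) \<times> real \<Rightarrow> real) \<Rightarrow>
     ((real ^ 'n) \<times> real \<Rightarrow> (real ^ 'n) \<times> real) \<Rightarrow> (real ^ 'n \<Rightarrow> real) \<Rightarrow> bool" where
  "energy_space \<Omega> \<alpha> w G u \<longleftrightarrow>
     in_wL2 (weight \<alpha> 0) (cylinder \<Omega>) w \<and> in_wL2 (weight \<alpha> 0) (cylinder \<Omega>) G \<and> in_L2 \<Omega> u \<and>
     (\<exists>\<eta>. (\<forall>j::nat. test_function (\<Omega> \<times> UNIV) (\<eta> j)) \<and>
        (\<lambda>j. wnorm_sq (weight \<alpha> 0) (cylinder \<Omega>) (\<lambda>z. \<eta> j z - w z)) \<longlonglongrightarrow> 0 \<and>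
        (\<lambda>j. wnorm_sq (weight \<alpha> 0) (cylinder \<Omega>) (\<lambda>z. grad (\<eta> j) z - G z)) \<longlonglongrightarrow> 0 \<and>
        (\<lambda>j. L2norm_sq \<Omega> (\<lambda>x. \<eta> j (x, 0) - u x)) \<longlonglongrightarrow> 0)"

text \<open>The matrix \<open>diag {A, 1}\<close> acting on a vector of the form \<open>(\<xi>, \<zeta>)\<close>.\<close>

definition ext_matrix ::
    "(real ^ 'n \<Rightarrow> real ^ 'n ^ 'n) \<Rightarrow> (real ^ 'n) \<times> real \<Rightarrow> (real ^ 'n) \<times> real \<Rightarrow>
     (real ^ 'n) \<times> real" where
  "ext_matrix A z p = (A (fst z) *v fst p, snd p)"

definition d_s :: "real \<Rightarrow> real" where
  "d_s s = 2 powr (1 - 2 * s) * Gamma (1 - s) / Gamma s"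


section \<open>The extended evolution problem\<close>

definition caputo :: "real \<Rightarrow> (real \<Rightarrow> real) \<Rightarrow> real \<Rightarrow> real" where
  "caputo \<gamma> v t =
     (if \<gamma> = 2 then (deriv ^^ 2) v t
      else 1 / Gamma (2 - \<gamma>) * (LINT r:{0<..<t}|lborel. (t - r) powr (1 - \<gamma>) * (deriv ^^ 2) v r))"

text \<open>\<open>v\<close> is continuously differentiable with absolutely continuous derivative on \<open>[0, T]\<close>,
  and \<open>v 0 = v0\<close>, \<open>v' 0 = v1\<close>; then \<open>v''\<close> exists almost everywhere, is integrable, and
  determines \<open>v'\<close>.\<close>

definition time_regular :: "real \<Rightarrow> (real \<Rightarrow> real) \<Rightarrow> real \<Rightarrow> real \<Rightarrow> bool" where
  "time_regular T v v0 v1 \<longleftrightarrow>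
     continuous_on {0..T} v \<and> v 0 = v0 \<and>
     (v has_real_derivative v1) (at 0 within {0..T}) \<and>
     (\<forall>t\<in>{0<..<T}. v differentiable (at t)) \<and>
     (\<exists>w. set_integrable lborel {0<..<T} w \<and>
        (\<forall>t\<in>{0<..<T}. deriv v t = v1 + (LINT r:{0<..<t}|lborel. w r)))"

text \<open>Weak solutions. The last condition is the weak form of the degenerate elliptic equation in the
  cylinder together with the condition \<open>d_s s * (caputo derivative) + (conormal derivative) = d_s s * f\<close>
  on \<open>y = 0\<close>. The duality pairing of \<open>f(t) - (caputo derivative of u)(t)\<close> with the trace of \<open>\<eta>\<close> is
  evaluated through the Fourier coefficients with respect to \<open>\<phi>\<close>, because the Caputo derivative
  need not be in \<open>L2\<close>.\<close>

definition extended_solution ::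
    "(real ^ 'n) set \<Rightarrow> (real ^ 'n \<Rightarrow> real ^ 'n ^ 'n) \<Rightarrow> (real ^ 'n \<Rightarrow> real) \<Rightarrow>
     (nat \<Rightarrow> real ^ 'n \<Rightarrow> real) \<Rightarrow> real \<Rightarrow> real \<Rightarrow> real \<Rightarrow>
     (real \<Rightarrow> real ^ 'n \<Rightarrow> real) \<Rightarrow> (real ^ 'n \<Rightarrow> real) \<Rightarrow> (real ^ 'n \<Rightarrow> real) \<Rightarrow>
     (real \<Rightarrow> (real ^ 'n) \<times> real \<Rightarrow> real) \<Rightarrow> (real \<Rightarrow> real ^ 'n \<Rightarrow> real) \<Rightarrow> bool" where
  "extended_solution \<Omega> A c \<phi> s \<gamma> T f g h U u \<longleftrightarrow>
     in_L2 \<Omega> g \<and> in_L2 \<Omega> h \<and> (\<forall>t\<in>{0..T}. in_L2 \<Omega> (u t)) \<and>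
     (\<forall>k. time_regular T (\<lambda>t. L2_inner \<Omega> (u t) (\<phi> k)) (L2_inner \<Omega> g (\<phi> k)) (L2_inner \<Omega> h (\<phi> k))) \<and>
     (AE t in lborel. t \<in> {0<..<T} \<longrightarrow>
        in_L2 \<Omega> (f t) \<and>
        (\<exists>G. energy_space \<Omega> (1 - 2 * s) (U t) G (u t) \<and>
          (\<forall>\<eta>. test_function (\<Omega> \<times> UNIV) \<eta> \<longrightarrow>
            (\<lambda>k. d_s s * (L2_inner \<Omega> (f t) (\<phi> k) - caputo \<gamma> (\<lambda>\<tau>. L2_inner \<Omega> (u \<tau>) (\<phi> k)) t)
                   * L2_inner \<Omega> (\<lambda>x. \<eta> (x, 0)) (\<phi> k))
              sums (LINT z:cylinder \<Omega>|lborel. snd z powr (1 - 2 * s) *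
                      (ext_matrix A z (G z) \<bullet> grad \<eta> z + c (fst z) * U t z * \<eta> z)))))"

text \<open>The profile is the solution on \<open>(0, \<infinity>)\<close> of the boundary value problem
  \<open>\<psi>'' + (1 - 2s)/y \<psi>' = \<mu> \<psi>\<close>, \<open>\<psi>(0) = 1\<close>, \<open>\<psi>(\<infinity>) = 0\<close>; it equals
  \<open>2^(1-s) / \<Gamma>(s) (\<surd>\<mu> y)^s K_s(\<surd>\<mu> y)\<close>, with \<open>K_s\<close> the modified Bessel function of the second kind.\<close>

definition profile :: "real \<Rightarrow> real \<Rightarrow> (real \<Rightarrow> real) \<Rightarrow> bool" where
  "profile s \<mu> \<psi> \<longleftrightarrow>
     (\<forall>y>0. \<psi> differentiable (at y) \<and> deriv \<psi> differentiable (at y) \<and>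
        deriv (deriv \<psi>) y + (1 - 2 * s) / y * deriv \<psi> y = \<mu> * \<psi> y) \<and>
     continuous_on {0..} \<psi> \<and> \<psi> 0 = 1 \<and> (\<psi> \<longlongrightarrow> 0) at_top"

text \<open>\<open>U(x, y, t) = \<Sum>k. u_k(t) \<phi>_k(x) \<psi>_k(y)\<close>, with \<open>u_k\<close> the Fourier coefficients of \<open>u\<close>.\<close>

definition series_representation ::
    "(real ^ 'n) set \<Rightarrow> (nat \<Rightarrow> real ^ 'n \<Rightarrow> real) \<Rightarrow> (nat \<Rightarrow> real \<Rightarrow> real) \<Rightarrow> real \<Rightarrow>
     (real \<Rightarrow> (real ^ 'n) \<times> real \<Rightarrow> real) \<Rightarrow> (real \<Rightarrow> real ^ 'n \<Rightarrow> real) \<Rightarrow> bool" where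
  "series_representation \<Omega> \<phi> \<psi> T U u \<longleftrightarrow>
     (AE t in lborel. t \<in> {0<..<T} \<longrightarrow> (AE y in lborel. 0 < y \<longrightarrow>
        (\<lambda>N. L2norm_sq \<Omega> (\<lambda>x. U t (x, y) - (\<Sum>k<N. L2_inner \<Omega> (u t) (\<phi> k) * \<phi> k x * \<psi> k y)))
          \<longlonglongrightarrow> 0))"

end

theory Submission
  imports Defs
begin

text \<open>
  Write \<open>U(x, y) = \<Sum>k. u_k \<phi>_k(x) \<psi>_k(y)\<close> at a fixed time. Differentiation in \<open>y\<close> only hits the
  profiles \<open>\<psi>_k\<close>, and the \<open>\<phi>_k\<close> are orthonormal in \<open>L2\<close>, orthogonal in the energy of the operator, and
  eigenfunctions. Hence each of the three norms is bounded by a series over \<open>k\<close> whose terms are \<open>u_k\<^sup>2\<close>,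
  times 1, a multiple of \<open>\<lambda>_k\<close> or \<open>\<lambda>_k\<^sup>2\<close>, times a one-dimensional weighted integral of the square of the
  derivative of order \<open>l + 1\<close> of \<open>\<psi>_k\<close>. Scaling \<open>z = \<surd>\<lambda>_k y\<close> turns that integral into a power of \<open>\<lambda>_k\<close>
  times a constant, and the powers add up to the exponents of the \<open>H^r\<close> norms. The problem is
  therefore the growth in \<open>l\<close> of that constant.

  Everything about the profile is read off its differential equation, without Bessel functions.
  The maximum principle \<open>max_principle\<close> gives \<open>0 \<le> \<psi> \<le> 1\<close>, monotonicity, and, by comparison
  with exponentials, \<open>\<psi>(z) \<le> C exp(- \<delta> z)\<close> for every \<open>\<delta> < 1\<close>. The flux \<open>z^(1 - 2s) \<psi>'(z)\<close> is increasing
  with slope at most \<open>z^(1 - 2s)\<close>, which controls \<open>\<psi>'\<close> near 0 by \<open>z^(2s - 1)\<close> and at infinity by the decay of \<open>\<psi>\<close>. Differentiating the equation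
  \<open>m\<close> times gives a recursion for \<open>a_m = z^m \<psi>^(m)(z)\<close> with non-negative majorants, solved by
  \<open>2^m m! (\<Sum>j\<le>m. z^j / j!)\<close>; replacing \<open>z^j\<close> by \<open>\<epsilon>^(-m) (\<epsilon> z)^j\<close> shows that, up to \<open>(2 / \<epsilon>)^m m!\<close> and a constant, all
  \<open>a_m\<close> with \<open>m \<ge> 1\<close> are bounded by \<open>z^(2s) exp(- (\<delta> - \<epsilon>) z)\<close>. As \<open>\<theta> / \<surd>\<lambda>_k\<close> stays below a number smaller than 2, \<open>\<delta>\<close> and \<open>\<epsilon>\<close> can be
  chosen so that the weight \<open>exp(\<theta> y)\<close> is absorbed; what remains is a Gamma integral, which converges
  at 0 exactly under the restrictions \<open>\<sigma> < s\<close> and \<open>\<nu> < 1 + s\<close>.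

  The differentiated series is given a meaning slice by slice. For each \<open>y > 0\<close> the numbers \<open>\<lambda>_k^j \<psi>_k^(l + 1)(y)\<^sup>2\<close> are bounded in \<open>k\<close>, so the series for the derivative, for
  its gradient in \<open>x\<close> and for its image under the operator converge in \<open>L2(\<Omega>)\<close> on every slice, locally
  uniformly in \<open>y\<close>, already for \<open>u\<close> in \<open>L2(\<Omega>)\<close>. A subsequence chosen from \<open>u\<close> alone converges almost
  everywhere on every slice and provides jointly measurable limits (\<open>bessel_system_series\<close>).
  Local \<open>L2\<close> convergence identifies the limits as distributional derivatives, and Fatou's lemma with
  Tonelli's theorem transfers the bounds for the partial sums to the weighted norms.
\<close>

section \<open>A maximum principle for the profile equation\<close>

text \<open>
  At a positive interior maximum the first derivative vanishes, and the hypothesis makes the second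
  derivative positive there, so \<open>w\<close> would increase further to the right.
\<close>

lemma max_principle:
  fixes w w' w'' :: "real \<Rightarrow> real"
  assumes cont: "continuous_on {a..} w" and a: "w a \<le> 0"
    and lim: "(w \<longlongrightarrow> L) at_top" "L \<le> 0"
    and d1: "\<And>y. y > a \<Longrightarrow> (w has_real_derivative w' y) (at y)"
    and d2: "\<And>y. y > a \<Longrightarrow> (w' has_real_derivative w'' y) (at y)"
    and sub: "\<And>y. y > a \<Longrightarrow> w y > 0 \<Longrightarrow> w' y = 0 \<Longrightarrow> w'' y > 0"
    and y: "y \<ge> a"
  shows "w y \<le> 0"
proof (rule ccontr)
  assume "\<not> w y \<le> 0"
  then have wy: "w y > 0" by simp
  have "eventually (\<lambda>x. w x < w y) at_top"
    using lim wy by (intro order_tendstoD(2)[OF lim(1)]) simp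
  then obtain b0 where b0: "\<And>x. x \<ge> b0 \<Longrightarrow> w x < w y"
    by (auto simp: eventually_at_top_linorder)
  define b where "b = max b0 (y + 1)"
  have b: "b \<ge> y + 1" "\<And>x. x \<ge> b \<Longrightarrow> w x < w y" using b0 by (auto simp: b_def)
  have "continuous_on {a..b} w" by (rule continuous_on_subset[OF cont]) auto
  moreover have "compact {a..b}" "{a..b} \<noteq> {}" using y b(1) by auto
  ultimately obtain z where z: "z \<in> {a..b}" "\<And>x. x \<in> {a..b} \<Longrightarrow> w x \<le> w z"
    using continuous_attains_sup by metis
  have wz: "w y \<le> w z" using z(2)[of y] y b(1) by auto
  have za: "z > a" using wz wy a z(1) by (cases "z = a") auto
  have glob: "w x \<le> w z" if "x \<ge> a" for x
    using z(2)[of x] b(2)[of x] wz that by (cases "x \<le> b") auto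
  have z0: "w' z = 0"
  proof (rule DERIV_local_max[OF d1[OF za]])
    show "0 < z - a" using za by simp
    show "\<forall>x. \<bar>z - x\<bar> < z - a \<longrightarrow> w x \<le> w z" using glob by auto
  qed
  have "w'' z > 0" using sub[OF za _ z0] wz wy by simp
  then obtain d where d: "d > 0" "\<And>h. 0 < h \<Longrightarrow> h < d \<Longrightarrow> w' z < w' (z + h)"
    using DERIV_pos_inc_right[OF d2[OF za]] by auto
  have "w z < w (z + d / 2)"
  proof (rule DERIV_pos_imp_increasing_open[where f = w and a = z and b = "z + d / 2"])
    show "z < z + d / 2" using d by simp
    show "\<exists>y. DERIV w x :> y \<and> 0 < y" if "z < x" "x < z + d / 2" for x
      using d1[of x] d(2)[of "x - z"] that za z0 d(1) by auto
    show "continuous_on {z..z + d / 2} w"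
      by (rule continuous_on_subset[OF cont]) (use za in auto)
  qed
  with glob[of "z + d / 2"] za d(1) show False by auto
qed

lemma profile_deriv:
  assumes "profile s \<mu> \<psi>" "y > 0"
  shows "(\<psi> has_real_derivative deriv \<psi> y) (at y)"
    and "(deriv \<psi> has_real_derivative (\<mu> * \<psi> y - (1 - 2 * s) / y * deriv \<psi> y)) (at y)"
proof -
  have *: "\<psi> differentiable (at y)" "deriv \<psi> differentiable (at y)"
    "deriv (deriv \<psi>) y = \<mu> * \<psi> y - (1 - 2 * s) / y * deriv \<psi> y"
    using assms unfolding profile_def by (auto simp: algebra_simps)
  show "(\<psi> has_real_derivative deriv \<psi> y) (at y)"
    using *(1) by (simp add: DERIV_deriv_iff_real_differentiable)
  show "(deriv \<psi> has_real_derivative (\<mu> * \<psi> y - (1 - 2 * s) / y * deriv \<psi> y)) (at y)"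
    unfolding *(3)[symmetric] using *(2) by (simp add: DERIV_deriv_iff_real_differentiable)
qed

lemma profile_props:
  assumes "profile s \<mu> \<psi>"
  shows "continuous_on {0..} \<psi>" "\<psi> 0 = 1" "(\<psi> \<longlongrightarrow> 0) at_top"
  using assms unfolding profile_def by auto

lemma profile_nonneg:
  assumes p: "profile s \<mu> \<psi>" and mu: "\<mu> > 0" and y: "y \<ge> 0"
  shows "0 \<le> \<psi> y"
proof -
  have "- \<psi> y \<le> 0"
  proof (rule max_principle[where w = "\<lambda>y. - \<psi> y" and y = y and a = 0 and L = 0 and w' = "\<lambda>y. - deriv \<psi> y"
        and w'' = "\<lambda>y. - (\<mu> * \<psi> y - (1 - 2 * s) / y * deriv \<psi> y)"])
    show "((\<lambda>y. - \<psi> y) \<longlongrightarrow> 0) at_top"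
      using tendsto_minus[OF profile_props(3)[OF p]] by simp
    show "continuous_on {0..} (\<lambda>y. - \<psi> y)"
      by (intro continuous_intros profile_props(1)[OF p])
    show "((\<lambda>y. - \<psi> y) has_real_derivative - deriv \<psi> y) (at y)" if "0 < y" for y
      using profile_deriv(1)[OF p that] by (rule DERIV_minus)
    show "((\<lambda>y. - deriv \<psi> y) has_real_derivative
        - (\<mu> * \<psi> y - (1 - 2 * s) / y * deriv \<psi> y)) (at y)" if "0 < y" for y
      using profile_deriv(2)[OF p that] by (rule DERIV_minus)
  qed (use y mu in \<open>auto simp: profile_props(2)[OF p] mult_pos_neg\<close>)
  then show ?thesis by simp
qed

text \<open>
  Beyond \<open>a\<close> the function \<open>\<psi> - \<psi> a\<close> starts at 0 and has a non-positive limit, and where it is positive so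
  is \<open>\<psi>\<close>; hence the maximum principle applies on \<open>[a, \<infinity>)\<close>.
\<close>

lemma profile_antimono:
  assumes p: "profile s \<mu> \<psi>" and mu: "\<mu> > 0" and a: "0 \<le> a" "a \<le> y"
  shows "\<psi> y \<le> \<psi> a"
proof -
  have "\<psi> y - \<psi> a \<le> 0"
  proof (rule max_principle[where w = "\<lambda>y. \<psi> y - \<psi> a" and y = y and a = a and L = "0 - \<psi> a" and w' = "\<lambda>y. deriv \<psi> y"
        and w'' = "\<lambda>y. \<mu> * \<psi> y - (1 - 2 * s) / y * deriv \<psi> y"])
    show "((\<lambda>y. \<psi> y - \<psi> a) \<longlongrightarrow> 0 - \<psi> a) at_top"
      by (intro tendsto_intros profile_props[OF p])
    show "0 - \<psi> a \<le> 0" using profile_nonneg[OF p mu a(1)] by simp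
    show "continuous_on {a..} (\<lambda>y. \<psi> y - \<psi> a)"
      by (intro continuous_intros continuous_on_subset[OF profile_props(1)[OF p]]) (use a in auto)
    show "((\<lambda>y. \<psi> y - \<psi> a) has_real_derivative deriv \<psi> y) (at y)" if "a < y" for y
      using profile_deriv(1)[OF p, of y] that a by (auto intro!: derivative_eq_intros)
    show "(deriv \<psi> has_real_derivative \<mu> * \<psi> y - (1 - 2 * s) / y * deriv \<psi> y) (at y)"
      if "a < y" for y using profile_deriv(2)[OF p, of y] that a by auto
    show "0 < \<mu> * \<psi> y - (1 - 2 * s) / y * deriv \<psi> y"
      if "a < y" "0 < \<psi> y - \<psi> a" "deriv \<psi> y = 0" for y
      using that profile_nonneg[OF p mu a(1)] mu by simp
  qed (use a in auto)
  then show ?thesis by simp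
qed

lemma profile_le_1:
  assumes "profile s \<mu> \<psi>" "\<mu> > 0" "0 \<le> y"
  shows "\<psi> y \<le> 1"
  using profile_antimono[OF assms(1,2), of 0 y] assms(3) profile_props(2)[OF assms(1)] by simp

lemma profile_deriv_nonpos:
  assumes p: "profile s \<mu> \<psi>" and mu: "\<mu> > 0" and y: "0 < y"
  shows "deriv \<psi> y \<le> 0"
proof (rule ccontr)
  assume "\<not> deriv \<psi> y \<le> 0"
  then obtain d where d: "d > 0" "\<And>h. 0 < h \<Longrightarrow> h < d \<Longrightarrow> \<psi> y < \<psi> (y + h)"
    using DERIV_pos_inc_right[OF profile_deriv(1)[OF p y]] by auto
  from d(2)[of "d/2"] profile_antimono[OF p mu, of y "y + d/2"] d(1) y show False by auto
qed

text \<open>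
  For \<open>\<delta> < 1\<close> the function \<open>exp(- \<delta> (y - R))\<close> is a supersolution beyond \<open>R = 1 / (1 - \<delta>\<^sup>2)\<close>: there the
  first-order term, of size at most \<open>\<delta> / y\<close> relative to the exponential, is smaller than \<open>1 - \<delta>\<^sup>2\<close>.
\<close>

lemma profile_decay:
  fixes \<delta> :: real
  assumes p: "profile s 1 \<psi>" and s: "0 < s" "s < 1" and \<delta>: "0 < \<delta>" "\<delta> < 1" and y: "y \<ge> 0"
  shows "\<psi> y \<le> exp (\<delta> / (1 - \<delta>\<^sup>2)) * exp (- \<delta> * y)"
proof -
  define R where "R = 1 / (1 - \<delta>\<^sup>2)"
  have d2: "\<delta>\<^sup>2 < 1" using \<delta> by (simp add: power_less_one_iff abs_square_less_1)
  have R: "R > 0" using d2 by (simp add: R_def)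
  have key: "\<psi> y \<le> exp (- \<delta> * (y - R))" if yR: "y \<ge> R" for y
  proof -
    have "\<psi> y - exp (- \<delta> * (y - R)) \<le> 0"
    proof (rule max_principle[where w = "\<lambda>y. \<psi> y - exp (- \<delta> * (y - R))" and y = y and a = R and L = "0 - 0"
          and w' = "\<lambda>y. deriv \<psi> y + \<delta> * exp (- \<delta> * (y - R))"
          and w'' = "\<lambda>y. 1 * \<psi> y - (1 - 2 * s) / y * deriv \<psi> y - \<delta>\<^sup>2 * exp (- \<delta> * (y - R))"])
      show "continuous_on {R..} (\<lambda>y. \<psi> y - exp (- \<delta> * (y - R)))"
        by (intro continuous_intros continuous_on_subset[OF profile_props(1)[OF p]]) (use R in auto)
      show "\<psi> R - exp (- \<delta> * (R - R)) \<le> 0" using profile_le_1[OF p _, of R] R by simp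
      have "((\<lambda>y. exp (- \<delta> * (y - R))) \<longlongrightarrow> 0) at_top"
      proof (rule filterlim_compose[OF exp_at_bot])
        show "filterlim (\<lambda>y. - \<delta> * (y - R)) at_bot at_top"
          unfolding filterlim_at_bot
        proof
          fix Z :: real
          show "\<forall>\<^sub>F x in at_top. - \<delta> * (x - R) \<le> Z"
            using eventually_ge_at_top[of "R - Z / \<delta>"]
          proof eventually_elim
            case (elim x)
            then have "\<delta> * (R - Z / \<delta>) \<le> \<delta> * x" using \<delta> by (intro mult_left_mono) auto
            then show ?case using \<delta> by (simp add: algebra_simps)
          qed
        qed
      qed
      then show "((\<lambda>y. \<psi> y - exp (- \<delta> * (y - R))) \<longlongrightarrow> 0 - 0) at_top"
        by (intro tendsto_intros profile_props[OF p])
      show "((\<lambda>y. \<psi> y - exp (- \<delta> * (y - R))) has_real_derivative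
          deriv \<psi> y + \<delta> * exp (- \<delta> * (y - R))) (at y)" if "R < y" for y
        using profile_deriv(1)[OF p, of y] that R by (auto intro!: derivative_eq_intros)
      show "((\<lambda>y. deriv \<psi> y + \<delta> * exp (- \<delta> * (y - R))) has_real_derivative
          1 * \<psi> y - (1 - 2 * s) / y * deriv \<psi> y - \<delta>\<^sup>2 * exp (- \<delta> * (y - R))) (at y)" if "R < y" for y
        using profile_deriv(2)[OF p, of y] that R
        by (auto intro!: derivative_eq_intros simp: power2_eq_square)
      show "0 < 1 * \<psi> y - (1 - 2 * s) / y * deriv \<psi> y - \<delta>\<^sup>2 * exp (- \<delta> * (y - R))"
        if h: "R < y" "0 < \<psi> y - exp (- \<delta> * (y - R))"
          "deriv \<psi> y + \<delta> * exp (- \<delta> * (y - R)) = 0" for y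
      proof -
        define S where "S = exp (- \<delta> * (y - R))"
        have S: "S > 0" by (simp add: S_def)
        have dd: "deriv \<psi> y = - \<delta> * S" using h(3) by (simp add: S_def)
        have "\<bar>(1 - 2 * s) / y * \<delta>\<bar> = \<bar>1 - 2 * s\<bar> * \<delta> / y" using R h(1) \<delta> by (simp add: abs_mult)
        also have "\<dots> \<le> 1 * 1 / y" using s \<delta> R h(1) by (intro divide_right_mono mult_mono) auto
        also have "\<dots> \<le> 1 / R" using R h(1) by (simp add: field_simps)
        also have "\<dots> = 1 - \<delta>\<^sup>2" by (simp add: R_def)
        finally have "- (1 - \<delta>\<^sup>2) \<le> (1 - 2 * s) / y * \<delta>" by (simp only: abs_le_iff) linarith
        then have "0 \<le> (1 - \<delta>\<^sup>2 + (1 - 2 * s) / y * \<delta>) * S" using S by simp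
        also have "\<dots> < \<psi> y - S + (1 - \<delta>\<^sup>2 + (1 - 2 * s) / y * \<delta>) * S"
          using h(2) by (simp add: S_def)
        also have "\<dots> = 1 * \<psi> y - (1 - 2 * s) / y * deriv \<psi> y - \<delta>\<^sup>2 * S"
          unfolding dd by (simp add: left_diff_distrib distrib_right mult.assoc)
        finally show ?thesis by (simp add: S_def)
      qed
    qed (use yR in auto)
    then show ?thesis by simp
  qed
  have eq: "exp (\<delta> / (1 - \<delta>\<^sup>2)) * exp (- \<delta> * y) = exp (- \<delta> * (y - R))"
    by (simp add: R_def algebra_simps flip: exp_add)
  show ?thesis
  proof (cases "y \<ge> R")
    case True
    then show ?thesis using key eq by simp
  next
    case False
    then have "1 \<le> exp (- \<delta> * (y - R))" using \<delta> by (auto simp: mult_le_0_iff)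
    then show ?thesis unfolding eq using profile_le_1[OF p zero_less_one y] by linarith
  qed
qed

section \<open>Size of the profile and of its derivative\<close>

text \<open>
  Powers of \<open>z\<close> are absorbed by giving up part of the exponential decay.
\<close>

lemma powr_exp_absorb:
  fixes p \<delta> :: real
  assumes p: "0 \<le> p" and \<delta>: "\<delta> < \<delta>'"
  shows "\<exists>C>0. \<forall>z\<ge>0. z powr p * exp (- \<delta>' * z) \<le> C * exp (- \<delta> * z)"
proof -
  define m where "m = nat \<lceil>p\<rceil>"
  define e where "e = \<delta>' - \<delta>"
  have e: "e > 0" using \<delta> by (simp add: e_def)
  have m: "p \<le> real m" by (simp add: m_def real_nat_ceiling_ge)
  define C where "C = 1 + fact m / e ^ m"
  have "z powr p * exp (- \<delta>' * z) \<le> C * exp (- \<delta> * z)" if z: "z \<ge> 0" for z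
  proof -
    have ez: "0 \<le> e * z" using e z by simp
    have f: "(e * z) ^ m / fact m \<le> exp (e * z)"
    proof -
      have "(\<Sum>k\<in>{m}. (e * z) ^ k /\<^sub>R fact k) \<le> (\<Sum>k. (e * z) ^ k /\<^sub>R fact k)"
        by (rule sum_le_suminf) (use ez in \<open>auto intro: summable_exp\<close>)
      then show ?thesis by (simp add: exp_def divide_inverse mult.commute)
    qed
    have zm: "z ^ m \<le> fact m / e ^ m * exp (e * z)"
      using f e by (simp add: field_simps power_mult_distrib)
    have "z powr p \<le> 1 + z ^ m"
    proof (cases "z \<le> 1")
      case True
      then have "z powr p \<le> 1" using z p by (intro powr_le1) auto
      then show ?thesis using z by (smt (verit) zero_le_power)
    next
      case False
      then have "z powr p \<le> z powr real m" using m by (intro powr_mono) auto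
      also have "\<dots> = z ^ m" using False by (simp add: powr_realpow)
      finally show ?thesis by simp
    qed
    also have "\<dots> \<le> exp (e * z) + fact m / e ^ m * exp (e * z)"
      using zm ez by (intro add_mono) auto
    also have "\<dots> = C * exp (e * z)" by (simp add: C_def algebra_simps)
    finally have "z powr p * exp (- \<delta>' * z) \<le> C * exp (e * z) * exp (- \<delta>' * z)"
      by (intro mult_right_mono) auto
    also have "\<dots> = C * exp (- \<delta> * z)" by (simp add: e_def algebra_simps flip: exp_add)
    finally show ?thesis .
  qed
  moreover have "C > 0" unfolding C_def using e by (intro add_pos_nonneg) auto
  ultimately show ?thesis by blast
qed

text \<open>
  In divergence form the equation reads \<open>(y^(1 - 2s) \<psi>')' = y^(1 - 2s) \<psi>\<close>. The right-hand side lies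
  between 0 and \<open>y^(1 - 2s)\<close>, which gives both monotonicity statements.
\<close>

lemma profile_flux_mono:
  fixes a b :: real
  assumes p: "profile s 1 \<psi>" and ab: "0 < a" "a \<le> b" and s: "0 < s" "s < 1"
  shows "a powr (1 - 2 * s) * deriv \<psi> a \<le> b powr (1 - 2 * s) * deriv \<psi> b"
    and "b powr (1 - 2 * s) * deriv \<psi> b - b powr (2 - 2 * s) / (2 - 2 * s)
       \<le> a powr (1 - 2 * s) * deriv \<psi> a - a powr (2 - 2 * s) / (2 - 2 * s)"
proof -
  define q where "q y = y powr (1 - 2 * s) * deriv \<psi> y" for y
  have q: "(q has_real_derivative y powr (1 - 2 * s) * \<psi> y) (at y)" if y: "y > 0" for y
  proof -
    have Dq: "(q has_real_derivative (1 - 2 * s) * y powr (1 - 2 * s - 1) * deriv \<psi> y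
       + y powr (1 - 2 * s) * (1 * \<psi> y - (1 - 2 * s) / y * deriv \<psi> y)) (at y)"
      unfolding q_def
      using DERIV_mult[OF has_real_derivative_powr[OF y, of "1 - 2 * s"] profile_deriv(2)[OF p y]]
      by (simp add: mult.commute)
    have pd: "y powr (1 - 2 * s - 1) = y powr (1 - 2 * s) / y"
      using y powr_diff[of y "1 - 2 * s" 1] by (simp only: powr_one less_imp_le)
    have alg: "k * (P / y) * d + P * (1 * x - k / y * d) = P * x" for k P d x :: real
      by (simp add: algebra_simps)
    show ?thesis using Dq unfolding pd alg .
  qed
  have pw: "((\<lambda>y. y powr (2 - 2 * s) / (2 - 2 * s)) has_real_derivative y powr (1 - 2 * s)) (at y)"
    if y: "y > 0" for y
  proof -
    have "(2 - 2 * s) * y powr (2 - 2 * s - 1) / (2 - 2 * s) = y powr (1 - 2 * s)"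
      using s by (simp add: diff_right_commute)
    then show ?thesis
      using DERIV_cdivide[OF has_real_derivative_powr[OF y, of "2 - 2 * s"], of "2 - 2 * s"] by (simp only:)
  qed
  have "q a \<le> q b"
  proof (rule DERIV_nonneg_imp_nondecreasing[OF ab(2)])
    fix x assume "a \<le> x" "x \<le> b"
    then show "\<exists>y. DERIV q x :> y \<and> 0 \<le> y"
      using q[of x] ab profile_nonneg[OF p, of x] by auto
  qed
  then show "a powr (1 - 2 * s) * deriv \<psi> a \<le> b powr (1 - 2 * s) * deriv \<psi> b" by (simp add: q_def)
  have "q b - b powr (2 - 2 * s) / (2 - 2 * s) \<le> q a - a powr (2 - 2 * s) / (2 - 2 * s)"
  proof (rule DERIV_nonpos_imp_nonincreasing[OF ab(2)])
    fix x assume x: "a \<le> x" "x \<le> b"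
    then have x0: "x > 0" using ab by simp
    have "((\<lambda>y. q y - y powr (2 - 2 * s) / (2 - 2 * s)) has_real_derivative
         x powr (1 - 2 * s) * \<psi> x - x powr (1 - 2 * s)) (at x)"
      by (intro DERIV_diff q pw x0)
    moreover have "x powr (1 - 2 * s) * \<psi> x - x powr (1 - 2 * s) \<le> 0"
      using profile_le_1[OF p, of x] x0 by (simp add: mult_left_le)
    ultimately show "\<exists>y. DERIV (\<lambda>y. q y - y powr (2 - 2 * s) / (2 - 2 * s)) x :> y \<and> y \<le> 0" by blast
  qed
  then show "b powr (1 - 2 * s) * deriv \<psi> b - b powr (2 - 2 * s) / (2 - 2 * s)
       \<le> a powr (1 - 2 * s) * deriv \<psi> a - a powr (2 - 2 * s) / (2 - 2 * s)" by (simp add: q_def)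
qed

text \<open>
  The mean value theorem produces a point \<open>z\<close> between \<open>y - 1/2\<close> and \<open>y\<close> where \<open>\<psi>'\<close> is controlled by \<open>\<psi>\<close>, and
  monotonicity of the flux carries the bound from \<open>z\<close> to \<open>y\<close>.
\<close>

lemma profile_deriv_decay:
  assumes p: "profile s 1 \<psi>" and s: "0 < s" "s < 1" and y: "y \<ge> 1"
  shows "- deriv \<psi> y \<le> 4 * \<psi> (y - 1/2)"
proof -
  have "\<exists>z. y - 1/2 < z \<and> z < y \<and> \<psi> y - \<psi> (y - 1/2) = (y - (y - 1/2)) * deriv \<psi> z"
    using y by (intro MVT2) (auto intro!: profile_deriv(1)[OF p])
  then obtain z where z: "y - 1/2 < z" "z < y" "\<psi> y - \<psi> (y - 1/2) = (1/2) * deriv \<psi> z" by auto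
  have z0: "z > 1/2" "y > 0" using z y by auto
  have "y powr (1 - 2 * s) * (- deriv \<psi> y) \<le> z powr (1 - 2 * s) * (- deriv \<psi> z)"
    using profile_flux_mono(1)[OF p _ _ s, of z y] z z0 by simp
  then have "- deriv \<psi> y \<le> (z powr (1 - 2 * s) / y powr (1 - 2 * s)) * (- deriv \<psi> z)"
    using z0 by (simp add: field_simps)
  also have "z powr (1 - 2 * s) / y powr (1 - 2 * s) = (z / y) powr (1 - 2 * s)"
    using z0 by (simp add: powr_divide)
  also have "(z / y) powr (1 - 2 * s) * (- deriv \<psi> z) \<le> 2 * (- deriv \<psi> z)"
  proof (intro mult_right_mono)
    have zy: "1/2 \<le> z / y" "z / y \<le> 1" "0 < z / y" using z y by (auto simp: field_simps)
    have "(z / y) powr (1 - 2 * s) \<le> (z / y) powr (- 1)"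
      by (rule powr_mono') (use s zy in linarith)+
    also have "\<dots> = y / z" using zy(3) by (simp only: powr_minus powr_one less_imp_le) simp
    also have "\<dots> \<le> 2" using zy z z0 by (simp add: field_simps)
    finally show "(z / y) powr (1 - 2 * s) \<le> 2" .
    show "0 \<le> - deriv \<psi> z" using profile_deriv_nonpos[OF p, of z] z0 by simp
  qed
  also have "\<dots> = 4 * (\<psi> (y - 1/2) - \<psi> y)" using z(3) by simp
  also have "\<dots> \<le> 4 * \<psi> (y - 1/2)" using profile_nonneg[OF p, of y] z0 by simp
  finally show ?thesis .
qed

text \<open>
  These are the two starting values for the recursion on the higher derivatives. The common factor
  \<open>z^(2s)\<close> is the exact order at 0 of \<open>z \<psi>'(z)\<close>; for \<open>z\<^sup>2 \<psi>(z)\<close> it is a weakening, because \<open>2s < 2\<close>.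
\<close>

lemma profile_base_bound_unit:
  fixes s \<delta> :: real
  assumes s: "0 < s" "s < 1" and \<delta>: "0 < \<delta>" "\<delta> < 1"
  shows "\<exists>M>0. \<forall>\<psi>. profile s 1 \<psi> \<longrightarrow> (\<forall>z>0. z\<^sup>2 * \<bar>\<psi> z\<bar> \<le> M * (z powr (2 * s) * exp (- \<delta> * z)) \<and>
     z * \<bar>deriv \<psi> z\<bar> \<le> M * (z powr (2 * s) * exp (- \<delta> * z)))"
proof -
  \<comment> \<open>The rate \<open>d\<close> lies between \<open>\<delta>\<close> and 1; the difference \<open>d - \<delta>\<close> pays for the powers of \<open>z\<close>.\<close>
  define d where "d = (1 + \<delta>) / 2"
  have d: "0 < d" "d < 1" "\<delta> < d" using \<delta> by (auto simp: d_def)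
  define K where "K = exp (d / (1 - d\<^sup>2))"
  have K: "K \<ge> 1" using d by (auto simp: K_def power_le_one_iff intro!: divide_nonneg_nonneg)
  obtain C where C: "C > 0" "\<And>z. z \<ge> 0 \<Longrightarrow> z powr (2 - 2 * s) * exp (- d * z) \<le> C * exp (- \<delta> * z)"
    using powr_exp_absorb[of "2 - 2 * s" \<delta> d] s d by auto
  define H where "H = 4 * K * exp (d / 2)"
  have H: "H > 0" using K by (simp add: H_def)
  define M where "M = K * C + H * C + (H + 1 / (2 - 2 * s)) * exp \<delta>"
  have M: "M > 0" using K C H s by (auto simp: M_def intro!: add_pos_pos mult_pos_pos)
  have KCM: "K * C \<le> M" and HCM: "H * C \<le> M" and LM: "(H + 1 / (2 - 2 * s)) * exp \<delta> \<le> M"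
    using K C H s by (auto simp: M_def intro!: add_nonneg_nonneg)
  have "z\<^sup>2 * \<bar>\<psi> z\<bar> \<le> M * (z powr (2 * s) * exp (- \<delta> * z)) \<and>
     z * \<bar>deriv \<psi> z\<bar> \<le> M * (z powr (2 * s) * exp (- \<delta> * z))" if p: "profile s 1 \<psi>" and z: "z > 0" for \<psi> z
  proof
    have dec: "\<psi> y \<le> K * exp (- d * y)" if "y \<ge> 0" for y
      using profile_decay[OF p s d(1,2) that] by (simp add: K_def)
    have z2: "z\<^sup>2 = z powr (2 * s) * z powr (2 - 2 * s)"
      using z by (simp flip: powr_add)
    have "z\<^sup>2 * \<bar>\<psi> z\<bar> \<le> z\<^sup>2 * (K * exp (- d * z))"
      using dec[of z] profile_nonneg[OF p, of z] z by (intro mult_left_mono) auto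
    also have "\<dots> = K * z powr (2 * s) * (z powr (2 - 2 * s) * exp (- d * z))"
      by (simp add: z2)
    also have "\<dots> \<le> K * z powr (2 * s) * (C * exp (- \<delta> * z))"
      using C(2)[of z] z K by (intro mult_left_mono) auto
    also have "\<dots> = (K * C) * (z powr (2 * s) * exp (- \<delta> * z))" by simp
    also have "\<dots> \<le> M * (z powr (2 * s) * exp (- \<delta> * z))"
      using KCM by (intro mult_right_mono) auto
    finally show "z\<^sup>2 * \<bar>\<psi> z\<bar> \<le> M * (z powr (2 * s) * exp (- \<delta> * z))" .
    have np: "\<bar>deriv \<psi> y\<bar> = - deriv \<psi> y" if "y > 0" for y
      using profile_deriv_nonpos[OF p _ that] by simp
    have far: "\<bar>deriv \<psi> y\<bar> \<le> H * exp (- d * y)" if "y \<ge> 1" for y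
    proof -
      have "\<bar>deriv \<psi> y\<bar> \<le> 4 * \<psi> (y - 1/2)" using profile_deriv_decay[OF p s that] np that by simp
      also have "\<dots> \<le> 4 * (K * exp (- d * (y - 1/2)))" using dec[of "y - 1/2"] that by simp
      also have "exp (- d * (y - 1/2)) = exp (d / 2) * exp (- d * y)"
        by (simp add: algebra_simps flip: exp_add)
      finally show ?thesis by (simp add: H_def)
    qed
    show "z * \<bar>deriv \<psi> z\<bar> \<le> M * (z powr (2 * s) * exp (- \<delta> * z))"
    proof (cases "z \<ge> 1")
      case True
      have "z = z powr (2 * s) * z powr (1 - 2 * s)" using z by (simp flip: powr_add)
      also have "\<dots> \<le> z powr (2 * s) * z powr (2 - 2 * s)"
        using True by (intro mult_left_mono powr_mono) auto
      finally have "z * \<bar>deriv \<psi> z\<bar> \<le> (z powr (2 * s) * z powr (2 - 2 * s)) * (H * exp (- d * z))"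
        using far[OF True] z by (intro mult_mono) auto
      also have "\<dots> = H * z powr (2 * s) * (z powr (2 - 2 * s) * exp (- d * z))"
        by simp
      also have "\<dots> \<le> H * z powr (2 * s) * (C * exp (- \<delta> * z))"
        using C(2)[of z] z H by (intro mult_left_mono) auto
      also have "\<dots> = (H * C) * (z powr (2 * s) * exp (- \<delta> * z))" by simp
      also have "\<dots> \<le> M * (z powr (2 * s) * exp (- \<delta> * z))"
        using HCM by (intro mult_right_mono) auto
      finally show ?thesis .
    next
      case False
      have "z powr (1 - 2 * s) * (- deriv \<psi> z) \<le> - deriv \<psi> 1 + 1 / (2 - 2 * s) - z powr (2 - 2 * s) / (2 - 2 * s)"
        using profile_flux_mono(2)[OF p z _ s, of 1] False by simp
      also have "\<dots> \<le> H + 1 / (2 - 2 * s)"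
      proof -
        have "- deriv \<psi> 1 \<le> H * exp (- d)" using far[of 1] np[of 1] by simp
        also have "\<dots> \<le> H" using H d by simp
        finally show ?thesis using s z by (smt (verit) divide_nonneg_nonneg powr_ge_zero)
      qed
      finally have *: "z powr (1 - 2 * s) * (- deriv \<psi> z) \<le> H + 1 / (2 - 2 * s)" .
      have "z = z powr (2 * s) * z powr (1 - 2 * s)" using z by (simp flip: powr_add)
      then have "z * \<bar>deriv \<psi> z\<bar> = z powr (2 * s) * (z powr (1 - 2 * s) * (- deriv \<psi> z))"
        using np[OF z] by (metis mult.assoc)
      also have "\<dots> \<le> z powr (2 * s) * (H + 1 / (2 - 2 * s))"
        using * by (intro mult_left_mono) auto
      also have "\<dots> \<le> z powr (2 * s) * (((H + 1 / (2 - 2 * s)) * exp \<delta>) * exp (- \<delta> * z))"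
      proof (intro mult_left_mono)
        have "1 \<le> exp (\<delta> + - \<delta> * z)" using False \<delta> by simp
        then have "(H + 1 / (2 - 2 * s)) * 1 \<le> (H + 1 / (2 - 2 * s)) * exp (\<delta> + - \<delta> * z)"
          using H s by (intro mult_left_mono) auto
        then show "H + 1 / (2 - 2 * s) \<le> ((H + 1 / (2 - 2 * s)) * exp \<delta>) * exp (- \<delta> * z)"
          by (simp add: mult.assoc mult_exp_exp)
      qed auto
      also have "\<dots> \<le> z powr (2 * s) * (M * exp (- \<delta> * z))"
        using LM by (intro mult_left_mono mult_right_mono) auto
      also have "\<dots> = M * (z powr (2 * s) * exp (- \<delta> * z))" by simp
      finally show ?thesis .
    qed
  qed
  with M show ?thesis by blast
qed

text \<open>
  The parameter \<open>\<mu>\<close> is removed by the substitution \<open>z = \<surd>\<mu> y\<close>, so constants obtained for \<open>\<mu> = 1\<close> are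
  uniform in \<open>\<mu>\<close>.
\<close>

lemma profile_scale:
  assumes p: "profile s \<mu> \<psi>" and mu: "\<mu> > 0"
  shows "profile s 1 (\<lambda>z. \<psi> (z / sqrt \<mu>))"
    and "\<And>z. z > 0 \<Longrightarrow> deriv (\<lambda>z. \<psi> (z / sqrt \<mu>)) z = deriv \<psi> (z / sqrt \<mu>) / sqrt \<mu>"
proof -
  let ?r = "sqrt \<mu>" and ?g = "\<lambda>z. \<psi> (z / sqrt \<mu>)"
  have r: "?r > 0" "?r * ?r = \<mu>" using mu by auto
  have d1: "(?g has_real_derivative deriv \<psi> (z / ?r) / ?r) (at z)" if "z > 0" for z
  proof -
    have "((\<lambda>z. \<psi> (z / ?r)) has_real_derivative deriv \<psi> (z / ?r) * (1 / ?r)) (at z)"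
      by (rule DERIV_chain2[where g = "\<lambda>z. z / ?r"], rule profile_deriv(1)[OF p])
        (use that r in simp, rule DERIV_cdivide[OF DERIV_ident])
    then show ?thesis by simp
  qed
  then show D: "deriv ?g z = deriv \<psi> (z / ?r) / ?r" if "z > 0" for z
    using that by (intro DERIV_imp_deriv) auto
  have d2': "((\<lambda>z. deriv \<psi> (z / ?r) / ?r) has_real_derivative
     (\<mu> * \<psi> (z / ?r) - (1 - 2 * s) / (z / ?r) * deriv \<psi> (z / ?r)) / ?r / ?r) (at z)" if "z > 0" for z
  proof -
    have "((\<lambda>z. deriv \<psi> (z / ?r)) has_real_derivative
        (\<mu> * \<psi> (z / ?r) - (1 - 2 * s) / (z / ?r) * deriv \<psi> (z / ?r)) * (1 / ?r)) (at z)"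
      by (rule DERIV_chain2[where g = "\<lambda>z. z / ?r"], rule profile_deriv(2)[OF p])
        (use that r in simp, rule DERIV_cdivide[OF DERIV_ident])
    from DERIV_cdivide[OF this, of ?r] show ?thesis by simp
  qed
  have d2: "(deriv ?g has_real_derivative ?g z - (1 - 2 * s) / z * deriv ?g z) (at z)" if z: "z > 0" for z
  proof (rule has_field_derivative_transform_within_open[where S = "{0<..}"])
    have "(\<mu> * \<psi> (z / ?r) - (1 - 2 * s) / (z / ?r) * deriv \<psi> (z / ?r)) / ?r / ?r
        = ?g z - (1 - 2 * s) / z * deriv ?g z"
    proof -
      have aux: "(R * R * a - k / (z / R) * b) / R / R = a - k / z * (b / R)" if "R > 0" for R a k b :: real
        using that z by (simp add: field_simps)
      show ?thesis unfolding D[OF z] using aux[OF r(1)] by (simp only: r(2))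
    qed
    with d2'[OF z] show "((\<lambda>z. deriv \<psi> (z / ?r) / ?r) has_real_derivative ?g z - (1 - 2 * s) / z * deriv ?g z) (at z)"
      by simp
  qed (use z D in auto)
  show "profile s 1 ?g"
    unfolding profile_def
  proof (intro conjI allI impI)
    fix z :: real assume z: "z > 0"
    show "?g differentiable (at z)" using d1[OF z] by (auto simp: real_differentiable_def)
    show "deriv ?g differentiable (at z)" using d2[OF z] by (auto simp: real_differentiable_def)
    show "deriv (deriv ?g) z + (1 - 2 * s) / z * deriv ?g z = 1 * ?g z"
      using DERIV_imp_deriv[OF d2[OF z]] by simp
  next
    show "continuous_on {0..} ?g"
      by (rule continuous_on_compose2[OF profile_props(1)[OF p]]) (use r in \<open>auto intro!: continuous_intros\<close>)
    show "?g 0 = 1" using profile_props(2)[OF p] by simp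
    show "(?g \<longlongrightarrow> 0) at_top"
    proof (rule filterlim_compose[OF profile_props(3)[OF p]])
      show "filterlim (\<lambda>z. z / ?r) at_top at_top"
        using filterlim_tendsto_pos_mult_at_top[OF tendsto_const[of "1 / ?r"] _ filterlim_ident] r(1) by simp
    qed
  qed
qed

lemma profile_base_bound:
  fixes s \<delta> :: real
  assumes s: "0 < s" "s < 1" and \<delta>: "0 < \<delta>" "\<delta> < 1"
  shows "\<exists>M>0. \<forall>\<mu> \<psi>. 0 < \<mu> \<longrightarrow> profile s \<mu> \<psi> \<longrightarrow> (\<forall>y>0.
     \<mu> * y\<^sup>2 * \<bar>\<psi> y\<bar> \<le> M * ((sqrt \<mu> * y) powr (2 * s) * exp (- \<delta> * (sqrt \<mu> * y))) \<and>
     y * \<bar>deriv \<psi> y\<bar> \<le> M * ((sqrt \<mu> * y) powr (2 * s) * exp (- \<delta> * (sqrt \<mu> * y))))"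
proof -
  from profile_base_bound_unit[OF assms] obtain M where M: "M > 0"
    "\<And>\<psi> z. profile s 1 \<psi> \<Longrightarrow> z > 0 \<Longrightarrow> z\<^sup>2 * \<bar>\<psi> z\<bar> \<le> M * (z powr (2 * s) * exp (- \<delta> * z))"
    "\<And>\<psi> z. profile s 1 \<psi> \<Longrightarrow> z > 0 \<Longrightarrow> z * \<bar>deriv \<psi> z\<bar> \<le> M * (z powr (2 * s) * exp (- \<delta> * z))"
    by blast
  have "\<mu> * y\<^sup>2 * \<bar>\<psi> y\<bar> \<le> M * ((sqrt \<mu> * y) powr (2 * s) * exp (- \<delta> * (sqrt \<mu> * y))) \<and>
     y * \<bar>deriv \<psi> y\<bar> \<le> M * ((sqrt \<mu> * y) powr (2 * s) * exp (- \<delta> * (sqrt \<mu> * y)))"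
    if mu: "0 < \<mu>" and p: "profile s \<mu> \<psi>" and y: "y > 0" for \<mu> \<psi> y
  proof -
    have z: "sqrt \<mu> * y > 0" using mu y by simp
    show ?thesis
      using M(2)[OF profile_scale(1)[OF p mu] z] M(3)[OF profile_scale(1)[OF p mu] z]
        profile_scale(2)[OF p mu z] mu y
      by (simp add: power_mult_distrib abs_divide)
  qed
  with M(1) show ?thesis by blast
qed

section \<open>Derivatives of the profile of all orders\<close>

text \<open>
  The derivatives of a profile, defined from \<open>\<psi>\<close> and \<open>\<psi>'\<close> by the recursion that results from
  differentiating \<open>y \<psi>'' + (1 - 2s) \<psi>' = \<mu> y \<psi>\<close> \<open>m\<close> times. For \<open>m = 0\<close> the truncated index \<open>m - 1\<close> is
  harmless because of the factor \<open>m\<close>.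
\<close>

fun profile_deriv_seq :: "real \<Rightarrow> real \<Rightarrow> (real \<Rightarrow> real) \<Rightarrow> nat \<Rightarrow> real \<Rightarrow> real" where
  "profile_deriv_seq s \<mu> \<psi> 0 = \<psi>"
| "profile_deriv_seq s \<mu> \<psi> (Suc 0) = deriv \<psi>"
| "profile_deriv_seq s \<mu> \<psi> (Suc (Suc m)) = (\<lambda>y. \<mu> * profile_deriv_seq s \<mu> \<psi> m y
     + (\<mu> * real m * profile_deriv_seq s \<mu> \<psi> (m - 1) y
        - (real m + (1 - 2 * s)) * profile_deriv_seq s \<mu> \<psi> (Suc m) y) / y)"

lemma profile_deriv_seq_deriv:
  assumes p: "profile s \<mu> \<psi>" and y: "y > 0"
  shows "(profile_deriv_seq s \<mu> \<psi> m has_real_derivative profile_deriv_seq s \<mu> \<psi> (Suc m) y) (at y)"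
proof (induction m rule: less_induct)
  case (less m)
  let ?D = "profile_deriv_seq s \<mu> \<psi>"
  consider "m = 0" | "m = Suc 0" | k where "m = Suc (Suc k)"
    by (metis not0_implies_Suc)
  then show ?case
  proof cases
    case 1
    then show ?thesis using profile_deriv(1)[OF p y] by simp
  next
    case 2
    have "?D (Suc (Suc 0)) y = \<mu> * \<psi> y - (1 - 2 * s) / y * deriv \<psi> y" by simp
    with profile_deriv(2)[OF p y] show ?thesis unfolding 2 by (simp only: profile_deriv_seq.simps(2))
  next
    case 3
    have a: "(?D k has_real_derivative ?D (Suc k) y) (at y)" using less 3 by simp
    have b: "(?D (Suc k) has_real_derivative ?D (Suc (Suc k)) y) (at y)" using less 3 by blast
    have c: "((\<lambda>y. \<mu> * real k * ?D (k - 1) y) has_real_derivative \<mu> * real k * ?D k y) (at y)"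
    proof (cases k)
      case (Suc j)
      then have "(?D (k - 1) has_real_derivative ?D k y) (at y)" using less 3 by simp
      then show ?thesis by (rule DERIV_cmult)
    qed simp
    have "((\<lambda>y. \<mu> * ?D k y + (\<mu> * real k * ?D (k - 1) y - (real k + (1 - 2 * s)) * ?D (Suc k) y) / y)
       has_real_derivative \<mu> * ?D (Suc k) y +
        ((\<mu> * real k * ?D k y - (real k + (1 - 2 * s)) * ?D (Suc (Suc k)) y) * y
          - (\<mu> * real k * ?D (k - 1) y - (real k + (1 - 2 * s)) * ?D (Suc k) y) * 1) / (y * y)) (at y)"
      by (intro DERIV_add DERIV_cmult DERIV_divide DERIV_diff DERIV_ident a b c) (use y in auto)
    moreover have "\<mu> * ?D (Suc k) y +
        ((\<mu> * real k * ?D k y - (real k + (1 - 2 * s)) * ?D (Suc (Suc k)) y) * y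
          - (\<mu> * real k * ?D (k - 1) y - (real k + (1 - 2 * s)) * ?D (Suc k) y) * 1) / (y * y)
        = ?D (Suc (Suc (Suc k))) y"
    proof -
      have "\<mu> * real k * ?D (k - 1) y - (real k + (1 - 2 * s)) * ?D (Suc k) y
          = y * (?D (Suc (Suc k)) y - \<mu> * ?D k y)"
        using y by simp
      moreover have "?D (Suc (Suc (Suc k))) y = \<mu> * ?D (Suc k) y
         + (\<mu> * real (Suc k) * ?D k y - (real (Suc k) + (1 - 2 * s)) * ?D (Suc (Suc k)) y) / y"
        by (simp only: profile_deriv_seq.simps(3)[where m = "Suc k"] diff_Suc_1)
      ultimately show ?thesis using y
        by (simp only: of_nat_Suc) (simp add: field_simps del: profile_deriv_seq.simps)
    qed
    ultimately show ?thesis unfolding 3 profile_deriv_seq.simps(3)[of s \<mu> \<psi> k] by simp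
  qed
qed

text \<open>
  Partial sums of the exponential series grow only like \<open>exp(\<epsilon> x)\<close>, at the price of a factor that is
  geometric in the number of terms. This keeps almost all of the exponential decay of the profile.
\<close>

lemma exp_partial_le:
  fixes x \<epsilon> :: real
  assumes "0 \<le> x" "0 < \<epsilon>" "\<epsilon> \<le> 1"
  shows "(\<Sum>j\<le>m. x ^ j / fact j) \<le> exp (\<epsilon> * x) / \<epsilon> ^ m"
proof -
  have "(\<Sum>j\<le>m. x ^ j / fact j) \<le> (\<Sum>j\<le>m. (\<epsilon> * x) ^ j / fact j / \<epsilon> ^ m)"
  proof (rule sum_mono)
    fix j assume j: "j \<in> {..m}"
    have "\<epsilon> ^ m \<le> \<epsilon> ^ j" using j assms by (intro power_decreasing) auto
    then have "x ^ j / fact j * \<epsilon> ^ m \<le> x ^ j / fact j * \<epsilon> ^ j"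
      using assms by (intro mult_left_mono) auto
    then show "x ^ j / fact j \<le> (\<epsilon> * x) ^ j / fact j / \<epsilon> ^ m"
      using assms by (simp add: field_simps power_mult_distrib)
  qed
  also have "\<dots> = (\<Sum>j\<le>m. (\<epsilon> * x) ^ j / fact j) / \<epsilon> ^ m" by (simp add: sum_divide_distrib)
  also have "(\<Sum>j\<le>m. (\<epsilon> * x) ^ j / fact j) \<le> exp (\<epsilon> * x)"
  proof -
    have "(\<Sum>j\<in>{..m}. (\<epsilon> * x) ^ j /\<^sub>R fact j) \<le> (\<Sum>j. (\<epsilon> * x) ^ j /\<^sub>R fact j)"
      by (rule sum_le_suminf) (use assms in \<open>auto intro: summable_exp\<close>)
    then show ?thesis by (simp add: exp_def divide_inverse mult.commute)
  qed
  finally show ?thesis using assms by (simp add: divide_right_mono)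
qed

text \<open>
  Multiplication by \<open>z\<^sup>2\<close> shifts the sum by two indices, and \<open>j \<le> m\<close> lets \<open>m!\<close> pay for the change of the
  denominators.
\<close>

lemma sum_power_fact_shift:
  fixes z :: real
  assumes z: "0 \<le> z"
  shows "z\<^sup>2 * (fact m * (\<Sum>j\<le>m. z ^ j / fact j)) \<le> fact (m + 2) * (\<Sum>j\<le>m + 2. z ^ j / fact j)"
proof -
  have "z\<^sup>2 * (fact m * (\<Sum>j\<le>m. z ^ j / fact j)) = (\<Sum>j\<le>m. fact m * (z ^ (j + 2) / fact j))"
    by (simp add: sum_distrib_left power_add power2_eq_square mult_ac)
  also have "\<dots> \<le> (\<Sum>j\<le>m. fact (m + 2) * (z ^ (j + 2) / fact (j + 2)))"
  proof (rule sum_mono)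
    fix j assume j: "j \<in> {..m}"
    have f2: "fact (n + 2) = (real n + 2) * (real n + 1) * fact n" for n
      by (simp add: algebra_simps)
    have "(fact m * ((real j + 2) * (real j + 1)) :: real) \<le> fact m * ((real m + 2) * (real m + 1))"
      using j by (intro mult_left_mono mult_mono) auto
    also have "\<dots> = fact (m + 2)" unfolding f2[of m] by (simp only: mult.commute)
    finally have "fact m * ((real j + 2) * (real j + 1)) * (z ^ (j + 2) / fact (j + 2)) \<le>
       fact (m + 2) * (z ^ (j + 2) / fact (j + 2))"
      using z by (intro mult_right_mono) auto
    moreover have "fact m * ((real j + 2) * (real j + 1)) * (z ^ (j + 2) / fact (j + 2))
       = fact m * (z ^ (j + 2) / fact j)"
    proof -
      have aux: "F * q * (w / (q * f)) = F * (w / f)" if "q \<noteq> 0" for F q w f :: real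
        using that by simp
      have "(real j + 2) * (real j + 1) \<noteq> 0" by auto
      from aux[OF this] show ?thesis unfolding f2[of j] .
    qed
    ultimately show "fact m * (z ^ (j + 2) / fact j) \<le> fact (m + 2) * (z ^ (j + 2) / fact (j + 2))"
      by simp
  qed
  also have "\<dots> = fact (m + 2) * (\<Sum>j\<in>(\<lambda>j. j + 2) ` {..m}. z ^ j / fact j)"
    by (subst sum.reindex) (auto simp: sum_distrib_left inj_on_def)
  also have "\<dots> \<le> fact (m + 2) * (\<Sum>j\<le>m + 2. z ^ j / fact j)"
    using z by (intro mult_left_mono sum_mono2) auto
  finally show ?thesis .
qed

text \<open>
  With \<open>z = \<surd>\<mu> y\<close> the quantities \<open>a m = y^m |D m|\<close> satisfy
  \<open>a (m + 2) \<le> z\<^sup>2 a m + m z\<^sup>2 a (m - 1) + (m + 1) a (m + 1)\<close>. The majorants \<open>S m = m! (\<Sum>j\<le>m. z^j / j!)\<close>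
  satisfy \<open>z\<^sup>2 S m \<le> S (m + 2)\<close> and \<open>(m + 1) S m \<le> S (m + 1)\<close>, so \<open>B 2^m S m\<close> reproduces itself under the
  recursion: the three terms contribute \<open>1 + 1 + 2 = 2\<^sup>2\<close> times \<open>B 2^m S (m + 2)\<close>.
\<close>

lemma profile_deriv_seq_bound:
  assumes p: "profile s \<mu> \<psi>" and mu: "\<mu> > 0" and y: "y > 0" and s: "0 < s" "s < 1"
    and b0: "\<mu> * y\<^sup>2 * \<bar>\<psi> y\<bar> \<le> B" and b1: "y * \<bar>deriv \<psi> y\<bar> \<le> B"
  shows "y ^ Suc m * \<bar>profile_deriv_seq s \<mu> \<psi> (Suc m) y\<bar>
     \<le> B * 2 ^ Suc m * (fact (Suc m) * (\<Sum>j\<le>Suc m. (sqrt \<mu> * y) ^ j / fact j))"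
proof -
  define D where "D = profile_deriv_seq s \<mu> \<psi>"
  have D0: "D 0 = \<psi>" and D1: "D (Suc 0) = deriv \<psi>"
    and D2: "D (Suc (Suc m)) y = \<mu> * D m y
      + (\<mu> * real m * D (m - 1) y - (real m + (1 - 2 * s)) * D (Suc m) y) / y" for m
    by (simp_all add: D_def)
  define z where "z = sqrt \<mu> * y"
  have z: "z > 0" "z\<^sup>2 = \<mu> * y\<^sup>2" using mu y by (auto simp: z_def power_mult_distrib)
  define S where "S m = (fact m * (\<Sum>j\<le>m. z ^ j / fact j) :: real)" for m
  define a where "a m = y ^ m * \<bar>D m y\<bar>" for m
  have B: "B \<ge> 0" using order_trans[OF mult_nonneg_nonneg b1] y by simp
  have S2: "z\<^sup>2 * S m \<le> S (m + 2)" for m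
    unfolding S_def using sum_power_fact_shift[of z m] z by simp
  have S1: "(real m + 1) * S m \<le> S (Suc m)" for m
  proof -
    have "(real m + 1) * S m = fact (Suc m) * (\<Sum>j\<le>m. z ^ j / fact j)"
      by (simp add: S_def algebra_simps)
    also have "\<dots> \<le> S (Suc m)" unfolding S_def
      using z by (intro mult_left_mono sum_mono2) auto
    finally show ?thesis .
  qed
  have S0: "S 0 = 1" by (simp add: S_def)
  have Sge: "S m \<ge> 1" for m
  proof (induction m)
    case (Suc m)
    have "1 * 1 \<le> (real m + 1) * S m" using Suc by (intro mult_mono) auto
    then show ?case using S1[of m] by linarith
  qed (simp add: S0)
  have alg: "y ^ Suc m * (\<mu> * y * d0 + (\<mu> * real m * d1 - k * d2))
      = \<mu> * y\<^sup>2 * (y ^ m * d0) + (if m = 0 then 0 else real m * (\<mu> * y\<^sup>2 * (y ^ (m - 1) * d1)))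
        - k * (y ^ Suc m * d2)" for m and d0 d1 d2 k :: real
    by (cases m) (simp_all add: power2_eq_square algebra_simps)
  have tri: "\<bar>p + q - r\<bar> \<le> \<bar>p\<bar> + \<bar>q\<bar> + \<bar>r\<bar>" for p q r :: real by linarith
  have rec: "a (Suc (Suc m)) \<le> z\<^sup>2 * a m + real m * (z\<^sup>2 * a (m - 1)) + (real m + 1) * a (Suc m)" for m
  proof -
    have "y ^ Suc (Suc m) * D (Suc (Suc m)) y
       = z\<^sup>2 * (y ^ m * D m y) + (if m = 0 then 0 else real m * (z\<^sup>2 * (y ^ (m - 1) * D (m - 1) y)))
         - (real m + (1 - 2 * s)) * (y ^ Suc m * D (Suc m) y)"
    proof -
      have e: "y * D (Suc (Suc m)) y = \<mu> * y * D m y + (\<mu> * real m * D (m - 1) y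
          - (real m + (1 - 2 * s)) * D (Suc m) y)"
        using y unfolding D2 by (simp add: distrib_left)
      have "y ^ Suc (Suc m) * D (Suc (Suc m)) y = y ^ Suc m * (y * D (Suc (Suc m)) y)"
        by (simp only: power_Suc mult_ac)
      also have "\<dots> = z\<^sup>2 * (y ^ m * D m y) + (if m = 0 then 0 else real m * (z\<^sup>2 * (y ^ (m - 1) * D (m - 1) y)))
         - (real m + (1 - 2 * s)) * (y ^ Suc m * D (Suc m) y)"
        unfolding e z(2)
        by (rule alg)
      finally show ?thesis .
    qed
    also have "(if m = 0 then 0 else real m * (z\<^sup>2 * (y ^ (m - 1) * D (m - 1) y)))
        = real m * (z\<^sup>2 * (y ^ (m - 1) * D (m - 1) y))" by simp
    finally have "\<bar>y ^ Suc (Suc m) * D (Suc (Suc m)) y\<bar>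
       \<le> \<bar>z\<^sup>2 * (y ^ m * D m y)\<bar> + \<bar>real m * (z\<^sup>2 * (y ^ (m - 1) * D (m - 1) y))\<bar>
         + \<bar>(real m + (1 - 2 * s)) * (y ^ Suc m * D (Suc m) y)\<bar>"
      by (simp only: tri)
    also have "\<bar>(real m + (1 - 2 * s)) * (y ^ Suc m * D (Suc m) y)\<bar> = \<bar>real m + (1 - 2 * s)\<bar> * a (Suc m)"
      using y unfolding a_def abs_mult by simp
    also have "\<dots> \<le> (real m + 1) * a (Suc m)"
      using s y by (intro mult_right_mono) (auto simp: a_def)
    finally show ?thesis using y unfolding a_def abs_mult by simp
  qed
  have a0: "z\<^sup>2 * a 0 \<le> B" using b0 by (simp add: a_def z D0)
  have a1: "a (Suc 0) \<le> B" using b1 by (simp add: a_def D1)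
  have zz: "z\<^sup>2 * a j \<le> B * 2 ^ j * S (j + 2)" if "j = 0 \<or> a j \<le> B * 2 ^ j * S j" for j
  proof (cases "j = 0")
    case True
    have "B * 1 \<le> B * S 2" using Sge[of 2] B by (intro mult_left_mono)
    then show ?thesis using a0 True by (simp add: numeral_2_eq_2)
  next
    case False
    then have "z\<^sup>2 * a j \<le> z\<^sup>2 * (B * 2 ^ j * S j)" using that by (intro mult_left_mono) auto
    also have "\<dots> \<le> B * 2 ^ j * S (j + 2)"
      using mult_left_mono[OF S2[of j], of "B * 2 ^ j"] B by (simp add: mult_ac)
    finally show ?thesis .
  qed
  have "a (Suc m) \<le> B * 2 ^ Suc m * S (Suc m)"
  proof (induction m rule: less_induct)
    case (less m)
    show ?case
    proof (cases m)
      case 0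
      then show ?thesis using a1 Sge[of 1] B mult_left_mono[of 1 "2 * S 1" B] by simp
    next
      case (Suc k)
      let ?X = "B * 2 ^ k" and ?T = "S (Suc (Suc k))"
      have X: "0 \<le> ?X" using B by simp
      have IH: "j = 0 \<or> a j \<le> B * 2 ^ j * S j" if "j \<le> Suc k" for j
        using less[of "j - 1"] that Suc by (cases j) auto
      have t1: "z\<^sup>2 * a k \<le> ?X * ?T" using zz[OF IH[of k]] by simp
      have S1': "(real k + 2) * S (Suc k) \<le> ?T" using S1[of "Suc k"] by (simp add: add_ac)
      have t2: "real k * (z\<^sup>2 * a (k - 1)) \<le> ?X * ?T"
      proof (cases k)
        case 0
        then show ?thesis using X Sge[of "Suc (Suc k)"] by simp
      next
        case (Suc i)
        have "real k * (z\<^sup>2 * a (k - 1)) \<le> (real k + 2) * (?X * S (Suc k))"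
        proof (rule mult_mono)
          have "z\<^sup>2 * a (k - 1) \<le> B * 2 ^ i * S (Suc k)" using zz[OF IH[of i]] Suc by simp
          also have "\<dots> \<le> ?X * S (Suc k)"
            using Suc B Sge[of "Suc k"] by (intro mult_right_mono mult_left_mono) auto
          finally show "z\<^sup>2 * a (k - 1) \<le> ?X * S (Suc k)" .
        qed (use y in \<open>auto simp: a_def\<close>)
        also have "\<dots> \<le> ?X * ?T" using mult_left_mono[OF S1' X] by (simp only: mult_ac)
        finally show ?thesis .
      qed
      have t3: "(real k + 1) * a (Suc k) \<le> 2 * ?X * ?T"
      proof -
        have "(real k + 1) * a (Suc k) \<le> (real k + 2) * (2 * ?X * S (Suc k))"
          using IH[of "Suc k"] y by (intro mult_mono) (auto simp: a_def mult_ac)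
        also have "\<dots> \<le> 2 * ?X * ?T" using mult_left_mono[OF S1', of "2 * ?X"] X by (simp only: mult_ac)
        finally show ?thesis .
      qed
      have "a (Suc (Suc k)) \<le> ?X * ?T + ?X * ?T + 2 * ?X * ?T" using rec[of k] t1 t2 t3 by linarith
      then show ?thesis using Suc by (simp add: mult_ac)
    qed
  qed
  then show ?thesis by (simp only: a_def S_def z_def D_def)
qed

section \<open>Weighted integrals of the derivatives of the profile\<close>

text \<open>
  Factorial growth in the order \<open>m\<close> with an exponential decay rate as close to 1 as desired; this is the
  real-variable substitute for Cauchy's estimates on discs of radius proportional to \<open>y\<close>.
\<close>

lemma profile_deriv_seq_decay:
  fixes s \<eta> :: real
  assumes s: "0 < s" "s < 1" and \<eta>: "0 < \<eta>" "\<eta> < 1"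
  shows "\<exists>\<kappa>>1. \<exists>M>0. \<forall>\<mu>>0. \<forall>\<psi>. profile s \<mu> \<psi> \<longrightarrow> (\<forall>m. \<forall>y>0.
     y ^ Suc m * \<bar>profile_deriv_seq s \<mu> \<psi> (Suc m) y\<bar>
       \<le> M * \<kappa> ^ Suc m * fact (Suc m) * ((sqrt \<mu> * y) powr (2 * s) * exp (- \<eta> * (sqrt \<mu> * y))))"
proof -
  \<comment> \<open>Here \<open>\<delta> < 1\<close> is the decay rate of the profile and \<open>\<epsilon>\<close> the part of it spent on the sum, with \<open>\<delta> - \<epsilon> = \<eta>\<close>.\<close>
  define \<delta> where "\<delta> = (1 + \<eta>) / 2"
  define \<epsilon> where "\<epsilon> = (1 - \<eta>) / 2"
  have \<delta>: "0 < \<delta>" "\<delta> < 1" and \<epsilon>: "0 < \<epsilon>" "\<epsilon> \<le> 1" "\<delta> - \<epsilon> = \<eta>" using \<eta> by (auto simp: \<delta>_def \<epsilon>_def field_simps)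
  from profile_base_bound[OF s \<delta>] obtain M where M: "M > 0" and
    MB: "\<And>\<mu> \<psi> y. 0 < \<mu> \<Longrightarrow> profile s \<mu> \<psi> \<Longrightarrow> y > 0 \<Longrightarrow>
     \<mu> * y\<^sup>2 * \<bar>\<psi> y\<bar> \<le> M * ((sqrt \<mu> * y) powr (2 * s) * exp (- \<delta> * (sqrt \<mu> * y))) \<and>
     y * \<bar>deriv \<psi> y\<bar> \<le> M * ((sqrt \<mu> * y) powr (2 * s) * exp (- \<delta> * (sqrt \<mu> * y)))"
    by blast
  define \<kappa> where "\<kappa> = 2 / \<epsilon>"
  have \<kappa>: "\<kappa> > 1" using \<epsilon> by (simp add: \<kappa>_def field_simps)
  have "y ^ Suc m * \<bar>profile_deriv_seq s \<mu> \<psi> (Suc m) y\<bar>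
       \<le> M * \<kappa> ^ Suc m * fact (Suc m) * ((sqrt \<mu> * y) powr (2 * s) * exp (- \<eta> * (sqrt \<mu> * y)))"
    if mu: "\<mu> > 0" and p: "profile s \<mu> \<psi>" and y: "y > 0" for \<mu> \<psi> m y
  proof -
    define z where "z = sqrt \<mu> * y"
    have z: "z > 0" using mu y by (simp add: z_def)
    define B where "B = M * (z powr (2 * s) * exp (- \<delta> * z))"
    have B: "B \<ge> 0" using M by (simp add: B_def)
    have "y ^ Suc m * \<bar>profile_deriv_seq s \<mu> \<psi> (Suc m) y\<bar>
       \<le> B * 2 ^ Suc m * (fact (Suc m) * (\<Sum>j\<le>Suc m. z ^ j / fact j))"
      unfolding z_def using MB[OF mu p y]
      by (intro profile_deriv_seq_bound[OF p mu y s]) (auto simp: B_def z_def)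
    also have "\<dots> \<le> B * 2 ^ Suc m * (fact (Suc m) * (exp (\<epsilon> * z) / \<epsilon> ^ Suc m))"
      using B z \<epsilon> by (intro mult_left_mono exp_partial_le) auto
    also have "\<dots> = M * \<kappa> ^ Suc m * fact (Suc m) * (z powr (2 * s) * (exp (- \<delta> * z) * exp (\<epsilon> * z)))"
      unfolding B_def \<kappa>_def power_divide by (simp only: times_divide_eq_left times_divide_eq_right mult_ac)
    also have "exp (- \<delta> * z) * exp (\<epsilon> * z) = exp (- \<eta> * z)"
      by (simp add: \<epsilon>(3)[symmetric] algebra_simps flip: exp_add)
    finally show ?thesis by (simp only: z_def)
  qed
  with \<kappa> M show ?thesis by blast
qed

lemma nn_integral_powr_exp:
  fixes a p :: real
  assumes a: "a > 0" and p: "p > 0"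
  shows "(\<integral>\<^sup>+y\<in>{0<..}. ennreal (y powr (p - 1) * exp (- a * y)) \<partial>lborel) = ennreal (Gamma p / a powr p)"
proof -
  define I where "I = (\<integral>\<^sup>+y\<in>{0<..}. ennreal (y powr (p - 1) * exp (- a * y)) \<partial>lborel)"
  let ?f = "\<lambda>t::real. ennreal (t powr (p - 1) / exp t) * indicator {0..} t"
  have "ennreal (Gamma p) = integral\<^sup>N lborel ?f"
    using nn_integral_has_integral_lebesgue'[OF _ Gamma_integral_real[OF p]] by simp
  also have "\<dots> = ennreal \<bar>a\<bar> * (\<integral>\<^sup>+x. ?f (0 + a * x) \<partial>lborel)"
    using a by (intro nn_integral_real_affine) auto
  also have "(\<integral>\<^sup>+x. ?f (0 + a * x) \<partial>lborel)
     = (\<integral>\<^sup>+x. ennreal (a powr (p - 1)) * (ennreal (x powr (p - 1) * exp (- a * x)) * indicator {0<..} x) \<partial>lborel)"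
  proof (intro nn_integral_cong)
    fix x :: real
    show "?f (0 + a * x) = ennreal (a powr (p - 1)) * (ennreal (x powr (p - 1) * exp (- a * x)) * indicator {0<..} x)"
      using a by (cases "x > 0"; cases "x = 0")
        (auto simp: indicator_def powr_mult exp_minus divide_inverse zero_le_mult_iff mult_ac simp flip: ennreal_mult)
  qed
  also have "\<dots> = ennreal (a powr (p - 1)) * I"
    unfolding I_def by (intro nn_integral_cmult) auto
  finally have "ennreal (Gamma p) = ennreal (a * a powr (p - 1)) * I"
    using a by (simp add: ennreal_mult mult.assoc)
  also have "a * a powr (p - 1) = a powr p" using a by (simp add: powr_diff)
  finally have e: "ennreal (Gamma p) = ennreal (a powr p) * I" .
  have "ennreal (Gamma p / a powr p) = ennreal (1 / a powr p) * ennreal (Gamma p)"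
    using p by (simp flip: ennreal_mult add: Gamma_real_pos less_imp_le)
  also have "\<dots> = (ennreal (1 / a powr p) * ennreal (a powr p)) * I" by (simp only: e mult.assoc)
  also have "ennreal (1 / a powr p) * ennreal (a powr p) = 1"
    using a by (simp flip: ennreal_mult)
  finally show ?thesis by (simp add: I_def)
qed

text \<open>
  The exponent is arranged such that the value scales like \<open>\<mu> powr (s + \<rho> - 1)\<close> for every \<open>l\<close>. The estimate of
  the \<open>y\<close>-derivative is the case \<open>\<rho> = \<sigma> + 1\<close>, the other two are the case \<open>\<rho> = \<nu>\<close>.
\<close>

definition profile_energy :: "real \<Rightarrow> real \<Rightarrow> real \<Rightarrow> real \<Rightarrow> (real \<Rightarrow> real) \<Rightarrow> nat \<Rightarrow> ennreal" where
  "profile_energy s \<theta> \<rho> \<mu> \<psi> l =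
     (\<integral>\<^sup>+y\<in>{0<..}. ennreal (y powr (1 - 2 * s + 2 * real (l + 1) - 2 * \<rho>) * exp (\<theta> * y)
         * (profile_deriv_seq s \<mu> \<psi> (l + 1) y)\<^sup>2) \<partial>lborel)"

text \<open>
  Near 0 the integrand is bounded by \<open>y powr (1 + 2s - 2\<rho>)\<close>, which is integrable for \<open>\<rho> < 1 + s\<close>. At infinity
  the decay rate of the squared derivative is \<open>2\<eta> \<surd>\<mu>\<close> with \<open>\<theta>\<^sub>0 < 2\<eta> < 2\<close>, which beats the weight. The base
  \<open>\<kappa>\<close> depends on \<open>\<eta>\<close> only and is common to all \<open>\<rho>\<close>.
\<close>

lemma profile_deriv_seq_weighted_bound:
  fixes s \<theta>\<^sub>0 :: real
  assumes s: "0 < s" "s < 1" and \<theta>\<^sub>0: "0 \<le> \<theta>\<^sub>0" "\<theta>\<^sub>0 < 2"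
  shows "\<exists>\<kappa>>1. \<forall>\<rho><1 + s. \<exists>C>0. \<forall>\<mu>>0. \<forall>\<psi> \<theta> l. profile s \<mu> \<psi> \<longrightarrow> \<theta> \<le> \<theta>\<^sub>0 * sqrt \<mu> \<longrightarrow>
     profile_energy s \<theta> \<rho> \<mu> \<psi> l \<le> ennreal (C * \<kappa> ^ (2 * (l + 1)) * (fact (l + 1))\<^sup>2 * \<mu> powr (s + \<rho> - 1))"
proof -
  \<comment> \<open>Any \<open>\<eta>\<close> strictly between \<open>\<theta>\<^sub>0 / 2\<close> and 1 would do.\<close>
  define \<eta> where "\<eta> = (2 + \<theta>\<^sub>0) / 4"
  have \<eta>: "0 < \<eta>" "\<eta> < 1" "\<theta>\<^sub>0 < 2 * \<eta>" using \<theta>\<^sub>0 by (auto simp: \<eta>_def)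
  define \<tau> where "\<tau> = 2 * \<eta> - \<theta>\<^sub>0"
  have \<tau>: "\<tau> > 0" using \<eta> by (simp add: \<tau>_def)
  from profile_deriv_seq_decay[OF s \<eta>(1,2)] obtain \<kappa> M where \<kappa>: "\<kappa> > 1" and M: "M > 0" and
    KM: "\<And>\<mu> \<psi> m y. \<mu> > 0 \<Longrightarrow> profile s \<mu> \<psi> \<Longrightarrow> y > 0 \<Longrightarrow>
     y ^ Suc m * \<bar>profile_deriv_seq s \<mu> \<psi> (Suc m) y\<bar>
       \<le> M * \<kappa> ^ Suc m * fact (Suc m) * ((sqrt \<mu> * y) powr (2 * s) * exp (- \<eta> * (sqrt \<mu> * y)))"
    by blast
  have "\<exists>C>0. \<forall>\<mu>>0. \<forall>\<psi> \<theta> l. profile s \<mu> \<psi> \<longrightarrow> \<theta> \<le> \<theta>\<^sub>0 * sqrt \<mu> \<longrightarrow>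
     profile_energy s \<theta> \<rho> \<mu> \<psi> l \<le> ennreal (C * \<kappa> ^ (2 * (l + 1)) * (fact (l + 1))\<^sup>2 * \<mu> powr (s + \<rho> - 1))"
    if \<rho>: "\<rho> < 1 + s" for \<rho>
  proof -
    define p where "p = 2 * (1 + s - \<rho>)"
    have p: "p > 0" using \<rho> by (simp add: p_def)
    define C where "C = M\<^sup>2 * (Gamma p / \<tau> powr p)"
    have C: "C > 0" using M p \<tau> by (simp add: C_def Gamma_real_pos)
    have "profile_energy s \<theta> \<rho> \<mu> \<psi> l \<le> ennreal (C * \<kappa> ^ (2 * (l + 1)) * (fact (l + 1))\<^sup>2 * \<mu> powr (s + \<rho> - 1))"
      if mu: "\<mu> > 0" and pr: "profile s \<mu> \<psi>" and \<theta>: "\<theta> \<le> \<theta>\<^sub>0 * sqrt \<mu>" for \<mu> \<psi> \<theta> l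
    proof -
      define r where "r = sqrt \<mu>"
      have r: "r > 0" using mu by (simp add: r_def)
      define E where "E = M\<^sup>2 * \<kappa> ^ (2 * (l + 1)) * (fact (l + 1))\<^sup>2 * r powr (4 * s)"
      have E: "E \<ge> 0" using \<kappa> unfolding E_def by (intro mult_nonneg_nonneg) auto
      have pt: "y powr (1 - 2 * s + 2 * real (l + 1) - 2 * \<rho>) * exp (\<theta> * y)
         * (profile_deriv_seq s \<mu> \<psi> (l + 1) y)\<^sup>2 \<le> E * (y powr (p - 1) * exp (- (\<tau> * r) * y))"
        if y: "y > 0" for y
      proof -
        let ?D = "profile_deriv_seq s \<mu> \<psi> (Suc l) y"
        have "(y ^ Suc l * \<bar>?D\<bar>)\<^sup>2 \<le> (M * \<kappa> ^ Suc l * fact (Suc l) * ((r * y) powr (2 * s) * exp (- \<eta> * (r * y))))\<^sup>2"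
          unfolding r_def using KM[OF mu pr y, of l] y by (intro power_mono) auto
        also have "\<dots> = M\<^sup>2 * \<kappa> ^ (2 * (l + 1)) * (fact (l + 1))\<^sup>2 * (((r * y) powr (2 * s))\<^sup>2 * (exp (- \<eta> * (r * y)))\<^sup>2)"
          by (simp only: power_mult_distrib Suc_eq_plus1 power_even_eq)
        also have "((r * y) powr (2 * s))\<^sup>2 = r powr (4 * s) * y powr (4 * s)"
        proof -
          have "(x powr (2 * s))\<^sup>2 = x powr (4 * s)" for x :: real
            by (simp add: power2_eq_square flip: powr_add)
          then show ?thesis using r y by (simp add: powr_mult power_mult_distrib)
        qed
        also have "(exp (- \<eta> * (r * y)))\<^sup>2 = exp (- (2 * \<eta> * r) * y)"
          by (simp add: power2_eq_square flip: exp_add)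
        finally have sqle: "(y ^ Suc l * \<bar>?D\<bar>)\<^sup>2 \<le> M\<^sup>2 * \<kappa> ^ (2 * (l + 1)) * (fact (l + 1))\<^sup>2 * (r powr (4 * s) * y powr (4 * s) * exp (- (2 * \<eta> * r) * y))" .
        have sq: "y ^ (2 * Suc l) * ?D\<^sup>2 \<le> E * (y powr (4 * s) * exp (- (2 * \<eta> * r) * y))"
        proof -
          have "y ^ (2 * Suc l) * ?D\<^sup>2 = (y ^ Suc l * \<bar>?D\<bar>)\<^sup>2"
            by (simp only: power_mult_distrib power2_abs power_even_eq)
          with sqle show ?thesis unfolding E_def by (simp only: mult.assoc)
        qed
        have w: "y powr (1 - 2 * s + 2 * real (l + 1) - 2 * \<rho>) = y powr (p - 1 - 4 * s) * y ^ (2 * Suc l)"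
        proof -
          have "y ^ (2 * Suc l) = y powr (real (2 * Suc l))" using y by (simp only: powr_realpow)
          moreover have "1 - 2 * s + 2 * real (l + 1) - 2 * \<rho> = (p - 1 - 4 * s) + real (2 * Suc l)"
            by (simp add: p_def)
          ultimately show ?thesis by (simp only: powr_add)
        qed
        have "y powr (1 - 2 * s + 2 * real (l + 1) - 2 * \<rho>) * exp (\<theta> * y) * ?D\<^sup>2
          = y powr (p - 1 - 4 * s) * exp (\<theta> * y) * (y ^ (2 * Suc l) * ?D\<^sup>2)"
          unfolding w by (simp only: mult_ac)
        also have "\<dots> \<le> y powr (p - 1 - 4 * s) * exp (\<theta>\<^sub>0 * r * y) * (E * (y powr (4 * s) * exp (- (2 * \<eta> * r) * y)))"
        proof (rule mult_mono[OF _ sq])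
          show "y powr (p - 1 - 4 * s) * exp (\<theta> * y) \<le> y powr (p - 1 - 4 * s) * exp (\<theta>\<^sub>0 * r * y)"
            using y \<theta> by (intro mult_left_mono) (auto simp: r_def)
        qed (use y in auto)
        also have "\<dots> = E * ((y powr (p - 1 - 4 * s) * y powr (4 * s)) * (exp (\<theta>\<^sub>0 * r * y) * exp (- (2 * \<eta> * r) * y)))"
          by (simp only: mult_ac)
        also have "y powr (p - 1 - 4 * s) * y powr (4 * s) = y powr (p - 1)"
          by (simp flip: powr_add)
        also have "exp (\<theta>\<^sub>0 * r * y) * exp (- (2 * \<eta> * r) * y) = exp (- (\<tau> * r) * y)"
          by (simp add: \<tau>_def algebra_simps flip: exp_add)
        finally show ?thesis by simp
      qed
      have "profile_energy s \<theta> \<rho> \<mu> \<psi> l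
        \<le> (\<integral>\<^sup>+y. ennreal E * (ennreal (y powr (p - 1) * exp (- (\<tau> * r) * y)) * indicator {0<..} y) \<partial>lborel)"
        unfolding profile_energy_def
      proof (intro nn_integral_mono)
        fix y :: real
        show "ennreal (y powr (1 - 2 * s + 2 * real (l + 1) - 2 * \<rho>) * exp (\<theta> * y)
         * (profile_deriv_seq s \<mu> \<psi> (l + 1) y)\<^sup>2) * indicator {0<..} y
          \<le> ennreal E * (ennreal (y powr (p - 1) * exp (- (\<tau> * r) * y)) * indicator {0<..} y)"
        proof (cases "y > 0")
          case True
          from ennreal_leI[OF pt[OF this]] True E show ?thesis
            by (simp add: ennreal_mult del: profile_deriv_seq.simps)
        qed simp
      qed
      also have "\<dots> = ennreal E * (\<integral>\<^sup>+y\<in>{0<..}. ennreal (y powr (p - 1) * exp (- (\<tau> * r) * y)) \<partial>lborel)"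
        by (intro nn_integral_cmult) auto
      also have "\<dots> = ennreal E * ennreal (Gamma p / (\<tau> * r) powr p)"
        using \<tau> r p by (subst nn_integral_powr_exp) auto
      also have "\<dots> = ennreal (E * (Gamma p / (\<tau> * r) powr p))"
        using E p \<tau> r by (subst ennreal_mult) (auto simp: Gamma_real_pos less_imp_le)
      also have "E * (Gamma p / (\<tau> * r) powr p)
         = C * \<kappa> ^ (2 * (l + 1)) * (fact (l + 1))\<^sup>2 * (r powr (4 * s) / r powr p)"
        using \<tau> r by (simp add: E_def C_def powr_mult mult_ac)
      also have "r powr (4 * s) / r powr p = \<mu> powr (s + \<rho> - 1)"
      proof -
        have "r powr (4 * s) / r powr p = r powr (2 * (s + \<rho> - 1))"
          by (simp add: p_def algebra_simps flip: powr_diff)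
        also have "\<dots> = (r powr 2) powr (s + \<rho> - 1)" by (simp only: powr_powr)
        also have "r powr 2 = \<mu>" using r mu by (simp add: r_def)
        finally show ?thesis .
      qed
      finally show ?thesis .
    qed
    with C show ?thesis by blast
  qed
  with \<kappa> show ?thesis by blast
qed

text \<open>
  At a fixed \<open>y > 0\<close> the exponential decay in \<open>\<surd>\<mu> y\<close> dominates every power of \<open>\<mu>\<close>. This makes the
  differentiated series converge on slices for square-summable coefficients.
\<close>

lemma profile_deriv_seq_uniform_bound:
  fixes s :: real
  assumes s: "0 < s" "s < 1"
  shows "\<exists>C>0. \<forall>\<mu>>0. \<forall>\<psi>. profile s \<mu> \<psi> \<longrightarrow> (\<forall>y>0.
     \<mu> ^ j * (profile_deriv_seq s \<mu> \<psi> (Suc m) y)\<^sup>2 \<le> C / y ^ (2 * (Suc m + j)))"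
proof -
  from profile_deriv_seq_decay[OF s, of "1/2"] obtain \<kappa> M where \<kappa>: "\<kappa> > 1" and M: "M > 0" and
    KM: "\<And>\<mu> \<psi> m y. \<mu> > 0 \<Longrightarrow> profile s \<mu> \<psi> \<Longrightarrow> y > 0 \<Longrightarrow>
     y ^ Suc m * \<bar>profile_deriv_seq s \<mu> \<psi> (Suc m) y\<bar>
       \<le> M * \<kappa> ^ Suc m * fact (Suc m) * ((sqrt \<mu> * y) powr (2 * s) * exp (- (1/2) * (sqrt \<mu> * y)))"
    by auto
  obtain C where C: "C > 0" "\<And>z::real. z \<ge> 0 \<Longrightarrow> z powr (real j + 2 * s) * exp (- (1/2) * z) \<le> C * exp (- 0 * z)"
    using powr_exp_absorb[of "real j + 2 * s" 0 "1/2"] s by auto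
  define K where "K = M * \<kappa> ^ Suc m * fact (Suc m) * C"
  have K: "K > 0" using M \<kappa> C by (simp add: K_def)
  have "\<mu> ^ j * (profile_deriv_seq s \<mu> \<psi> (Suc m) y)\<^sup>2 \<le> K\<^sup>2 / y ^ (2 * (Suc m + j))"
    if mu: "\<mu> > 0" and p: "profile s \<mu> \<psi>" and y: "y > 0" for \<mu> \<psi> y
  proof -
    let ?D = "profile_deriv_seq s \<mu> \<psi> (Suc m) y"
    define z where "z = sqrt \<mu> * y"
    have z: "z > 0" "z\<^sup>2 = \<mu> * y\<^sup>2" using mu y by (auto simp: z_def power_mult_distrib)
    have "z ^ j * (y ^ Suc m * \<bar>?D\<bar>) \<le> z ^ j * (M * \<kappa> ^ Suc m * fact (Suc m) * (z powr (2 * s) * exp (- (1/2) * z)))"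
      unfolding z_def using KM[OF mu p y, of m] mu y by (intro mult_left_mono) auto
    also have "\<dots> = M * \<kappa> ^ Suc m * fact (Suc m) * (z powr (real j + 2 * s) * exp (- (1/2) * z))"
      using z by (simp only: powr_add powr_realpow mult_ac)
    also have "\<dots> \<le> M * \<kappa> ^ Suc m * fact (Suc m) * (C * exp (- 0 * z))"
      using z M \<kappa> by (intro mult_left_mono C) auto
    also have "\<dots> = K" by (simp add: K_def)
    finally have "(z ^ j * (y ^ Suc m * \<bar>?D\<bar>))\<^sup>2 \<le> K\<^sup>2"
      using z y by (intro power_mono) auto
    also have "(z ^ j * (y ^ Suc m * \<bar>?D\<bar>))\<^sup>2 = (z\<^sup>2) ^ j * ((y\<^sup>2) ^ Suc m * ?D\<^sup>2)"
      by (simp only: power_mult_distrib power2_abs flip: power_mult) (simp only: mult.commute)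
    also have "\<dots> = \<mu> ^ j * ?D\<^sup>2 * y ^ (2 * (Suc m + j))"
      unfolding z(2) by (simp only: power_mult_distrib power_mult power_add mult_ac)
    finally show ?thesis using y by (simp add: pos_le_divide_eq del: profile_deriv_seq.simps power_Suc)
  qed
  with K show ?thesis by (meson zero_less_power)
qed

section \<open>Square-integrable functions\<close>

lemma L2norm_sq_eq: "L2norm_sq S f = (\<integral>\<^sup>+x. ennreal ((norm (indicator S x *\<^sub>R f x))\<^sup>2) \<partial>lborel)"
  unfolding wnorm_sq_def by (intro nn_integral_cong) (auto simp: indicator_def)

lemma L2norm_sq_cong: "(\<And>x. x \<in> S \<Longrightarrow> norm (f x) = norm (g x)) \<Longrightarrow> L2norm_sq S f = L2norm_sq S g"
  unfolding wnorm_sq_def by (intro nn_integral_cong) (auto simp: indicator_def)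

lemma L2norm_sq_mono_set: "S \<subseteq> S' \<Longrightarrow> L2norm_sq S f \<le> L2norm_sq S' f"
  unfolding wnorm_sq_def by (intro nn_integral_mono) (auto simp: indicator_def)

lemma set_borel_measurable_restrict:
  fixes f :: "'a::euclidean_space \<Rightarrow> 'b::euclidean_space"
  assumes "set_borel_measurable lborel S f" "K \<in> sets borel" "K \<subseteq> S"
  shows "set_borel_measurable lborel K f"
  using set_borel_measurable_subset[of lborel S f K] assms by simp

lemma set_borel_measurable_add:
  fixes f g :: "'a::euclidean_space \<Rightarrow> 'b::euclidean_space"
  assumes "set_borel_measurable lborel S f" "set_borel_measurable lborel S g"
  shows "set_borel_measurable lborel S (\<lambda>x. f x + g x)" "set_borel_measurable lborel S (\<lambda>x. f x - g x)"
  using assms unfolding set_borel_measurable_def scaleR_add_right scaleR_diff_right by simp_all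

lemma set_borel_measurable_scaleR:
  fixes f :: "'a::euclidean_space \<Rightarrow> 'b::euclidean_space"
  assumes "set_borel_measurable lborel S f"
  shows "set_borel_measurable lborel S (\<lambda>x. a *\<^sub>R f x)"
proof -
  have "(\<lambda>x. a *\<^sub>R (indicator S x *\<^sub>R f x)) \<in> borel_measurable lborel"
    using assms unfolding set_borel_measurable_def by measurable
  then show ?thesis unfolding set_borel_measurable_def by (simp add: mult.commute)
qed

lemma set_borel_measurable_sum:
  fixes f :: "'i \<Rightarrow> 'a::euclidean_space \<Rightarrow> 'b::euclidean_space"
  assumes "\<And>i. i \<in> I \<Longrightarrow> set_borel_measurable lborel S (f i)"
  shows "set_borel_measurable lborel S (\<lambda>x. \<Sum>i\<in>I. f i x)"
  using assms unfolding set_borel_measurable_def scaleR_sum_right by (intro borel_measurable_sum) auto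

lemma norm_add_sq_le:
  fixes a b :: "'b::real_normed_vector"
  shows "(norm (a + b))\<^sup>2 \<le> 2 * (norm a)\<^sup>2 + 2 * (norm b)\<^sup>2"
proof -
  have "(norm (a + b))\<^sup>2 \<le> (norm a + norm b)\<^sup>2" by (intro power_mono norm_triangle_ineq) auto
  also have "\<dots> \<le> 2 * (norm a)\<^sup>2 + 2 * (norm b)\<^sup>2"
    using zero_le_power2[of "norm a - norm b"] by (simp add: power2_eq_square algebra_simps)
  finally show ?thesis .
qed

lemma L2norm_sq_add_le:
  fixes f g :: "'a::euclidean_space \<Rightarrow> 'b::euclidean_space"
  assumes "set_borel_measurable lborel S f" "set_borel_measurable lborel S g"
  shows "L2norm_sq S (\<lambda>x. f x + g x) \<le> 2 * L2norm_sq S f + 2 * L2norm_sq S g"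
proof -
  define F where "F = (\<lambda>x. indicator S x *\<^sub>R f x)"
  define G where "G = (\<lambda>x. indicator S x *\<^sub>R g x)"
  have [measurable]: "F \<in> borel_measurable lborel" "G \<in> borel_measurable lborel"
    using assms by (auto simp: set_borel_measurable_def F_def G_def)
  have "L2norm_sq S (\<lambda>x. f x + g x) = (\<integral>\<^sup>+x. ennreal ((norm (F x + G x))\<^sup>2) \<partial>lborel)"
    unfolding L2norm_sq_eq F_def G_def scaleR_add_right ..
  also have "\<dots> \<le> (\<integral>\<^sup>+x. 2 * ennreal ((norm (F x))\<^sup>2) + 2 * ennreal ((norm (G x))\<^sup>2) \<partial>lborel)"
  proof (intro nn_integral_mono)
    fix x
    have "ennreal ((norm (F x + G x))\<^sup>2) \<le> ennreal (2 * (norm (F x))\<^sup>2 + 2 * (norm (G x))\<^sup>2)"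
      by (intro ennreal_leI norm_add_sq_le)
    then show "ennreal ((norm (F x + G x))\<^sup>2) \<le> 2 * ennreal ((norm (F x))\<^sup>2) + 2 * ennreal ((norm (G x))\<^sup>2)"
      by (simp add: ennreal_plus ennreal_mult)
  qed
  also have "\<dots> = 2 * (\<integral>\<^sup>+x. ennreal ((norm (F x))\<^sup>2) \<partial>lborel) + 2 * (\<integral>\<^sup>+x. ennreal ((norm (G x))\<^sup>2) \<partial>lborel)"
    by (subst nn_integral_add) (simp_all add: nn_integral_cmult)
  also have "\<dots> = 2 * L2norm_sq S f + 2 * L2norm_sq S g"
    unfolding L2norm_sq_eq F_def G_def ..
  finally show ?thesis .
qed

lemma L2norm_sq_scaleR:
  fixes f :: "'a::euclidean_space \<Rightarrow> 'b::euclidean_space"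
  assumes "set_borel_measurable lborel S f"
  shows "L2norm_sq S (\<lambda>x. a *\<^sub>R f x) = ennreal (a\<^sup>2) * L2norm_sq S f"
proof -
  define F where "F = (\<lambda>x. indicator S x *\<^sub>R f x)"
  have [measurable]: "F \<in> borel_measurable lborel"
    using assms by (auto simp: set_borel_measurable_def F_def)
  have "L2norm_sq S (\<lambda>x. a *\<^sub>R f x) = (\<integral>\<^sup>+x. ennreal (a\<^sup>2) * ennreal ((norm (F x))\<^sup>2) \<partial>lborel)"
    unfolding L2norm_sq_eq F_def
    by (intro nn_integral_cong) (auto simp: indicator_def power_mult_distrib simp flip: ennreal_mult)
  also have "\<dots> = ennreal (a\<^sup>2) * (\<integral>\<^sup>+x. ennreal ((norm (F x))\<^sup>2) \<partial>lborel)"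
    by (intro nn_integral_cmult) auto
  finally show ?thesis unfolding L2norm_sq_eq F_def .
qed

lemma L2norm_sq_minus: "L2norm_sq S (\<lambda>x. f x - g x) = L2norm_sq S (\<lambda>x. g x - f x)"
  by (rule L2norm_sq_cong) (rule norm_minus_commute)

lemma in_L2_add:
  fixes f g :: "'a::euclidean_space \<Rightarrow> 'b::euclidean_space"
  assumes "in_L2 S f" "in_L2 S g" shows "in_L2 S (\<lambda>x. f x + g x)"
proof -
  have "L2norm_sq S (\<lambda>x. f x + g x) \<le> 2 * L2norm_sq S f + 2 * L2norm_sq S g"
    using assms by (intro L2norm_sq_add_le) (auto simp: in_wL2_def)
  also have "\<dots> < \<infinity>" using assms by (auto simp: in_wL2_def ennreal_mult_less_top)
  finally show ?thesis using assms by (auto simp: in_wL2_def intro: set_borel_measurable_add)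
qed

lemma in_L2_scaleR:
  fixes f :: "'a::euclidean_space \<Rightarrow> 'b::euclidean_space"
  assumes "in_L2 S f" shows "in_L2 S (\<lambda>x. a *\<^sub>R f x)"
  using assms by (auto simp: in_wL2_def L2norm_sq_scaleR ennreal_mult_less_top intro: set_borel_measurable_scaleR)

lemma in_L2_diff:
  fixes f g :: "'a::euclidean_space \<Rightarrow> 'b::euclidean_space"
  assumes "in_L2 S f" "in_L2 S g" shows "in_L2 S (\<lambda>x. f x - g x)"
  using in_L2_add[OF assms(1) in_L2_scaleR[OF assms(2), of "-1"]] by simp

lemma in_L2_zero: "in_L2 S (\<lambda>x. 0)"
  by (simp add: in_wL2_def set_borel_measurable_def wnorm_sq_def)

lemma in_L2_sum:
  fixes f :: "'i \<Rightarrow> 'a::euclidean_space \<Rightarrow> 'b::euclidean_space"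
  assumes "\<And>i. i \<in> I \<Longrightarrow> in_L2 S (f i)"
  shows "in_L2 S (\<lambda>x. \<Sum>i\<in>I. f i x)"
proof (cases "finite I")
  case True
  then show ?thesis using assms by (induction I) (auto intro: in_L2_add in_L2_zero)
next
  case False
  then show ?thesis using in_L2_zero by simp
qed

lemma L2_cauchy_schwarz:
  fixes f g :: "'a::euclidean_space \<Rightarrow> 'b::euclidean_space"
  assumes f: "in_L2 S f" and g: "in_L2 S g"
  shows "set_integrable lborel S (\<lambda>x. f x \<bullet> g x)"
    and "ennreal ((LINT x:S|lborel. f x \<bullet> g x)\<^sup>2) \<le> L2norm_sq S f * L2norm_sq S g"
proof -
  define F where "F = (\<lambda>x. indicator S x *\<^sub>R f x)"
  define G where "G = (\<lambda>x. indicator S x *\<^sub>R g x)"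
  have [measurable]: "F \<in> borel_measurable lborel" "G \<in> borel_measurable lborel"
    using assms by (auto simp: in_wL2_def set_borel_measurable_def F_def G_def)
  have FG: "(\<lambda>x. indicator S x *\<^sub>R (f x \<bullet> g x)) = (\<lambda>x. F x \<bullet> G x)"
    by (auto simp: F_def G_def indicator_def fun_eq_iff)
  have cs: "(\<integral>\<^sup>+x. ennreal (norm (F x \<bullet> G x)) \<partial>lborel)\<^sup>2 \<le> L2norm_sq S f * L2norm_sq S g"
  proof -
    have "(\<integral>\<^sup>+x. ennreal (norm (F x \<bullet> G x)) \<partial>lborel) \<le> (\<integral>\<^sup>+x. ennreal (norm (F x)) * ennreal (norm (G x)) \<partial>lborel)"
      using Cauchy_Schwarz_ineq2
      by (intro nn_integral_mono) (auto simp flip: ennreal_mult intro!: ennreal_leI)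
    then have "(\<integral>\<^sup>+x. ennreal (norm (F x \<bullet> G x)) \<partial>lborel)\<^sup>2 \<le> (\<integral>\<^sup>+x. ennreal (norm (F x)) * ennreal (norm (G x)) \<partial>lborel)\<^sup>2"
      by (intro power_mono) auto
    also have "\<dots> \<le> (\<integral>\<^sup>+x. (ennreal (norm (F x)))\<^sup>2 \<partial>lborel) * (\<integral>\<^sup>+x. (ennreal (norm (G x)))\<^sup>2 \<partial>lborel)"
      by (rule Cauchy_Schwarz_nn_integral) auto
    finally show ?thesis by (simp add: L2norm_sq_eq F_def G_def ennreal_power)
  qed
  have fin: "L2norm_sq S f * L2norm_sq S g < \<infinity>"
    using assms by (auto simp: in_wL2_def ennreal_mult_less_top)
  have fin': "(\<integral>\<^sup>+x. ennreal (norm (F x \<bullet> G x)) \<partial>lborel) < \<infinity>"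
  proof (rule ccontr)
    assume "\<not> ?thesis"
    then have "(\<integral>\<^sup>+x. ennreal (norm (F x \<bullet> G x)) \<partial>lborel) = \<infinity>" by (metis infinity_ennreal_def less_top)
    then show False using cs fin by (simp add: power2_eq_square ennreal_top_mult top.not_eq_extremum)
  qed
  have int: "integrable lborel (\<lambda>x. F x \<bullet> G x)"
    using fin' by (intro integrableI_bounded) auto
  then show "set_integrable lborel S (\<lambda>x. f x \<bullet> g x)" unfolding set_integrable_def FG .
  have "ennreal \<bar>LINT x:S|lborel. f x \<bullet> g x\<bar> \<le> (\<integral>\<^sup>+x. ennreal (norm (F x \<bullet> G x)) \<partial>lborel)"
    unfolding set_lebesgue_integral_def FG using integral_norm_bound_ennreal[OF int] by simp
  then have "(ennreal \<bar>LINT x:S|lborel. f x \<bullet> g x\<bar>)\<^sup>2 \<le> (\<integral>\<^sup>+x. ennreal (norm (F x \<bullet> G x)) \<partial>lborel)\<^sup>2"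
    by (intro power_mono) auto
  with cs show "ennreal ((LINT x:S|lborel. f x \<bullet> g x)\<^sup>2) \<le> L2norm_sq S f * L2norm_sq S g"
    by (simp add: ennreal_power)
qed

lemma L2norm_sq_inner:
  fixes f :: "'a::euclidean_space \<Rightarrow> 'b::euclidean_space"
  assumes f: "in_L2 S f"
  shows "L2norm_sq S f = ennreal (LINT x:S|lborel. f x \<bullet> f x)"
proof -
  have i: "integrable lborel (\<lambda>x. indicator S x *\<^sub>R (f x \<bullet> f x))"
    using L2_cauchy_schwarz(1)[OF f f] by (simp add: set_integrable_def)
  have "L2norm_sq S f = (\<integral>\<^sup>+x. ennreal (indicator S x *\<^sub>R (f x \<bullet> f x)) \<partial>lborel)"
    unfolding L2norm_sq_eq
    by (intro nn_integral_cong) (auto simp: indicator_def power2_norm_eq_inner)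
  also have "\<dots> = ennreal (LINT x:S|lborel. f x \<bullet> f x)"
    unfolding set_lebesgue_integral_def by (intro nn_integral_eq_integral i) (auto simp: indicator_def)
  finally show ?thesis .
qed

lemma L2_inner_tendsto:
  fixes f g :: "'a::euclidean_space \<Rightarrow> 'b::euclidean_space"
  assumes fN: "\<And>N. in_L2 S (fN N)" and f: "in_L2 S f" and g: "in_L2 S g"
    and lim: "(\<lambda>N. L2norm_sq S (\<lambda>x. fN N x - f x)) \<longlonglongrightarrow> 0"
  shows "(\<lambda>N. LINT x:S|lborel. fN N x \<bullet> g x) \<longlonglongrightarrow> (LINT x:S|lborel. f x \<bullet> g x)"
proof -
  let ?d = "\<lambda>N. (LINT x:S|lborel. fN N x \<bullet> g x) - (LINT x:S|lborel. f x \<bullet> g x)"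
  have "(\<lambda>N. ennreal ((?d N)\<^sup>2)) \<longlonglongrightarrow> 0"
  proof (rule tendsto_sandwich[of "\<lambda>_. 0" _ _ "\<lambda>N. L2norm_sq S (\<lambda>x. fN N x - f x) * L2norm_sq S g"])
    have "ennreal ((?d N)\<^sup>2) \<le> L2norm_sq S (\<lambda>x. fN N x - f x) * L2norm_sq S g" for N
    proof -
      have "?d N = (LINT x:S|lborel. (fN N x - f x) \<bullet> g x)"
        unfolding inner_diff_left
        by (intro set_integral_diff(2)[symmetric] L2_cauchy_schwarz fN f g)
      then show ?thesis using L2_cauchy_schwarz(2)[OF in_L2_diff[OF fN f] g, of N] by simp
    qed
    then show "\<forall>\<^sub>F N in sequentially. ennreal ((?d N)\<^sup>2) \<le> L2norm_sq S (\<lambda>x. fN N x - f x) * L2norm_sq S g"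
      by simp
    have "(\<lambda>N. L2norm_sq S (\<lambda>x. fN N x - f x) * L2norm_sq S g) \<longlonglongrightarrow> 0 * L2norm_sq S g"
      using g by (intro tendsto_mult_ennreal lim tendsto_const) (auto simp: in_wL2_def)
    then show "(\<lambda>N. L2norm_sq S (\<lambda>x. fN N x - f x) * L2norm_sq S g) \<longlonglongrightarrow> 0" by simp
  qed auto
  then have "(\<lambda>N. (?d N)\<^sup>2) \<longlonglongrightarrow> 0"
    by (subst (asm) ennreal_tendsto_0_iff) auto
  then have "(\<lambda>N. sqrt ((?d N)\<^sup>2)) \<longlonglongrightarrow> sqrt 0" by (rule tendsto_real_sqrt)
  then have "?d \<longlonglongrightarrow> 0" by (simp add: tendsto_rabs_zero_iff)
  then show ?thesis by (rule LIM_zero_cancel)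
qed

section \<open>Distributional derivatives\<close>

lemma partials_append: "partials (bs @ cs) f = partials bs (partials cs f)"
  by (induction bs) auto

lemma smooth_differentiable: "smooth f \<Longrightarrow> f differentiable (at x)"
  unfolding smooth_def by (metis partials.simps(1))

lemma smooth_partials: "smooth f \<Longrightarrow> smooth (partials cs f)"
  unfolding smooth_def by (metis partials_append)

lemma smooth_continuous: "smooth f \<Longrightarrow> continuous_on A f"
  by (meson continuous_at_imp_continuous_on differentiable_imp_continuous_within smooth_differentiable)

lemma frechet_derivative_zero_off:
  assumes "closed K" "\<And>x. x \<notin> K \<Longrightarrow> f x = 0" "x \<notin> K"
  shows "frechet_derivative f (at x) = (\<lambda>_. 0)"
proof -
  have "((\<lambda>_. 0) has_derivative (\<lambda>_. 0)) (at x)" by simp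
  then have "(f has_derivative (\<lambda>_. 0)) (at x)"
    by (rule has_derivative_transform_within_open[where s = "- K"]) (use assms in \<open>auto simp: open_Compl\<close>)
  then show ?thesis by (rule frechet_derivative_at[symmetric])
qed

lemma partials_zero_off:
  assumes "closed K" "\<And>x. x \<notin> K \<Longrightarrow> f x = 0" "x \<notin> K"
  shows "partials bs f x = 0"
  using assms(3)
proof (induction bs arbitrary: x)
  case (Cons b bs)
  then show ?case using frechet_derivative_zero_off[OF assms(1), of "partials bs f"] by simp
qed (use assms in simp)

lemma test_function_partials:
  assumes "test_function S \<eta>" shows "test_function S (partials cs \<eta>)"
proof -
  obtain K where K: "compact K" "K \<subseteq> S" "\<And>x. x \<notin> K \<Longrightarrow> \<eta> x = 0" "smooth \<eta>"
    using assms by (auto simp: test_function_def)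
  then have "partials cs \<eta> x = 0" if "x \<notin> K" for x
    using partials_zero_off[OF compact_imp_closed[OF K(1)] _ that] by blast
  then show ?thesis using K smooth_partials unfolding test_function_def by blast
qed

lemma continuous_compact_support_bounded:
  fixes g :: "'a::euclidean_space \<Rightarrow> real"
  assumes "continuous_on UNIV g" "compact K" "\<And>x. x \<notin> K \<Longrightarrow> g x = 0"
  obtains B where "B \<ge> 0" "\<And>x. \<bar>g x\<bar> \<le> B"
proof -
  have "bounded (g ` K)"
    by (intro compact_imp_bounded compact_continuous_image continuous_on_subset[OF assms(1)] assms) auto
  then obtain B where B: "\<And>x. x \<in> K \<Longrightarrow> \<bar>g x\<bar> \<le> B" by (auto simp: bounded_iff)
  show ?thesis
  proof (rule that[of "max B 0"])
    show "\<bar>g x\<bar> \<le> max B 0" for x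
      using B[of x] assms(3)[of x] by (cases "x \<in> K") auto
  qed auto
qed

lemma set_integrable_mult_test:
  fixes w g :: "'a::euclidean_space \<Rightarrow> real"
  assumes w: "locally_integrable S w" and K: "compact K" "K \<subseteq> S"
    and g: "continuous_on UNIV g" "\<And>x. x \<notin> K \<Longrightarrow> g x = 0"
  shows "set_integrable lborel S (\<lambda>x. w x * g x)"
    and "(LINT x:S|lborel. w x * g x) = (LINT x:K|lborel. w x * g x)"
proof -
  obtain B where B: "\<And>x. \<bar>g x\<bar> \<le> B" using continuous_compact_support_bounded[OF g(1) K(1) g(2)] by metis
  have eq: "(\<lambda>x. indicator S x *\<^sub>R (w x * g x)) = (\<lambda>x. indicator K x *\<^sub>R (w x * g x))"
    using K(2) g(2) by (auto simp: indicator_def fun_eq_iff)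
  have wK: "integrable lborel (\<lambda>x. indicator K x *\<^sub>R w x)"
    using w K by (auto simp: locally_integrable_def set_integrable_def)
  have gm: "g \<in> borel_measurable lborel" using g(1) by (simp add: borel_measurable_continuous_onI)
  have "integrable lborel (\<lambda>x. g x * (indicator K x *\<^sub>R w x))"
  proof (rule Bochner_Integration.integrable_bound[of _ "\<lambda>x. B * (indicator K x *\<^sub>R w x)"])
    show "(\<lambda>x. g x * (indicator K x *\<^sub>R w x)) \<in> borel_measurable lborel"
      using gm borel_measurable_integrable[OF wK] by measurable
    show "AE x in lborel. norm (g x * (indicator K x *\<^sub>R w x)) \<le> norm (B * (indicator K x *\<^sub>R w x))"
      using B by (intro AE_I2) (auto simp: abs_mult intro!: mult_right_mono intro: order_trans[OF B abs_ge_self])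
  qed (use wK in simp)
  then show "set_integrable lborel S (\<lambda>x. w x * g x)"
    unfolding set_integrable_def eq by (simp add: mult_ac)
  show "(LINT x:S|lborel. w x * g x) = (LINT x:K|lborel. w x * g x)"
    unfolding set_lebesgue_integral_def eq ..
qed

lemma test_function_integrable:
  assumes w: "locally_integrable S w" and \<eta>: "test_function S \<eta>"
  shows "set_integrable lborel S (\<lambda>x. w x * \<eta> x)"
proof -
  obtain K where K: "compact K" "K \<subseteq> S" "\<And>x. x \<notin> K \<Longrightarrow> \<eta> x = 0" "smooth \<eta>"
    using \<eta> by (auto simp: test_function_def)
  show ?thesis by (rule set_integrable_mult_test(1)[OF w K(1,2) smooth_continuous[OF K(4)] K(3)])
qed

lemma locally_integrable_add:
  "locally_integrable S f \<Longrightarrow> locally_integrable S g \<Longrightarrow> locally_integrable S (\<lambda>x. f x + g x)"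
  unfolding locally_integrable_def by (auto intro: set_integral_add)

lemma locally_integrable_cmult:
  "locally_integrable S f \<Longrightarrow> locally_integrable S (\<lambda>x. a * f x)"
  unfolding locally_integrable_def by auto

lemma weak_deriv_cmult:
  assumes "weak_deriv S bs w v" shows "weak_deriv S bs (\<lambda>x. a * w x) (\<lambda>x. a * v x)"
  using assms unfolding weak_deriv_def
  by (auto simp: locally_integrable_cmult mult.assoc)

lemma weak_deriv_add:
  assumes 1: "weak_deriv S bs w v" and 2: "weak_deriv S bs w' v'"
  shows "weak_deriv S bs (\<lambda>x. w x + w' x) (\<lambda>x. v x + v' x)"
  unfolding weak_deriv_def
proof (intro conjI allI impI)
  show "locally_integrable S (\<lambda>x. w x + w' x)" "locally_integrable S (\<lambda>x. v x + v' x)"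
    using 1 2 by (auto simp: weak_deriv_def intro: locally_integrable_add)
  fix \<eta> assume \<eta>: "test_function S \<eta>"
  note \<eta>' = test_function_partials[OF \<eta>, of bs]
  have l: "locally_integrable S w" "locally_integrable S w'" "locally_integrable S v" "locally_integrable S v'"
    using 1 2 by (auto simp: weak_deriv_def)
  have "(LINT x:S|lborel. (w x + w' x) * partials bs \<eta> x)
     = (LINT x:S|lborel. w x * partials bs \<eta> x) + (LINT x:S|lborel. w' x * partials bs \<eta> x)"
    unfolding distrib_right by (intro set_integral_add test_function_integrable l \<eta>')
  moreover have "(LINT x:S|lborel. (v x + v' x) * \<eta> x)
     = (LINT x:S|lborel. v x * \<eta> x) + (LINT x:S|lborel. v' x * \<eta> x)"
    unfolding distrib_right by (intro set_integral_add test_function_integrable l \<eta>)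
  ultimately show "(LINT x:S|lborel. (w x + w' x) * partials bs \<eta> x)
     = (- 1) ^ length bs * (LINT x:S|lborel. (v x + v' x) * \<eta> x)"
    using 1 2 \<eta> by (simp add: weak_deriv_def distrib_left)
qed

lemma weak_deriv_zero: "weak_deriv S bs (\<lambda>x. 0) (\<lambda>x. 0)"
  by (simp add: weak_deriv_def locally_integrable_def set_integrable_def)

lemma weak_deriv_sum:
  assumes "\<And>i. i \<in> I \<Longrightarrow> weak_deriv S bs (w i) (v i)"
  shows "weak_deriv S bs (\<lambda>x. \<Sum>i\<in>I. w i x) (\<lambda>x. \<Sum>i\<in>I. v i x)"
proof (cases "finite I")
  case True
  then show ?thesis using assms by (induction I) (auto intro: weak_deriv_add weak_deriv_zero)
next
  case False
  then show ?thesis using weak_deriv_zero by simp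
qed

lemma weak_deriv_comp:
  assumes 1: "weak_deriv S bs w v" and 2: "weak_deriv S cs v v'"
  shows "weak_deriv S (bs @ cs) w v'"
  unfolding weak_deriv_def
proof (intro conjI allI impI)
  fix \<eta> assume \<eta>: "test_function S \<eta>"
  have "(LINT x:S|lborel. w x * partials (bs @ cs) \<eta> x) = (- 1) ^ length bs * (LINT x:S|lborel. v x * partials cs \<eta> x)"
    using 1 test_function_partials[OF \<eta>, of cs] by (simp add: weak_deriv_def partials_append)
  also have "\<dots> = (- 1) ^ length (bs @ cs) * (LINT x:S|lborel. v' x * \<eta> x)"
    using 2 \<eta> by (simp add: weak_deriv_def power_add)
  finally show "(LINT x:S|lborel. w x * partials (bs @ cs) \<eta> x) = (- 1) ^ length (bs @ cs) * (LINT x:S|lborel. v' x * \<eta> x)" .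
qed (use assms in \<open>auto simp: weak_deriv_def\<close>)

lemma in_L2_continuous_compact:
  assumes K: "compact K" and g: "continuous_on K g" shows "in_L2 K (g :: 'a::euclidean_space \<Rightarrow> real)"
proof -
  have m: "set_borel_measurable lborel K g"
    unfolding set_borel_measurable_def
    using borel_measurable_continuous_on_indicator[of K g] K g by (simp add: compact_imp_closed borel_closed)
  have "integrable lborel (\<lambda>x. indicator K x *\<^sub>R ((g x)\<^sup>2))"
    by (intro borel_integrable_compact K continuous_intros g)
  then have "(\<integral>\<^sup>+x. ennreal (norm (indicator K x *\<^sub>R ((g x)\<^sup>2))) \<partial>lborel) < \<infinity>"
    by (simp add: integrable_iff_bounded)
  moreover have "(\<integral>\<^sup>+x. ennreal (norm (indicator K x *\<^sub>R ((g x)\<^sup>2))) \<partial>lborel) = L2norm_sq K g"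
    unfolding L2norm_sq_eq by (intro nn_integral_cong) (auto simp: indicator_def)
  ultimately show ?thesis using m by (simp add: in_wL2_def)
qed

lemma locally_integrable_L2:
  fixes w :: "'a::euclidean_space \<Rightarrow> real"
  assumes "\<And>K. compact K \<Longrightarrow> K \<subseteq> S \<Longrightarrow> in_L2 K w"
  shows "locally_integrable S w"
  unfolding locally_integrable_def
proof (intro allI impI)
  fix K assume K: "compact K" "K \<subseteq> S"
  have "set_integrable lborel K (\<lambda>x. w x \<bullet> 1)"
    by (rule L2_cauchy_schwarz(1)[OF assms[OF K] in_L2_continuous_compact[OF K(1)]]) auto
  then show "set_integrable lborel K w" by simp
qed

text \<open>
  A test function lives on one compact set, where both sides of the defining identity are continuous
  for \<open>L2\<close> convergence.
\<close>

lemma weak_deriv_limit: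
  fixes w v :: "'a::euclidean_space \<Rightarrow> real"
  assumes wd: "\<And>N. weak_deriv S bs (wN N) (vN N)"
    and m: "set_borel_measurable lborel S w" "set_borel_measurable lborel S v"
    and L: "\<And>N K. compact K \<Longrightarrow> K \<subseteq> S \<Longrightarrow> in_L2 K (wN N)" "\<And>N K. compact K \<Longrightarrow> K \<subseteq> S \<Longrightarrow> in_L2 K (vN N)"
    and lim: "\<And>K. compact K \<Longrightarrow> K \<subseteq> S \<Longrightarrow> (\<lambda>N. L2norm_sq K (\<lambda>x. wN N x - w x)) \<longlonglongrightarrow> 0"
      "\<And>K. compact K \<Longrightarrow> K \<subseteq> S \<Longrightarrow> (\<lambda>N. L2norm_sq K (\<lambda>x. vN N x - v x)) \<longlonglongrightarrow> 0"
  shows "weak_deriv S bs w v"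
proof -
  have inL2: "in_L2 K f" if K: "compact K" "K \<subseteq> S" and f: "set_borel_measurable lborel S f"
    "\<And>N. in_L2 K (fN N)" "(\<lambda>N. L2norm_sq K (\<lambda>x. fN N x - f x)) \<longlonglongrightarrow> 0" for K and f :: "'a \<Rightarrow> real" and fN
  proof -
    have fm: "set_borel_measurable lborel K f"
      using set_borel_measurable_restrict[OF f(1)] K by (simp add: compact_imp_closed borel_closed)
    obtain N where N: "L2norm_sq K (\<lambda>x. fN N x - f x) < 1"
      using order_tendstoD(2)[OF f(3), of 1] by (auto simp: eventually_sequentially)
    have "in_L2 K (\<lambda>x. fN N x - f x)"
      using N f(2)[of N] fm by (auto simp: in_wL2_def intro!: set_borel_measurable_add less_trans[OF N])
    from in_L2_diff[OF f(2)[of N] this] show ?thesis by simp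
  qed
  have w: "in_L2 K w" and v: "in_L2 K v" if "compact K" "K \<subseteq> S" for K
    using inL2[OF that m(1) L(1)[OF that] lim(1)[OF that]] inL2[OF that m(2) L(2)[OF that] lim(2)[OF that]] by auto
  have lw: "locally_integrable S w" "locally_integrable S v" using w v by (auto intro: locally_integrable_L2)
  have lwN: "locally_integrable S (wN N)" "locally_integrable S (vN N)" for N using L by (auto intro: locally_integrable_L2)
  show ?thesis
    unfolding weak_deriv_def
  proof (intro conjI allI impI lw)
    fix \<eta> assume \<eta>: "test_function S \<eta>"
    obtain K where K: "compact K" "K \<subseteq> S" "\<And>x. x \<notin> K \<Longrightarrow> \<eta> x = 0" "smooth \<eta>"
      using \<eta> by (auto simp: test_function_def)
    have p0: "partials bs \<eta> x = 0" if "x \<notin> K" for x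
      using partials_zero_off[OF compact_imp_closed[OF K(1)] K(3) that] .
    note c = smooth_continuous[OF K(4)] smooth_continuous[OF smooth_partials[OF K(4), of bs]]
    have A: "(\<lambda>N. LINT x:K|lborel. wN N x \<bullet> partials bs \<eta> x) \<longlonglongrightarrow> (LINT x:K|lborel. w x \<bullet> partials bs \<eta> x)"
      by (intro L2_inner_tendsto L w in_L2_continuous_compact K c lim)
    have "(\<lambda>N. LINT x:K|lborel. vN N x \<bullet> \<eta> x) \<longlonglongrightarrow> (LINT x:K|lborel. v x \<bullet> \<eta> x)"
      by (intro L2_inner_tendsto L v in_L2_continuous_compact K c lim)
    then have B: "(\<lambda>N. (- 1) ^ length bs * (LINT x:K|lborel. vN N x \<bullet> \<eta> x)) \<longlonglongrightarrow> (- 1) ^ length bs * (LINT x:K|lborel. v x \<bullet> \<eta> x)"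
      by (intro tendsto_intros)
    have C: "(LINT x:K|lborel. wN N x \<bullet> partials bs \<eta> x) = (- 1) ^ length bs * (LINT x:K|lborel. vN N x \<bullet> \<eta> x)" for N
      using wd[of N, unfolded weak_deriv_def, THEN conjunct2, THEN conjunct2, rule_format, OF \<eta>]
      by (simp add: set_integrable_mult_test(2)[OF lwN(1) K(1,2) c(2) p0]
          set_integrable_mult_test(2)[OF lwN(2) K(1,2) c(1) K(3)])
    have "(LINT x:K|lborel. w x \<bullet> partials bs \<eta> x) = (- 1) ^ length bs * (LINT x:K|lborel. v x \<bullet> \<eta> x)"
      by (rule LIMSEQ_unique[OF A[unfolded C] B])
    then show "(LINT x:S|lborel. w x * partials bs \<eta> x) = (- 1) ^ length bs * (LINT x:S|lborel. v x * \<eta> x)"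
      by (simp add: set_integrable_mult_test(2)[OF lw(1) K(1,2) c(2) p0]
          set_integrable_mult_test(2)[OF lw(2) K(1,2) c(1) K(3)])
  qed
qed

text \<open>
  By translation invariance all difference quotients of \<open>g\<close> in direction \<open>b\<close> have integral 0. They are
  bounded, supported in one compact set and converge pointwise to \<open>h\<close>, so dominated convergence applies.
\<close>

lemma integral_directional_derivative_zero:
  fixes g h :: "'a::euclidean_space \<Rightarrow> real"
  assumes d: "\<And>x. (g has_derivative g' x) (at x)" and h: "\<And>x. g' x b = h x"
    and c: "continuous_on UNIV h" and K: "compact K" "\<And>x. x \<notin> K \<Longrightarrow> g x = 0"
  shows "(\<integral>x. h x \<partial>lborel) = 0"
proof -
  have h0: "h x = 0" if "x \<notin> K" for x
  proof -
    have "g' x = frechet_derivative g (at x)" by (rule frechet_derivative_at[OF d])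
    also have "\<dots> = (\<lambda>_. 0)" by (rule frechet_derivative_zero_off[OF compact_imp_closed[OF K(1)] K(2) that])
    finally show ?thesis using h[of x] by simp
  qed
  obtain B where B: "B \<ge> 0" "\<And>x. \<bar>h x\<bar> \<le> B" using continuous_compact_support_bounded[OF c K(1) h0] by metis
  have gc: "continuous_on UNIV g"
    by (meson d has_derivative_continuous continuous_at_imp_continuous_on)
  have gint: "integrable lborel g"
  proof -
    have "integrable lborel (\<lambda>x. indicator K x *\<^sub>R g x)"
      by (intro borel_integrable_compact K continuous_on_subset[OF gc]) auto
    moreover have "(\<lambda>x. indicator K x *\<^sub>R g x) = g" using K(2) by (auto simp: indicator_def fun_eq_iff)
    ultimately show ?thesis by simp
  qed
  \<comment> \<open>The supports of all translates of \<open>g\<close> along \<open>b\<close> by at most one step lie in this compact set.\<close>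
  define K' where "K' = (\<lambda>p. fst p - snd p *\<^sub>R b) ` (K \<times> {0..1::real})"
  have K': "compact K'"
    unfolding K'_def by (intro compact_continuous_image compact_Times K continuous_intros) auto
  have line: "((\<lambda>t. g (x + t *\<^sub>R b)) has_real_derivative h (x + t *\<^sub>R b)) (at t)" for x t
  proof -
    have "((\<lambda>t. x + t *\<^sub>R b) has_derivative (\<lambda>s. s *\<^sub>R b)) (at t)"
      by (auto intro!: derivative_eq_intros)
    from has_derivative_compose[OF this d] have "((\<lambda>t. g (x + t *\<^sub>R b)) has_derivative (\<lambda>s. g' (x + t *\<^sub>R b) (s *\<^sub>R b))) (at t)" .
    moreover have "g' y (s *\<^sub>R b) = h y * s" for y s
      using h[of y] linear_scale[OF has_derivative_linear[OF d[of y]], of s b] by (simp add: mult.commute)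
    ultimately show ?thesis by (simp add: has_field_derivative_def mult_commute_abs)
  qed
  define q where "q n x = (real n + 1) * (g (x + (1 / (real n + 1)) *\<^sub>R b) - g x)" for n x
  have q0: "(\<integral>x. q n x \<partial>lborel) = 0" for n
  proof -
    let ?t = "(1 / (real n + 1)) *\<^sub>R b"
    have gm: "g \<in> borel_measurable borel" using borel_measurable_integrable[OF gint] by simp
    have i: "integrable lborel (\<lambda>x. g (x + ?t))"
      using integrable_distr_eq[of "(+) ?t" lborel borel g] gm gint lborel_distr_plus[of ?t]
      by (simp add: add.commute)
    have "(\<integral>x. g (x + ?t) \<partial>lborel) = (\<integral>x. g x \<partial>lborel)"
      using integral_distr[of "(+) ?t" lborel borel g] gm lborel_distr_plus[of ?t]
      by (simp add: add.commute)
    then show ?thesis unfolding q_def using i gint by simp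
  qed
  have "(\<lambda>n. \<integral>x. q n x \<partial>lborel) \<longlonglongrightarrow> (\<integral>x. h x \<partial>lborel)"
  proof (rule integral_dominated_convergence[where w = "\<lambda>x. indicator K' x *\<^sub>R B"])
    show "h \<in> borel_measurable lborel" using c by (simp add: borel_measurable_continuous_onI)
    have "continuous_on UNIV (q n)" for n
      unfolding q_def by (intro continuous_intros continuous_on_compose2[OF gc]) auto
    then show "q n \<in> borel_measurable lborel" for n by (simp add: borel_measurable_continuous_onI)
    show "integrable lborel (\<lambda>x. indicator K' x *\<^sub>R B)"
      by (intro borel_integrable_compact K') auto
    show "AE x in lborel. (\<lambda>n. q n x) \<longlonglongrightarrow> h x"
    proof (intro AE_I2)
      fix x
      have "((\<lambda>s. (g (x + s *\<^sub>R b) - g x) / s) \<longlongrightarrow> h x) (at 0)"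
        using line[of x 0] by (simp add: DERIV_def)
      moreover have "filterlim (\<lambda>n. 1 / (real n + 1)) (at 0) sequentially"
      proof (rule tendsto_imp_filterlim_at_right[THEN filterlim_mono])
        show "(\<lambda>n. 1 / (real n + 1)) \<longlonglongrightarrow> 0" using LIMSEQ_inverse_real_of_nat
          by (simp add: inverse_eq_divide add.commute)
      qed (auto simp: at_within_le_at)
      ultimately have "(\<lambda>n. (g (x + (1 / (real n + 1)) *\<^sub>R b) - g x) / (1 / (real n + 1))) \<longlonglongrightarrow> h x"
        by (rule filterlim_compose)
      then show "(\<lambda>n. q n x) \<longlonglongrightarrow> h x" by (simp add: q_def mult.commute)
    qed
    show "AE x in lborel. norm (q n x) \<le> indicator K' x *\<^sub>R B" for n
    proof (intro AE_I2)
      fix x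
      let ?e = "1 / (real n + 1)"
      have e: "0 < ?e" "?e \<le> 1" by auto
      have "\<exists>t. 0 < t \<and> t < ?e \<and> g (x + ?e *\<^sub>R b) - g (x + 0 *\<^sub>R b) = (?e - 0) * h (x + t *\<^sub>R b)"
        by (rule MVT2[OF e(1) line])
      then obtain t where t: "0 < t" "t < ?e" "g (x + ?e *\<^sub>R b) - g x = ?e * h (x + t *\<^sub>R b)" by auto
      have q: "q n x = h (x + t *\<^sub>R b)" unfolding q_def t(3) by simp
      show "norm (q n x) \<le> indicator K' x *\<^sub>R B"
      proof (cases "x + t *\<^sub>R b \<in> K")
        case True
        have "x = (\<lambda>p. fst p - snd p *\<^sub>R b) (x + t *\<^sub>R b, t)" by simp
        moreover have "(x + t *\<^sub>R b, t) \<in> K \<times> {0..1}" using True t(1) less_le_trans[OF t(2) e(2)] by simp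
        ultimately have "x \<in> K'" unfolding K'_def by (rule image_eqI)
        then show ?thesis using B q by simp
      next
        case False
        then show ?thesis using h0[OF False] q B by simp
      qed
    qed
  qed
  then show ?thesis using q0 LIMSEQ_unique[OF _ tendsto_const] by fastforce
qed

text \<open>
  Integration by parts: the product of \<open>f\<close> with a test function, extended by 0, is continuously
  differentiable in direction \<open>b\<close> with compact support.
\<close>

lemma weak_deriv_classical:
  fixes f v :: "'a::euclidean_space \<Rightarrow> real"
  assumes S: "open S" and d: "\<And>x. x \<in> S \<Longrightarrow> (f has_derivative f' x) (at x)" "\<And>x. x \<in> S \<Longrightarrow> f' x b = v x"
    and c: "continuous_on S f" "continuous_on S v"
  shows "weak_deriv S [b] f v"
proof -
  have L: "locally_integrable S f" "locally_integrable S v"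
    by (intro locally_integrable_L2 in_L2_continuous_compact; blast intro: continuous_on_subset[OF c(1)] continuous_on_subset[OF c(2)])+
  show ?thesis
    unfolding weak_deriv_def
  proof (intro conjI allI impI L)
    fix \<eta> assume \<eta>: "test_function S \<eta>"
    obtain K where K: "compact K" "K \<subseteq> S" "\<And>x. x \<notin> K \<Longrightarrow> \<eta> x = 0" "smooth \<eta>"
      using \<eta> by (auto simp: test_function_def)
    define \<eta>b where "\<eta>b = partials [b] \<eta>"
    have \<eta>': "(\<eta> has_derivative frechet_derivative \<eta> (at x)) (at x)" for x
      using smooth_differentiable[OF K(4)] by (simp add: frechet_derivative_works)
    have p0: "\<eta>b x = 0" if "x \<notin> K" for x
      unfolding \<eta>b_def using partials_zero_off[OF compact_imp_closed[OF K(1)] K(3) that] .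
    define g where "g x = (if x \<in> S then f x * \<eta> x else 0)" for x
    define g' where "g' x = (if x \<in> S then (\<lambda>e. f x * frechet_derivative \<eta> (at x) e + f' x e * \<eta> x) else (\<lambda>e. 0))" for x
    define h where "h x = (if x \<in> S then f x * \<eta>b x + v x * \<eta> x else 0)" for x
    have oK: "open (- K)" using K by (simp add: open_Compl compact_imp_closed)
    have "(g has_derivative g' x) (at x)" for x
    proof (cases "x \<in> S")
      case True
      have "((\<lambda>x. f x * \<eta> x) has_derivative g' x) (at x)"
        using has_derivative_mult[OF d(1)[OF True] \<eta>'] True by (simp add: g'_def)
      then show ?thesis
        by (rule has_derivative_transform_within_open[OF _ S True]) (simp add: g_def)
    next
      case False
      have "((\<lambda>_. 0) has_derivative g' x) (at x)" using False by (simp add: g'_def)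
      then show ?thesis
        by (rule has_derivative_transform_within_open[OF _ oK]) (use False K in \<open>auto simp: g_def\<close>)
    qed
    moreover have "g' x b = h x" for x using d(2) by (simp add: g'_def h_def \<eta>b_def)
    moreover have "continuous_on UNIV h"
    proof -
      have "continuous_on S h"
      proof (rule continuous_on_eq[where f = "\<lambda>x. f x * \<eta>b x + v x * \<eta> x"])
        have "continuous_on S \<eta>b" "continuous_on S \<eta>"
          unfolding \<eta>b_def by (intro smooth_continuous smooth_partials K)+
        then show "continuous_on S (\<lambda>x. f x * \<eta>b x + v x * \<eta> x)" by (intro continuous_intros c)
      qed (simp add: h_def)
      moreover have "continuous_on (- K) h"
        by (rule continuous_on_eq[where f = "\<lambda>x. 0"]) (use p0 K in \<open>auto simp: h_def\<close>)
      ultimately have "continuous_on (S \<union> - K) h"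
        by (intro continuous_on_open_Un S oK)
      moreover have "S \<union> - K = UNIV" using K(2) by auto
      ultimately show ?thesis by simp
    qed
    ultimately have "(\<integral>x. h x \<partial>lborel) = 0"
      by (rule integral_directional_derivative_zero[OF _ _ _ K(1)]) (use K in \<open>auto simp: g_def\<close>)
    moreover have "(\<integral>x. h x \<partial>lborel) = (LINT x:S|lborel. f x * \<eta>b x + v x * \<eta> x)"
      unfolding set_lebesgue_integral_def by (intro Bochner_Integration.integral_cong) (auto simp: h_def)
    moreover have "\<dots> = (LINT x:S|lborel. f x * \<eta>b x) + (LINT x:S|lborel. v x * \<eta> x)"
      unfolding \<eta>b_def by (intro set_integral_add test_function_integrable test_function_partials L \<eta>)
    ultimately show "(LINT x:S|lborel. f x * partials [b] \<eta> x) = (- 1) ^ length [b] * (LINT x:S|lborel. v x * \<eta> x)"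
      by (simp only: \<eta>b_def) simp
  qed
qed

section \<open>Slices of a cylinder and series with convergent slices\<close>

lemma wnorm_sq_slices:
  fixes f :: "'a::euclidean_space \<times> real \<Rightarrow> 'b::euclidean_space"
  assumes f: "set_borel_measurable lborel (S \<times> T) f" and \<omega>: "\<omega> \<in> borel_measurable borel" "\<And>y. 0 \<le> \<omega> y"
    and T: "T \<in> sets borel"
  shows "wnorm_sq (\<lambda>z. \<omega> (snd z)) (S \<times> T) f = (\<integral>\<^sup>+y\<in>T. ennreal (\<omega> y) * L2norm_sq S (\<lambda>x. f (x, y)) \<partial>lborel)"
proof -
  define F where "F = (\<lambda>z. indicator (S \<times> T) z *\<^sub>R f z)"
  have F: "F \<in> borel_measurable (lborel \<Otimes>\<^sub>M lborel)"
    using f unfolding set_borel_measurable_def F_def lborel_prod .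
  have [measurable]: "\<omega> \<in> borel_measurable lborel" using \<omega> by simp
  note [measurable] = F
  have "wnorm_sq (\<lambda>z. \<omega> (snd z)) (S \<times> T) f = (\<integral>\<^sup>+z. ennreal (\<omega> (snd z)) * ennreal ((norm (F z))\<^sup>2) \<partial>(lborel \<Otimes>\<^sub>M lborel))"
    unfolding wnorm_sq_def F_def lborel_prod
    by (intro nn_integral_cong) (auto simp: indicator_def ennreal_mult \<omega>(2))
  also have "\<dots> = (\<integral>\<^sup>+y. \<integral>\<^sup>+x. ennreal (\<omega> (snd (x, y))) * ennreal ((norm (F (x, y)))\<^sup>2) \<partial>lborel \<partial>lborel)"
    by (rule lborel_pair.nn_integral_snd[symmetric]) measurable
  also have "\<dots> = (\<integral>\<^sup>+y\<in>T. ennreal (\<omega> y) * L2norm_sq S (\<lambda>x. f (x, y)) \<partial>lborel)"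
  proof (intro nn_integral_cong)
    fix y :: real
    have [measurable]: "(\<lambda>x. F (x, y)) \<in> borel_measurable lborel" by measurable
    have "(\<integral>\<^sup>+x. ennreal (\<omega> (snd (x, y))) * ennreal ((norm (F (x, y)))\<^sup>2) \<partial>lborel)
        = ennreal (\<omega> y) * (\<integral>\<^sup>+x. ennreal ((norm (F (x, y)))\<^sup>2) \<partial>lborel)"
      by (simp add: nn_integral_cmult)
    also have "(\<integral>\<^sup>+x. ennreal ((norm (F (x, y)))\<^sup>2) \<partial>lborel) = L2norm_sq S (\<lambda>x. f (x, y)) * indicator T y"
    proof (cases "y \<in> T")
      case True
      then show ?thesis unfolding L2norm_sq_eq F_def
        by (simp, intro nn_integral_cong) (auto simp: indicator_def)
    qed (simp add: F_def)
    finally show "(\<integral>\<^sup>+x. ennreal (\<omega> (snd (x, y))) * ennreal ((norm (F (x, y)))\<^sup>2) \<partial>lborel)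
      = ennreal (\<omega> y) * L2norm_sq S (\<lambda>x. f (x, y)) * indicator T y" by (simp add: mult.assoc)
  qed
  finally show ?thesis .
qed

lemma slice_measurable:
  fixes f :: "'a::euclidean_space \<times> real \<Rightarrow> 'b::euclidean_space"
  assumes f: "set_borel_measurable lborel (S \<times> T) f" and y: "y \<in> T"
  shows "set_borel_measurable lborel S (\<lambda>x. f (x, y))"
proof -
  have F: "(\<lambda>z. indicator (S \<times> T) z *\<^sub>R f z) \<in> borel_measurable (lborel \<Otimes>\<^sub>M lborel)"
    using f unfolding set_borel_measurable_def lborel_prod .
  have "(\<lambda>x. (\<lambda>z. indicator (S \<times> T) z *\<^sub>R f z) (x, y)) \<in> borel_measurable lborel"
    by (rule measurable_compose[OF _ F]) simp
  then show ?thesis using y by (simp add: set_borel_measurable_def indicator_times)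
qed

lemma compact_in_cylinder:
  fixes K :: "('a::euclidean_space \<times> real) set"
  assumes K: "compact K" "K \<subseteq> S \<times> {0<..}"
  obtains a b :: real where "0 < a" "K \<subseteq> S \<times> {a..b}"
proof (cases "K = {}")
  case True
  then show ?thesis using that[of 1 1] by simp
next
  case False
  have c: "continuous_on K snd" by (intro continuous_intros)
  obtain z1 where z1: "z1 \<in> K" "\<And>z. z \<in> K \<Longrightarrow> snd z1 \<le> snd z"
    using continuous_attains_inf[OF K(1) False c] by auto
  obtain z2 where z2: "z2 \<in> K" "\<And>z. z \<in> K \<Longrightarrow> snd z \<le> snd z2"
    using continuous_attains_sup[OF K(1) False c] by auto
  show ?thesis
  proof (rule that[of "snd z1" "snd z2"])
    show "0 < snd z1" using z1(1) K(2) by auto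
    show "K \<subseteq> S \<times> {snd z1..snd z2}" using z1(2) z2(2) K(2) by fastforce
  qed
qed

lemma L2norm_sq_compact_slices:
  fixes f :: "'a::euclidean_space \<times> real \<Rightarrow> 'b::euclidean_space"
  assumes S: "S \<in> sets borel" and f: "set_borel_measurable lborel (S \<times> {0<..}) f"
    and K: "K \<subseteq> S \<times> {a..b}" "0 < a"
    and B: "AE y in lborel. y \<in> {a..b} \<longrightarrow> L2norm_sq S (\<lambda>x. f (x, y)) \<le> ennreal B"
  shows "L2norm_sq K f \<le> ennreal B * ennreal (b - a)"
proof -
  have sub: "S \<times> {a..b} \<subseteq> S \<times> {0<..}" using K(2) by auto
  have m: "set_borel_measurable lborel (S \<times> {a..b}) f"
    using S by (intro set_borel_measurable_restrict[OF f _ sub] borel_Times) auto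
  have "L2norm_sq K f \<le> L2norm_sq (S \<times> {a..b}) f" by (rule L2norm_sq_mono_set[OF K(1)])
  also have "\<dots> = (\<integral>\<^sup>+y\<in>{a..b}. ennreal 1 * L2norm_sq S (\<lambda>x. f (x, y)) \<partial>lborel)"
    using wnorm_sq_slices[OF m, of "\<lambda>_. 1"] by simp
  also have "\<dots> \<le> (\<integral>\<^sup>+y\<in>{a..b}. ennreal B \<partial>lborel)"
    using B by (intro nn_integral_mono_AE) (auto elim!: eventually_mono simp: indicator_def)
  also have "\<dots> = ennreal B * emeasure lborel {a..b}" by (simp add: nn_integral_cmult_indicator)
  also have "\<dots> \<le> ennreal B * ennreal (b - a)"
    by (intro mult_left_mono) (auto simp: emeasure_lborel_Icc_eq)
  finally show ?thesis .
qed

text \<open>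
  A compact subset of the cylinder stays away from \<open>y = 0\<close> and is bounded, so bounds on slices that are
  locally uniform in \<open>y\<close> suffice for local \<open>L2\<close> convergence.
\<close>

lemma L2norm_sq_local_limit:
  fixes f :: "nat \<Rightarrow> 'a::euclidean_space \<times> real \<Rightarrow> 'b::euclidean_space"
  assumes S: "S \<in> sets borel" and f: "\<And>N. set_borel_measurable lborel (S \<times> {0<..}) (f N)"
    and le: "\<And>N. AE y in lborel. 0 < y \<longrightarrow> L2norm_sq S (\<lambda>x. f N (x, y)) \<le> ennreal (m y * r N)"
    and m: "\<And>a b. 0 < a \<Longrightarrow> \<exists>B. \<forall>y\<in>{a..b}. m y \<le> B"
    and r: "\<And>N. 0 \<le> r N" "r \<longlonglongrightarrow> 0"
    and K: "compact K" "K \<subseteq> S \<times> {0<..}"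
  shows "(\<lambda>N. L2norm_sq K (f N)) \<longlonglongrightarrow> 0"
proof -
  obtain a b where ab: "0 < a" "K \<subseteq> S \<times> {a..b}" using compact_in_cylinder[OF K] .
  obtain B where B: "\<And>y. y \<in> {a..b} \<Longrightarrow> m y \<le> B" using m[OF ab(1)] by blast
  have le': "L2norm_sq K (f N) \<le> ennreal (B * r N) * ennreal (b - a)" for N
  proof (rule L2norm_sq_compact_slices[OF S f ab(2,1)])
    show "AE y in lborel. y \<in> {a..b} \<longrightarrow> L2norm_sq S (\<lambda>x. f N (x, y)) \<le> ennreal (B * r N)"
      using le[of N]
    proof eventually_elim
      case (elim y)
      have "ennreal (m y * r N) \<le> ennreal (B * r N)" if "y \<in> {a..b}"
        using B[OF that] r(1) by (intro ennreal_leI mult_right_mono) auto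
      then show ?case using elim ab(1) by auto
    qed
  qed
  have "(\<lambda>N. ennreal (B * r N) * ennreal (b - a)) \<longlonglongrightarrow> ennreal (B * 0) * ennreal (b - a)"
    by (intro tendsto_mult_ennreal tendsto_ennrealI tendsto_intros r) auto
  then have "(\<lambda>N. ennreal (B * r N) * ennreal (b - a)) \<longlonglongrightarrow> 0" by simp
  then show ?thesis
    by (rule tendsto_sandwich[OF _ _ tendsto_const, rotated 2]) (simp, intro always_eventually allI le')
qed

text \<open>
  The pointwise half of the Riesz-Fischer theorem. The weights \<open>2^j\<close> leave a convergent series of
  integrals, and for almost every \<open>x\<close> the increments are then summable because
  \<open>|d| \<le> 2^(-j) + 2^j |d|\<^sup>2\<close>.
\<close>

lemma L2_fast_cauchy_converges:
  fixes f :: "nat \<Rightarrow> 'a::euclidean_space \<Rightarrow> 'b::euclidean_space"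
  assumes f: "\<And>j. set_borel_measurable lborel S (f j)"
    and C: "0 \<le> C" "\<And>j. L2norm_sq S (\<lambda>x. f (Suc j) x - f j x) \<le> ennreal (C * (1/4) ^ j)"
  shows "AE x in lborel. x \<in> S \<longrightarrow> convergent (\<lambda>j. f j x)"
proof -
  define d where "d j x = indicator S x *\<^sub>R (f (Suc j) x - f j x)" for j x
  have [measurable]: "d j \<in> borel_measurable lborel" for j
    using set_borel_measurable_add(2)[OF f[of "Suc j"] f[of j]] by (simp add: set_borel_measurable_def d_def[abs_def])
  have "(\<integral>\<^sup>+x. (\<Sum>j. ennreal (2 ^ j * (norm (d j x))\<^sup>2)) \<partial>lborel) = (\<Sum>j. \<integral>\<^sup>+x. ennreal (2 ^ j * (norm (d j x))\<^sup>2) \<partial>lborel)"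
    by (intro nn_integral_suminf) measurable
  also have "\<dots> \<le> (\<Sum>j. ennreal (C * (1/2) ^ j))"
  proof (intro suminf_le)
    fix j
    have "(\<integral>\<^sup>+x. ennreal (2 ^ j * (norm (d j x))\<^sup>2) \<partial>lborel) = ennreal (2 ^ j) * (\<integral>\<^sup>+x. ennreal ((norm (d j x))\<^sup>2) \<partial>lborel)"
      by (subst nn_integral_cmult[symmetric]) (auto simp: ennreal_mult)
    also have "\<dots> = ennreal (2 ^ j) * L2norm_sq S (\<lambda>x. f (Suc j) x - f j x)"
      unfolding L2norm_sq_eq d_def ..
    also have "\<dots> \<le> ennreal (2 ^ j) * ennreal (C * (1/4) ^ j)"
      by (intro mult_left_mono C) auto
    also have "\<dots> = ennreal (C * (2 ^ j * (1/4) ^ j))"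
      using C by (subst ennreal_mult[symmetric]) (auto simp: mult_ac)
    also have "2 ^ j * (1/4) ^ j = (1/2 :: real) ^ j" by (simp flip: power_mult_distrib)
    finally show "(\<integral>\<^sup>+x. ennreal (2 ^ j * (norm (d j x))\<^sup>2) \<partial>lborel) \<le> ennreal (C * (1/2) ^ j)" .
  qed auto
  also have "\<dots> = ennreal (\<Sum>j. C * (1/2) ^ j)"
    using C by (intro suminf_ennreal2) (auto intro!: summable_mult summable_geometric)
  finally have "(\<integral>\<^sup>+x. (\<Sum>j. ennreal (2 ^ j * (norm (d j x))\<^sup>2)) \<partial>lborel) \<noteq> \<infinity>"
    by (auto simp: top_unique)
  then have "AE x in lborel. (\<Sum>j. ennreal (2 ^ j * (norm (d j x))\<^sup>2)) \<noteq> \<infinity>"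
    by (intro nn_integral_PInf_AE) auto
  then show ?thesis
  proof eventually_elim
    case (elim x)
    have "summable (\<lambda>j. 2 ^ j * (norm (d j x))\<^sup>2)"
      using elim by (intro summable_suminf_not_top) auto
    then have s: "summable (\<lambda>j. (1/2) ^ j + 2 ^ j * (norm (d j x))\<^sup>2)"
      by (intro summable_add summable_geometric) auto
    have "summable (\<lambda>j. d j x)"
    proof (rule summable_comparison_test[OF _ s], intro exI allI impI)
      fix j :: nat
      define p :: real where "p = 2 ^ j"
      have p: "p > 0" by (simp add: p_def)
      have "p * norm (d j x) \<le> 1 + (p * norm (d j x))\<^sup>2"
        using zero_le_power2[of "p * norm (d j x) - 1"] p
        by (simp add: power2_diff) (smt (verit) mult_nonneg_nonneg norm_ge_zero)
      then have "norm (d j x) \<le> (1 + (p * norm (d j x))\<^sup>2) / p" using p by (simp add: field_simps)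
      also have "\<dots> = 1 / p + p * (norm (d j x))\<^sup>2"
        using p by (simp add: field_simps power2_eq_square)
      finally show "norm (d j x) \<le> (1/2) ^ j + 2 ^ j * (norm (d j x))\<^sup>2"
        by (simp add: p_def power_one_over)
    qed
    then have "convergent (\<lambda>n. \<Sum>j<n. d j x)" by (simp add: summable_iff_convergent)
    moreover have "(\<Sum>j<n. d j x) = f n x - f 0 x" if "x \<in> S" for n
      using that sum_lessThan_telescope[of "\<lambda>j. f j x" n] by (simp add: d_def)
    ultimately have "convergent (\<lambda>n. f n x - f 0 x)" if "x \<in> S" using that by simp
    then show ?case using convergent_add[OF _ convergent_const[of "f 0 x"]] by fastforce
  qed
qed

lemma L2_fatou:
  fixes f :: "nat \<Rightarrow> 'a::euclidean_space \<Rightarrow> 'b::euclidean_space"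
  assumes f: "\<And>j. set_borel_measurable lborel S (f j)" and g: "set_borel_measurable lborel S g"
    and lim: "AE x in lborel. x \<in> S \<longrightarrow> (\<lambda>j. f j x) \<longlonglongrightarrow> F x"
    and le: "\<forall>\<^sub>F j in sequentially. L2norm_sq S (\<lambda>x. f j x - g x) \<le> R"
  shows "L2norm_sq S (\<lambda>x. F x - g x) \<le> R"
proof -
  define d where "d j x = ennreal ((norm (indicator S x *\<^sub>R (f j x - g x)))\<^sup>2)" for j x
  have [measurable]: "d j \<in> borel_measurable lborel" for j
  proof -
    have [measurable]: "(\<lambda>x. indicator S x *\<^sub>R (f j x - g x)) \<in> borel_measurable lborel"
      using set_borel_measurable_add(2)[OF f[of j] g] by (simp add: set_borel_measurable_def)
    show ?thesis unfolding d_def by measurable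
  qed
  have "L2norm_sq S (\<lambda>x. F x - g x) \<le> (\<integral>\<^sup>+x. liminf (\<lambda>j. d j x) \<partial>lborel)"
    unfolding L2norm_sq_eq
  proof (intro nn_integral_mono_AE)
    show "AE x in lborel. ennreal ((norm (indicator S x *\<^sub>R (F x - g x)))\<^sup>2) \<le> liminf (\<lambda>j. d j x)"
      using lim
    proof eventually_elim
      case (elim x)
      have "(\<lambda>j. d j x) \<longlonglongrightarrow> ennreal ((norm (indicator S x *\<^sub>R (F x - g x)))\<^sup>2)"
        using elim unfolding d_def
        by (cases "x \<in> S") (auto intro!: tendsto_ennrealI tendsto_intros)
      then show ?case using lim_imp_Liminf[OF sequentially_bot] by fastforce
    qed
  qed
  also have "\<dots> \<le> liminf (\<lambda>j. \<integral>\<^sup>+x. d j x \<partial>lborel)" by (rule nn_integral_liminf) measurable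
  also have "\<dots> \<le> R"
  proof (rule Liminf_le)
    show "\<forall>\<^sub>F j in sequentially. (\<integral>\<^sup>+x. d j x \<partial>lborel) \<le> R"
      using le by (simp add: L2norm_sq_eq d_def)
  qed simp
  finally show ?thesis .
qed

text \<open>
  Finite combinations of the \<open>e k\<close> obey an upper Bessel-type inequality with weights \<open>\<Lambda>\<close>. This is the
  common feature of the eigenfunctions, their gradients, and their images under the operator.
\<close>

definition bessel_system ::
    "'a::euclidean_space set \<Rightarrow> (nat \<Rightarrow> 'a \<Rightarrow> 'b::euclidean_space) \<Rightarrow> (nat \<Rightarrow> real) \<Rightarrow> bool" where
  "bessel_system S e \<Lambda> \<longleftrightarrow> (\<forall>k. in_L2 S (e k) \<and> 0 \<le> \<Lambda> k) \<and>
     (\<forall>I b. finite I \<longrightarrow> L2norm_sq S (\<lambda>x. \<Sum>k\<in>I. b k *\<^sub>R e k x) \<le> ennreal (\<Sum>k\<in>I. \<Lambda> k * (b k)\<^sup>2))"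

lemma square_tail_sum_le:
  fixes u :: "nat \<Rightarrow> real"
  assumes "summable (\<lambda>k. (u k)\<^sup>2)"
  shows "(\<Sum>k\<in>{N..<M}. (u k)\<^sup>2) \<le> (\<Sum>k. (u (k + N))\<^sup>2)"
proof -
  have "(\<Sum>k\<in>{N..<M}. (u k)\<^sup>2) = (\<Sum>k<M-N. (u (k + N))\<^sup>2)"
    by (cases "N \<le> M") (simp_all add: sum.atLeastLessThan_shift_0[of _ N M] lessThan_atLeast0 add.commute)
  also have "\<dots> \<le> (\<Sum>k. (u (k + N))\<^sup>2)"
    by (intro sum_le_suminf) (auto simp: summable_iff_shift[of "\<lambda>k. (u k)\<^sup>2" N] assms)
  finally show ?thesis .
qed

text \<open>
  The bound \<open>m y\<close> is uniform in \<open>k\<close>, so the tails of the series on the slice at height \<open>y\<close> are controlled by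
  the tails of \<open>\<Sum>k. (u k)\<^sup>2\<close>. A subsequence along which these are geometrically small converges almost
  everywhere on every slice at once. Taking its pointwise limit yields one jointly measurable
  function, which an abstract \<open>L2\<close> limit on each slice would not.
\<close>

lemma bessel_system_series:
  fixes e :: "nat \<Rightarrow> 'a::euclidean_space \<Rightarrow> 'b::euclidean_space" and w :: "nat \<Rightarrow> real \<Rightarrow> real"
  assumes S: "S \<in> sets borel" and e: "bessel_system S e \<Lambda>"
    and w: "\<And>k. continuous_on {0<..} (w k)" and u: "summable (\<lambda>k. (u k)\<^sup>2)"
    and m: "\<And>k y. 0 < y \<Longrightarrow> \<Lambda> k * (w k y)\<^sup>2 \<le> m y"
  obtains E where "set_borel_measurable lborel (S \<times> {0<..}) E"
    and "\<And>y N. 0 < y \<Longrightarrow> L2norm_sq S (\<lambda>x. (\<Sum>k<N. (u k * w k y) *\<^sub>R e k x) - E (x, y))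
           \<le> ennreal (m y * (\<Sum>k. (u (k + N))\<^sup>2))"
    and "\<And>y. 0 < y \<Longrightarrow> L2norm_sq S (\<lambda>x. E (x, y)) \<le> (\<Sum>k. ennreal (\<Lambda> k * (u k * w k y)\<^sup>2))"
proof -
  have eL2: "in_L2 S (e k)" and \<Lambda>: "0 \<le> \<Lambda> k"
    and bes: "finite I \<Longrightarrow> L2norm_sq S (\<lambda>x. \<Sum>k\<in>I. b k *\<^sub>R e k x) \<le> ennreal (\<Sum>k\<in>I. \<Lambda> k * (b k)\<^sup>2)" for k I b
    using e by (auto simp: bessel_system_def)
  have m0: "0 \<le> m y" if "0 < y" for y
    using m[OF that, of 0] \<Lambda>[of 0] by (meson mult_nonneg_nonneg order_trans zero_le_power2)
  define t where "t N = (\<Sum>k. (u (k + N))\<^sup>2)" for N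
  have su: "summable (\<lambda>k. (u (k + N))\<^sup>2)" for N using u by (subst summable_iff_shift)
  have t_lim: "t \<longlonglongrightarrow> 0" unfolding t_def by (rule suminf_exist_split2[OF u])
  note t_le = square_tail_sum_le[OF u, folded t_def]
  have t_anti: "t M \<le> t N" if "N \<le> M" for N M
  proof -
    have "t N = t M + (\<Sum>k<M-N. (u (k + N))\<^sup>2)"
      using suminf_split_initial_segment[OF su[of N], of "M - N"] that by (simp add: t_def add.assoc)
    then show ?thesis by (simp add: sum_nonneg)
  qed
  have t0: "0 \<le> t N" for N unfolding t_def by (intro suminf_nonneg su) auto
  \<comment> \<open>The summand \<open>j\<close> makes \<open>n\<close> tend to infinity even if \<open>u\<close> has only finitely many nonzero terms.\<close>
  define n where "n j = (LEAST i. t i \<le> (1/4) ^ j) + j" for j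
  have ex: "\<exists>i. t i \<le> (1/4) ^ j" for j :: nat
    using order_tendstoD(2)[OF t_lim, of "(1/4) ^ j"] by (auto simp: eventually_sequentially intro: less_imp_le)
  have tn: "t (n j) \<le> (1/4) ^ j" for j
    using LeastI_ex[OF ex[of j]] t_anti[of "LEAST i. t i \<le> (1/4) ^ j" "n j"] by (simp add: n_def)
  have n_mono: "n j \<le> n (Suc j)" for j
  proof -
    have "t (LEAST i. t i \<le> (1/4) ^ Suc j) \<le> (1/4) ^ Suc j" by (rule LeastI_ex[OF ex])
    also have "\<dots> \<le> (1/4) ^ j" by simp
    finally have "(LEAST i. t i \<le> (1/4) ^ j) \<le> (LEAST i. t i \<le> (1/4) ^ Suc j)" by (rule Least_le)
    then show ?thesis by (simp add: n_def)
  qed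
  have n_ge: "j \<le> n j" for j by (simp add: n_def)
  define P where "P N z = (\<Sum>k<N. (u k * (indicator {0<..} (snd z) * w k (snd z))) *\<^sub>R (indicator S (fst z) *\<^sub>R e k (fst z)))" for N z
  have [measurable]: "(\<lambda>x. indicator S x *\<^sub>R e k x) \<in> borel_measurable borel" for k
    using eL2[of k] by (simp add: in_wL2_def set_borel_measurable_def)
  have [measurable]: "(\<lambda>y. indicator {0<..} y * w k y) \<in> borel_measurable borel" for k
    using borel_measurable_continuous_on_indicator[OF _ w[of k]] by simp
  have P_meas: "P N \<in> borel_measurable (borel \<Otimes>\<^sub>M borel)" for N
    unfolding P_def by measurable
  have P_meas': "P N \<in> borel_measurable borel" for N using P_meas by (simp add: borel_prod)
  define E where "E z = lim (\<lambda>j. P (n j) z)" for z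
  have E_meas: "E \<in> borel_measurable borel" unfolding E_def[abs_def] using P_meas' by measurable
  have P_eq: "P N (x, y) = (\<Sum>k<N. (u k * w k y) *\<^sub>R e k x)" if "x \<in> S" "0 < y" for N x y
    using that by (simp add: P_def)
  have PL2: "set_borel_measurable lborel S (\<lambda>x. \<Sum>k\<in>I. b k *\<^sub>R e k x)" for I b
    using eL2 by (intro set_borel_measurable_sum set_borel_measurable_scaleR) (auto simp: in_wL2_def)
  have PyL2: "set_borel_measurable lborel S (\<lambda>x. P N (x, y))" if "0 < y" for N y
  proof -
    have "(\<lambda>x. indicator S x *\<^sub>R P N (x, y)) = (\<lambda>x. indicator S x *\<^sub>R (\<Sum>k<N. (u k * w k y) *\<^sub>R e k x))"
      using that P_eq by (auto simp: indicator_def fun_eq_iff)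
    then show ?thesis using PL2[of "\<lambda>k. u k * w k y" "{..<N}"] by (simp add: set_borel_measurable_def)
  qed
  have diff: "L2norm_sq S (\<lambda>x. P M (x, y) - P N (x, y)) \<le> ennreal (m y * t N)" if "N \<le> M" "0 < y" for N M y
  proof -
    have "L2norm_sq S (\<lambda>x. P M (x, y) - P N (x, y)) = L2norm_sq S (\<lambda>x. \<Sum>k\<in>{N..<M}. (u k * w k y) *\<^sub>R e k x)"
    proof (rule L2norm_sq_cong)
      fix x assume "x \<in> S"
      then show "norm (P M (x, y) - P N (x, y)) = norm (\<Sum>k\<in>{N..<M}. (u k * w k y) *\<^sub>R e k x)"
        using that by (simp add: P_eq lessThan_atLeast0 sum_diff_nat_ivl)
    qed
    also have "\<dots> \<le> ennreal (\<Sum>k\<in>{N..<M}. \<Lambda> k * (u k * w k y)\<^sup>2)" by (intro bes) auto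
    also have "\<dots> \<le> ennreal (m y * t N)"
    proof (intro ennreal_leI)
      have "(\<Sum>k\<in>{N..<M}. \<Lambda> k * (u k * w k y)\<^sup>2) \<le> (\<Sum>k\<in>{N..<M}. m y * (u k)\<^sup>2)"
      proof (intro sum_mono)
        fix k
        have "\<Lambda> k * (u k * w k y)\<^sup>2 = \<Lambda> k * (w k y)\<^sup>2 * (u k)\<^sup>2" by (simp add: power_mult_distrib)
        also have "\<dots> \<le> m y * (u k)\<^sup>2" using m[OF that(2)] by (intro mult_right_mono) auto
        finally show "\<Lambda> k * (u k * w k y)\<^sup>2 \<le> m y * (u k)\<^sup>2" .
      qed
      also have "\<dots> \<le> m y * t N"
        unfolding sum_distrib_left[symmetric] using m0[OF that(2)] by (intro mult_left_mono t_le)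
      finally show "(\<Sum>k\<in>{N..<M}. \<Lambda> k * (u k * w k y)\<^sup>2) \<le> m y * t N" .
    qed
    finally show ?thesis .
  qed
  have conv: "AE x in lborel. x \<in> S \<longrightarrow> (\<lambda>j. P (n j) (x, y)) \<longlonglongrightarrow> E (x, y)" if y: "0 < y" for y
  proof -
    have "AE x in lborel. x \<in> S \<longrightarrow> convergent (\<lambda>j. P (n j) (x, y))"
    proof (rule L2_fast_cauchy_converges)
      show "L2norm_sq S (\<lambda>x. P (n (Suc j)) (x, y) - P (n j) (x, y)) \<le> ennreal (m y * (1/4) ^ j)" for j
        using order_trans[OF diff[OF n_mono y] ennreal_leI[OF mult_left_mono[OF tn m0[OF y]]]] .
    qed (use PyL2[OF y] m0[OF y] in auto)
    then show ?thesis unfolding E_def by (auto elim!: eventually_mono simp: convergent_LIMSEQ_iff)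
  qed
  have b1: "L2norm_sq S (\<lambda>x. E (x, y) - P N (x, y)) \<le> ennreal (m y * t N)" if y: "0 < y" for y N
  proof (rule L2_fatou[OF PyL2[OF y] PyL2[OF y] conv[OF y]])
    show "\<forall>\<^sub>F j in sequentially. L2norm_sq S (\<lambda>x. P (n j) (x, y) - P N (x, y)) \<le> ennreal (m y * t N)"
      using eventually_ge_at_top[of N]
      by eventually_elim (rule diff[OF order_trans[OF _ n_ge] y])
  qed
  show ?thesis
  proof (rule that[of E])
    have "S \<times> {0::real<..} \<in> sets borel" using S by (intro borel_Times) auto
    then show "set_borel_measurable lborel (S \<times> {0<..}) E"
      using E_meas by (simp add: set_borel_measurable_def)
    fix y :: real assume y: "0 < y"
    show "L2norm_sq S (\<lambda>x. (\<Sum>k<N. (u k * w k y) *\<^sub>R e k x) - E (x, y)) \<le> ennreal (m y * (\<Sum>k. (u (k + N))\<^sup>2))" for N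
    proof -
      have "L2norm_sq S (\<lambda>x. (\<Sum>k<N. (u k * w k y) *\<^sub>R e k x) - E (x, y)) = L2norm_sq S (\<lambda>x. E (x, y) - P N (x, y))"
        by (rule L2norm_sq_cong) (simp add: P_eq y norm_minus_commute)
      then show ?thesis using b1[OF y, of N] by (simp add: t_def)
    qed
    have "L2norm_sq S (\<lambda>x. E (x, y) - 0) \<le> (\<Sum>k. ennreal (\<Lambda> k * (u k * w k y)\<^sup>2))"
    proof (rule L2_fatou[OF PyL2[OF y] _ conv[OF y]])
      show "set_borel_measurable lborel S (\<lambda>x. 0 :: 'b)" by (simp add: set_borel_measurable_def)
      show "\<forall>\<^sub>F j in sequentially. L2norm_sq S (\<lambda>x. P (n j) (x, y) - 0) \<le> (\<Sum>k. ennreal (\<Lambda> k * (u k * w k y)\<^sup>2))"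
      proof (intro always_eventually allI)
        fix j
        have "L2norm_sq S (\<lambda>x. P (n j) (x, y) - 0) = L2norm_sq S (\<lambda>x. \<Sum>k<n j. (u k * w k y) *\<^sub>R e k x)"
          by (rule L2norm_sq_cong) (simp add: P_eq y)
        also have "\<dots> \<le> ennreal (\<Sum>k<n j. \<Lambda> k * (u k * w k y)\<^sup>2)" by (intro bes) auto
        also have "\<dots> = (\<Sum>k<n j. ennreal (\<Lambda> k * (u k * w k y)\<^sup>2))"
          using \<Lambda> by (intro sum_ennreal[symmetric]) auto
        also have "\<dots> \<le> (\<Sum>k. ennreal (\<Lambda> k * (u k * w k y)\<^sup>2))" by (intro sum_le_suminf) auto
        finally show "L2norm_sq S (\<lambda>x. P (n j) (x, y) - 0) \<le> (\<Sum>k. ennreal (\<Lambda> k * (u k * w k y)\<^sup>2))" .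
      qed
    qed
    then show "L2norm_sq S (\<lambda>x. E (x, y)) \<le> (\<Sum>k. ennreal (\<Lambda> k * (u k * w k y)\<^sup>2))" by simp
  qed
qed

section \<open>Limits of test functions in the first-order Sobolev norm\<close>

lemma smooth_add:
  assumes f: "smooth f" and g: "smooth g"
  shows "partials bs (\<lambda>x. f x + g x) = (\<lambda>x. partials bs f x + partials bs g x)" "smooth (\<lambda>x. f x + g x)"
proof -
  have d: "partials bs f differentiable (at x)" "partials bs g differentiable (at x)" for bs x
    using f g by (auto simp: smooth_def)
  show eq: "partials bs (\<lambda>x. f x + g x) = (\<lambda>x. partials bs f x + partials bs g x)" for bs
  proof (induction bs)
    case (Cons b bs)
    have "frechet_derivative (\<lambda>x. partials bs f x + partials bs g x) (at x) =
       (\<lambda>e. frechet_derivative (partials bs f) (at x) e + frechet_derivative (partials bs g) (at x) e)" for x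
      by (intro frechet_derivative_at[symmetric] has_derivative_add) (use d in \<open>simp_all flip: frechet_derivative_works\<close>)
    then show ?case by (simp add: Cons)
  qed simp
  show "smooth (\<lambda>x. f x + g x)" unfolding smooth_def eq using d by (auto intro: differentiable_add)
qed

lemma smooth_cmult:
  assumes f: "smooth f"
  shows "partials bs (\<lambda>x. a * f x) = (\<lambda>x. a * partials bs f x)" "smooth (\<lambda>x. a * f x)"
proof -
  have d: "partials bs f differentiable (at x)" for bs x
    using f by (auto simp: smooth_def)
  show eq: "partials bs (\<lambda>x. a * f x) = (\<lambda>x. a * partials bs f x)" for bs
  proof (induction bs)
    case (Cons b bs)
    have "frechet_derivative (\<lambda>x. a * partials bs f x) (at x) =
       (\<lambda>e. a * frechet_derivative (partials bs f) (at x) e)" for x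
      by (intro frechet_derivative_at[symmetric] has_derivative_mult_right) (use d in \<open>simp_all flip: frechet_derivative_works\<close>)
    then show ?case by (simp add: Cons)
  qed simp
  show "smooth (\<lambda>x. a * f x)" unfolding smooth_def eq using d by (auto intro: differentiable_mult)
qed

lemma test_function_add:
  assumes "test_function S f" "test_function S g" shows "test_function S (\<lambda>x. f x + g x)"
proof -
  obtain K L where "compact K" "K \<subseteq> S" "\<And>x. x \<notin> K \<Longrightarrow> f x = 0" "compact L" "L \<subseteq> S" "\<And>x. x \<notin> L \<Longrightarrow> g x = 0"
    using assms by (auto simp: test_function_def)
  then show ?thesis using assms unfolding test_function_def
    by (intro conjI smooth_add(2) exI[of _ "K \<union> L"]) auto
qed

lemma test_function_cmult:
  assumes "test_function S f" shows "test_function S (\<lambda>x. a * f x)"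
proof -
  obtain K where "compact K" "K \<subseteq> S" "\<And>x. x \<notin> K \<Longrightarrow> f x = 0"
    using assms by (auto simp: test_function_def)
  then show ?thesis using assms unfolding test_function_def
    by (intro conjI smooth_cmult(2) exI[of _ K]) auto
qed

lemma test_function_smooth: "test_function S f \<Longrightarrow> smooth f"
  by (simp add: test_function_def)

lemma grad_add: "smooth f \<Longrightarrow> smooth g \<Longrightarrow> grad (\<lambda>x. f x + g x) x = grad f x + grad g x"
  unfolding grad_def using fun_cong[OF smooth_add(1)[of f g "[b]" for b]]
  by (simp add: scaleR_add_left sum.distrib)

lemma grad_cmult: "smooth f \<Longrightarrow> grad (\<lambda>x. a * f x) x = a *\<^sub>R grad f x"
  unfolding grad_def using fun_cong[OF smooth_cmult(1)[of f "[b]" for b]]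
  by (simp add: scaleR_sum_right)

lemma grad_continuous: assumes "smooth f" shows "continuous_on A (grad f)"
proof -
  have "continuous_on A (\<lambda>x. \<Sum>b\<in>Basis. partials [b] f x *\<^sub>R b)"
    by (intro continuous_intros smooth_continuous smooth_partials assms)
  then show ?thesis by (simp add: grad_def[abs_def])
qed

lemma test_function_in_L2:
  assumes S: "S \<in> sets borel" and \<eta>: "test_function S \<eta>"
  shows "in_L2 S \<eta>" "in_L2 S (grad \<eta>)"
proof -
  obtain K where K: "compact K" "K \<subseteq> S" "\<And>x. x \<notin> K \<Longrightarrow> \<eta> x = 0" "smooth \<eta>"
    using \<eta> by (auto simp: test_function_def)
  have comp: "in_L2 S g" if g: "continuous_on UNIV g" "\<And>x. x \<notin> K \<Longrightarrow> g x = 0" for g :: "'a \<Rightarrow> real"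
  proof -
    have eq: "(\<lambda>x. indicator S x *\<^sub>R g x) = (\<lambda>x. indicator K x *\<^sub>R g x)"
      using K g(2) by (auto simp: indicator_def fun_eq_iff)
    have "in_L2 K g" using g K by (intro in_L2_continuous_compact) (auto intro: continuous_on_subset)
    then show ?thesis unfolding in_wL2_def L2norm_sq_eq set_borel_measurable_def eq fun_cong[OF eq] .
  qed
  show "in_L2 S \<eta>" by (rule comp) (auto intro: smooth_continuous K)
  have "in_L2 S (partials [b] \<eta>)" for b
    by (rule comp) (auto intro!: smooth_continuous smooth_partials K partials_zero_off[OF compact_imp_closed[OF K(1)] K(3)] simp del: partials.simps)
  then have "in_L2 S (\<lambda>x. partials [b] \<eta> x *\<^sub>R b)" for b
  proof -
    assume *: "\<And>b. in_L2 S (partials [b] \<eta>)"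
    have m: "(\<lambda>x. indicator S x *\<^sub>R partials [b] \<eta> x) \<in> borel_measurable lborel"
      using *[of b] by (simp add: in_wL2_def set_borel_measurable_def)
    have "(\<lambda>x. (indicator S x *\<^sub>R partials [b] \<eta> x) *\<^sub>R b) \<in> borel_measurable lborel"
      using m by measurable
    then have m2: "set_borel_measurable lborel S (\<lambda>x. partials [b] \<eta> x *\<^sub>R b)"
      by (simp add: set_borel_measurable_def)
    have "L2norm_sq S (\<lambda>x. partials [b] \<eta> x *\<^sub>R b) = L2norm_sq S (\<lambda>x. norm b *\<^sub>R partials [b] \<eta> x)"
      by (rule L2norm_sq_cong) (simp add: abs_mult mult.commute)
    also have "\<dots> < \<infinity>" using in_L2_scaleR[OF *, of "norm b" b] by (simp add: in_wL2_def)
    finally show ?thesis using m2 by (simp add: in_wL2_def)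
  qed
  then have "in_L2 S (\<lambda>x. \<Sum>b\<in>Basis. partials [b] \<eta> x *\<^sub>R b)" by (intro in_L2_sum)
  then show "in_L2 S (grad \<eta>)" by (simp add: grad_def[abs_def])
qed

lemma H01_lincomb:
  assumes S: "S \<in> sets borel" and 1: "H01 S w G" and 2: "H01 S w' G'"
  shows "H01 S (\<lambda>x. a * w x + w' x) (\<lambda>x. a *\<^sub>R G x + G' x)"
proof -
  obtain \<eta> where \<eta>: "\<And>j. test_function S (\<eta> j)" "(\<lambda>j. L2norm_sq S (\<lambda>x. \<eta> j x - w x)) \<longlonglongrightarrow> 0"
        "(\<lambda>j. L2norm_sq S (\<lambda>x. grad (\<eta> j) x - G x)) \<longlonglongrightarrow> 0"
    using 1 by (auto simp: H01_def)
  obtain \<zeta> where \<zeta>: "\<And>j. test_function S (\<zeta> j)" "(\<lambda>j. L2norm_sq S (\<lambda>x. \<zeta> j x - w' x)) \<longlonglongrightarrow> 0"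
        "(\<lambda>j. L2norm_sq S (\<lambda>x. grad (\<zeta> j) x - G' x)) \<longlonglongrightarrow> 0"
    using 2 by (auto simp: H01_def)
  have L: "in_L2 S w" "in_L2 S w'" "in_L2 S G" "in_L2 S G'" using 1 2 by (auto simp: H01_def)
  have lim: "(\<lambda>j. L2norm_sq S (\<lambda>x. (a *\<^sub>R f j x + g j x) - (a *\<^sub>R p x + q x))) \<longlonglongrightarrow> 0"
    if L2: "\<And>j. in_L2 S (f j)" "\<And>j. in_L2 S (g j)" "in_L2 S p" "in_L2 S q"
      and l: "(\<lambda>j. L2norm_sq S (\<lambda>x. f j x - p x)) \<longlonglongrightarrow> 0" "(\<lambda>j. L2norm_sq S (\<lambda>x. g j x - q x)) \<longlonglongrightarrow> 0"
    for f g :: "nat \<Rightarrow> 'a \<Rightarrow> 'c::euclidean_space" and p q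
  proof (rule tendsto_sandwich[OF _ _ tendsto_const])
    let ?b = "\<lambda>j. 2 * (ennreal (a\<^sup>2) * L2norm_sq S (\<lambda>x. f j x - p x)) + 2 * L2norm_sq S (\<lambda>x. g j x - q x)"
    show "\<forall>\<^sub>F j in sequentially. L2norm_sq S (\<lambda>x. (a *\<^sub>R f j x + g j x) - (a *\<^sub>R p x + q x)) \<le> ?b j"
    proof (intro always_eventually allI)
      fix j
      have d: "in_L2 S (\<lambda>x. f j x - p x)" "in_L2 S (\<lambda>x. g j x - q x)" using L2 by (auto intro: in_L2_diff)
      have "L2norm_sq S (\<lambda>x. a *\<^sub>R (f j x - p x) + (g j x - q x)) \<le> ?b j"
        using L2norm_sq_add_le[of S "\<lambda>x. a *\<^sub>R (f j x - p x)" "\<lambda>x. g j x - q x"] d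
          L2norm_sq_scaleR[of S "\<lambda>x. f j x - p x" a]
        by (simp add: in_wL2_def set_borel_measurable_scaleR)
      then show "L2norm_sq S (\<lambda>x. (a *\<^sub>R f j x + g j x) - (a *\<^sub>R p x + q x)) \<le> ?b j"
        by (simp add: algebra_simps)
    qed
    have "?b \<longlonglongrightarrow> 2 * (ennreal (a\<^sup>2) * 0) + 2 * 0"
      by (intro tendsto_add tendsto_mult_ennreal tendsto_const l) auto
    then show "?b \<longlonglongrightarrow> 0" by simp
  qed simp
  show ?thesis unfolding H01_def
  proof (intro conjI exI[of _ "\<lambda>j x. a * \<eta> j x + \<zeta> j x"] allI)
    show "test_function S (\<lambda>x. a * \<eta> j x + \<zeta> j x)" for j by (intro test_function_add test_function_cmult \<eta> \<zeta>)
    note fL2 = test_function_in_L2[OF S \<eta>(1)] test_function_in_L2[OF S \<zeta>(1)]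
    show "(\<lambda>j. L2norm_sq S (\<lambda>x. a * \<eta> j x + \<zeta> j x - (a * w x + w' x))) \<longlonglongrightarrow> 0"
      using lim[OF fL2(1,3) L(1,2) \<eta>(2) \<zeta>(2)] by simp
    show "(\<lambda>j. L2norm_sq S (\<lambda>x. grad (\<lambda>x. a * \<eta> j x + \<zeta> j x) x - (a *\<^sub>R G x + G' x))) \<longlonglongrightarrow> 0"
      using lim[OF fL2(2,4) L(3,4) \<eta>(3) \<zeta>(3)]
      by (simp add: grad_add grad_cmult smooth_cmult test_function_smooth[OF \<eta>(1)] test_function_smooth[OF \<zeta>(1)])
    show "in_L2 S (\<lambda>x. a * w x + w' x)" using in_L2_add[OF in_L2_scaleR[OF L(1), of a] L(2)] by simp
  qed (use L in \<open>auto intro: in_L2_add in_L2_scaleR\<close>)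
qed

lemma H01_zero: "H01 S (\<lambda>x. 0) (\<lambda>x. 0)"
proof -
  have p: "partials bs (\<lambda>x::'a. 0) = (\<lambda>x. 0)" for bs by (induction bs) auto
  then have "test_function S (\<lambda>x. 0)" by (auto simp: test_function_def smooth_def)
  then show ?thesis unfolding H01_def
    by (intro conjI in_L2_zero exI[of _ "\<lambda>_ _. 0"]) (auto simp: grad_def wnorm_sq_def)
qed

lemma H01_sum:
  assumes S: "S \<in> sets borel" and "\<And>k. H01 S (w k) (G k)" "finite I"
  shows "H01 S (\<lambda>x. \<Sum>k\<in>I. b k * w k x) (\<lambda>x. \<Sum>k\<in>I. b k *\<^sub>R G k x)"
  using assms(3) by (induction I) (auto intro!: H01_lincomb[OF S] H01_zero assms(2))

text \<open>
  A diagonal choice of test functions.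
\<close>

lemma H01_closed:
  fixes w :: "'a::euclidean_space \<Rightarrow> real"
  assumes S: "S \<in> sets borel" and N: "\<And>N. H01 S (wN N) (GN N)" and L: "in_L2 S w" "in_L2 S G"
    and lim: "(\<lambda>N. L2norm_sq S (\<lambda>x. wN N x - w x)) \<longlonglongrightarrow> 0" "(\<lambda>N. L2norm_sq S (\<lambda>x. GN N x - G x)) \<longlonglongrightarrow> 0"
  shows "H01 S w G"
proof -
  have LN: "in_L2 S (wN N)" "in_L2 S (GN N)" for N using N by (auto simp: H01_def)
  have "\<exists>\<eta>. test_function S \<eta> \<and> L2norm_sq S (\<lambda>x. \<eta> x - w x) \<le> ennreal (4 * (1 / real (Suc j))) \<and>
     L2norm_sq S (\<lambda>x. grad \<eta> x - G x) \<le> ennreal (4 * (1 / real (Suc j)))" for j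
  proof -
    let ?e = "ennreal (1 / real (Suc j))"
    have e: "0 < ?e" by simp
    from eventually_conj[OF order_tendstoD(2)[OF lim(1) e] order_tendstoD(2)[OF lim(2) e]]
    obtain M where M: "L2norm_sq S (\<lambda>x. wN M x - w x) < ?e" "L2norm_sq S (\<lambda>x. GN M x - G x) < ?e"
      by (auto simp: eventually_sequentially)
    obtain \<eta> where \<eta>: "\<And>j. test_function S (\<eta> j)" "(\<lambda>j. L2norm_sq S (\<lambda>x. \<eta> j x - wN M x)) \<longlonglongrightarrow> 0"
        "(\<lambda>j. L2norm_sq S (\<lambda>x. grad (\<eta> j) x - GN M x)) \<longlonglongrightarrow> 0"
      using N[of M] by (auto simp: H01_def)
    from eventually_conj[OF order_tendstoD(2)[OF \<eta>(2) e] order_tendstoD(2)[OF \<eta>(3) e]]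
    obtain i where i: "L2norm_sq S (\<lambda>x. \<eta> i x - wN M x) < ?e" "L2norm_sq S (\<lambda>x. grad (\<eta> i) x - GN M x) < ?e"
      by (auto simp: eventually_sequentially)
    have tri: "L2norm_sq S (\<lambda>x. f x - h x) \<le> ennreal (4 * (1 / real (Suc j)))"
      if "L2norm_sq S (\<lambda>x. f x - g x) < ?e" "L2norm_sq S (\<lambda>x. g x - h x) < ?e" "in_L2 S f" "in_L2 S g" "in_L2 S h"
      for f g h :: "'a \<Rightarrow> 'c::euclidean_space"
    proof -
      have "L2norm_sq S (\<lambda>x. f x - h x) \<le> 2 * L2norm_sq S (\<lambda>x. f x - g x) + 2 * L2norm_sq S (\<lambda>x. g x - h x)"
        using L2norm_sq_add_le[of S "\<lambda>x. f x - g x" "\<lambda>x. g x - h x"] in_L2_diff[OF that(3,4)] in_L2_diff[OF that(4,5)]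
        by (simp add: in_wL2_def)
      also have "\<dots> \<le> 2 * ?e + 2 * ?e" using that by (intro add_mono mult_left_mono) auto
      also have "\<dots> = ennreal (2 * (1 / real (Suc j)) + 2 * (1 / real (Suc j)))"
      proof -
        have "2 * ennreal r + 2 * ennreal r = ennreal (2 * r + 2 * r)" if "0 \<le> r" for r
        proof -
          have "2 * ennreal r = ennreal (2 * r)" using that by (simp add: ennreal_mult)
          then show ?thesis using ennreal_plus[of "2 * r" "2 * r"] that by (simp only:)
        qed
        then show ?thesis by simp
      qed
      finally show ?thesis by simp
    qed
    show ?thesis
      by (intro exI[of _ "\<eta> i"] conjI \<eta>(1) tri[OF i(1) M(1)] tri[OF i(2) M(2)] LN L test_function_in_L2[OF S])
  qed
  then obtain \<eta> where \<eta>: "\<And>j. test_function S (\<eta> j)"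
     "\<And>j. L2norm_sq S (\<lambda>x. \<eta> j x - w x) \<le> ennreal (4 * (1 / real (Suc j)))"
     "\<And>j. L2norm_sq S (\<lambda>x. grad (\<eta> j) x - G x) \<le> ennreal (4 * (1 / real (Suc j)))"
    by metis
  have "(\<lambda>j. 4 * (1 / real (Suc j))) \<longlonglongrightarrow> 4 * 0"
    by (intro tendsto_mult tendsto_const LIMSEQ_Suc lim_1_over_n)
  then have z: "(\<lambda>j. ennreal (4 * (1 / real (Suc j)))) \<longlonglongrightarrow> 0"
    by (subst ennreal_tendsto_0_iff) auto
  show ?thesis unfolding H01_def
  proof (intro conjI L exI[of _ \<eta>] allI \<eta>(1))
    show "(\<lambda>j. L2norm_sq S (\<lambda>x. \<eta> j x - w x)) \<longlonglongrightarrow> 0"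
      by (rule tendsto_sandwich[OF _ _ tendsto_const z]) (simp, intro always_eventually allI \<eta>)
    show "(\<lambda>j. L2norm_sq S (\<lambda>x. grad (\<eta> j) x - G x)) \<longlonglongrightarrow> 0"
      by (rule tendsto_sandwich[OF _ _ tendsto_const z]) (simp, intro always_eventually allI \<eta>)
  qed
qed

section \<open>Products of a function of x and a function of y\<close>

lemma set_borel_measurable_component:
  fixes F :: "'a::euclidean_space \<Rightarrow> real ^ 'n"
  assumes "set_borel_measurable lborel S F" shows "set_borel_measurable lborel S (\<lambda>x. F x $ i)"
proof -
  have m: "(\<lambda>x. indicator S x *\<^sub>R F x) \<in> borel_measurable lborel" using assms by (simp add: set_borel_measurable_def)
  have "(\<lambda>x. (indicator S x *\<^sub>R F x) $ i) \<in> borel_measurable lborel"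
    unfolding cart_eq_inner_axis using m by measurable
  then show ?thesis by (simp add: set_borel_measurable_def)
qed

lemma L2norm_sq_component_le:
  fixes F :: "'a::euclidean_space \<Rightarrow> real ^ 'n"
  shows "L2norm_sq S (\<lambda>x. F x $ i) \<le> L2norm_sq S F"
  unfolding wnorm_sq_def
  by (intro nn_integral_mono mult_right_mono ennreal_leI mult_left_mono power_mono) (auto simp: component_le_norm_cart)

lemma in_L2_component:
  fixes F :: "'a::euclidean_space \<Rightarrow> real ^ 'n"
  assumes "in_L2 S F" shows "in_L2 S (\<lambda>x. F x $ i)"
  using assms set_borel_measurable_component[of S F i] le_less_trans[OF L2norm_sq_component_le[of S F i]]
  by (auto simp: in_wL2_def)

lemma tensor_has_derivative:
  assumes f: "smooth f" and D: "(D has_real_derivative D') (at y)"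
  shows "((\<lambda>z. f (fst z) * D (snd z)) has_derivative
     (\<lambda>e. f x * (D' * snd e) + frechet_derivative f (at x) (fst e) * D y)) (at (x, y))"
proof -
  have 1: "((\<lambda>z. f (fst z)) has_derivative (\<lambda>e. frechet_derivative f (at x) (fst e))) (at (x, y))"
    using has_derivative_compose[OF has_derivative_fst[OF has_derivative_ident], of f "frechet_derivative f (at x)" "(x, y)" UNIV]
      smooth_differentiable[OF f, of x] by (simp add: frechet_derivative_works)
  have 2: "((\<lambda>z. D (snd z)) has_derivative (\<lambda>e. D' * snd e)) (at (x, y))"
    using has_derivative_compose[OF has_derivative_snd[OF has_derivative_ident], of D "(*) D'" "(x, y)" UNIV] D
    by (simp add: has_field_derivative_def)
  show ?thesis using has_derivative_mult[OF 1 2] by simp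
qed

lemma tensor_measurable:
  fixes f :: "'a::euclidean_space \<Rightarrow> real" and D :: "real \<Rightarrow> real"
  assumes f: "set_borel_measurable lborel S f" and D: "continuous_on {0<..} D"
  shows "set_borel_measurable lborel (S \<times> {0<..}) (\<lambda>z. f (fst z) * D (snd z))"
proof -
  have [measurable]: "(\<lambda>x. indicator S x *\<^sub>R f x) \<in> borel_measurable borel"
    using f by (simp add: set_borel_measurable_def)
  have [measurable]: "(\<lambda>y. indicator {0<..} y * D y) \<in> borel_measurable borel"
    using borel_measurable_continuous_on_indicator[OF _ D] by simp
  have "(\<lambda>z. (indicator S (fst z) *\<^sub>R f (fst z)) * (indicator {0<..} (snd z) * D (snd z))) \<in> borel_measurable (borel \<Otimes>\<^sub>M borel)"
    by measurable
  moreover have "(\<lambda>z. (indicator S (fst z) *\<^sub>R f (fst z)) * (indicator {0<..} (snd z) * D (snd z)))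
     = (\<lambda>z. indicator (S \<times> {0<..}) z *\<^sub>R (f (fst z) * D (snd z)))"
    by (auto simp: indicator_def fun_eq_iff)
  ultimately show ?thesis by (simp add: set_borel_measurable_def borel_prod)
qed

lemma continuous_bounded_on_Icc:
  fixes D :: "real \<Rightarrow> real"
  assumes "continuous_on {0<..} D" "0 < a"
  shows "\<exists>B. \<forall>y\<in>{a..b}. (D y)\<^sup>2 \<le> B"
proof -
  have "continuous_on {a..b} (\<lambda>y. (D y)\<^sup>2)"
    by (intro continuous_intros continuous_on_subset[OF assms(1)]) (use assms(2) in auto)
  then have "bounded ((\<lambda>y. (D y)\<^sup>2) ` {a..b})"
    by (intro compact_imp_bounded compact_continuous_image) auto
  then show ?thesis by (auto simp: bounded_iff)
qed

lemma tensor_local_limit: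
  fixes f :: "nat \<Rightarrow> 'a::euclidean_space \<Rightarrow> real" and D :: "real \<Rightarrow> real"
  assumes S: "S \<in> sets borel" and f: "\<And>j. in_L2 S (f j)" and g: "in_L2 S g" and D: "continuous_on {0<..} D"
    and lim: "(\<lambda>j. L2norm_sq S (\<lambda>x. f j x - g x)) \<longlonglongrightarrow> 0" and K: "compact K" "K \<subseteq> S \<times> {0<..}"
  shows "(\<lambda>j. L2norm_sq K (\<lambda>z. f j (fst z) * D (snd z) - g (fst z) * D (snd z))) \<longlonglongrightarrow> 0"
proof (rule L2norm_sq_local_limit[OF S _ _ _ _ _ K, where m = "\<lambda>y. (D y)\<^sup>2" and r = "\<lambda>j. enn2real (L2norm_sq S (\<lambda>x. f j x - g x))"])
  have fg: "in_L2 S (\<lambda>x. f j x - g x)" for j by (rule in_L2_diff[OF f g])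
  show "set_borel_measurable lborel (S \<times> {0<..}) (\<lambda>z. f j (fst z) * D (snd z) - g (fst z) * D (snd z))" for j
    by (intro set_borel_measurable_add(2) tensor_measurable D) (use f g in \<open>auto simp: in_wL2_def\<close>)
  let ?r = "\<lambda>j. enn2real (L2norm_sq S (\<lambda>x. f j x - g x))"
  have r: "ennreal (?r j) = L2norm_sq S (\<lambda>x. f j x - g x)" for j
    using fg[of j] by (simp add: in_wL2_def)
  show "AE y in lborel. 0 < y \<longrightarrow> L2norm_sq S (\<lambda>x. f j (fst (x, y)) * D (snd (x, y)) - g (fst (x, y)) * D (snd (x, y)))
     \<le> ennreal ((D y)\<^sup>2 * ?r j)" for j
  proof (intro AE_I2 impI)
    fix y :: real
    have "L2norm_sq S (\<lambda>x. f j (fst (x, y)) * D (snd (x, y)) - g (fst (x, y)) * D (snd (x, y)))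
      = L2norm_sq S (\<lambda>x. D y *\<^sub>R (f j x - g x))"
      by (rule L2norm_sq_cong) (simp add: algebra_simps)
    also have "\<dots> = ennreal ((D y)\<^sup>2) * L2norm_sq S (\<lambda>x. f j x - g x)"
      using fg[of j] by (intro L2norm_sq_scaleR) (simp add: in_wL2_def)
    also have "\<dots> = ennreal ((D y)\<^sup>2 * ?r j)" by (simp add: ennreal_mult r)
    finally show "L2norm_sq S (\<lambda>x. f j (fst (x, y)) * D (snd (x, y)) - g (fst (x, y)) * D (snd (x, y)))
     \<le> ennreal ((D y)\<^sup>2 * ?r j)" by simp
  qed
  show "\<exists>B. \<forall>y\<in>{a..b}. (D y)\<^sup>2 \<le> B" if "0 < a" for a b by (rule continuous_bounded_on_Icc[OF D that])
  show "(\<lambda>j. ?r j) \<longlonglongrightarrow> 0" using tendsto_enn2real[of "\<lambda>j. L2norm_sq S (\<lambda>x. f j x - g x)" 0 sequentially] lim by simp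
qed auto

lemma tensor_in_L2_local:
  fixes f :: "'a::euclidean_space \<Rightarrow> real" and D :: "real \<Rightarrow> real"
  assumes S: "S \<in> sets borel" and f: "in_L2 S f" and D: "continuous_on {0<..} D" and K: "compact K" "K \<subseteq> S \<times> {0<..}"
  shows "in_L2 K (\<lambda>z. f (fst z) * D (snd z))"
proof -
  have m: "set_borel_measurable lborel (S \<times> {0<..}) (\<lambda>z. f (fst z) * D (snd z))"
    using f D by (intro tensor_measurable) (auto simp: in_wL2_def)
  obtain a b where ab: "0 < a" "K \<subseteq> S \<times> {a..b}" using compact_in_cylinder[OF K] .
  obtain B where B: "\<And>y. y \<in> {a..b} \<Longrightarrow> (D y)\<^sup>2 \<le> B" using continuous_bounded_on_Icc[OF D ab(1)] by blast
  define r where "r = enn2real (L2norm_sq S f)"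
  have r: "ennreal r = L2norm_sq S f" using f by (simp add: in_wL2_def r_def)
  have "L2norm_sq K (\<lambda>z. f (fst z) * D (snd z)) \<le> ennreal (B * r) * ennreal (b - a)"
  proof (rule L2norm_sq_compact_slices[OF S m ab(2,1)], intro AE_I2 impI)
    fix y assume y: "y \<in> {a..b}"
    have "L2norm_sq S (\<lambda>x. f (fst (x, y)) * D (snd (x, y))) = L2norm_sq S (\<lambda>x. D y *\<^sub>R f x)"
      by (rule L2norm_sq_cong) (simp add: algebra_simps)
    also have "\<dots> = ennreal ((D y)\<^sup>2 * r)"
      using f by (subst L2norm_sq_scaleR) (simp_all add: in_wL2_def ennreal_mult r r_def)
    also have "\<dots> \<le> ennreal (B * r)" using B[OF y] by (intro ennreal_leI mult_right_mono) (auto simp: r_def)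
    finally show "L2norm_sq S (\<lambda>x. f (fst (x, y)) * D (snd (x, y))) \<le> ennreal (B * r)" .
  qed
  also have "\<dots> < \<infinity>" by (simp add: ennreal_mult_less_top)
  finally show ?thesis
    using set_borel_measurable_restrict[OF m _ K(2)] K(1) by (simp add: in_wL2_def compact_imp_closed borel_closed)
qed

text \<open>
  For a test function of \<open>x\<close> in place of \<open>w\<close> both identities are classical; \<open>w\<close> and \<open>G\<close> are limits of such
  functions and their gradients.
\<close>

lemma tensor_weak_deriv:
  fixes w :: "real ^ 'n \<Rightarrow> real" and D :: "real \<Rightarrow> real"
  assumes S: "open S" and w: "H01 S w G"
    and D: "\<And>y. 0 < y \<Longrightarrow> (D has_real_derivative D' y) (at y)" and D': "continuous_on {0<..} D'"
  shows "weak_deriv (cylinder S) [dir_y] (\<lambda>z. w (fst z) * D (snd z)) (\<lambda>z. w (fst z) * D' (snd z))"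
    and "weak_deriv (cylinder S) [(axis i 1, 0)] (\<lambda>z. w (fst z) * D (snd z)) (\<lambda>z. G (fst z) $ i * D (snd z))"
proof -
  have Sb: "S \<in> sets borel" using S by simp
  have Dc: "continuous_on {0<..} D"
    by (intro continuous_at_imp_continuous_on ballI DERIV_isCont[OF D]) auto
  obtain \<eta> where \<eta>: "\<And>j. test_function S (\<eta> j)" "(\<lambda>j. L2norm_sq S (\<lambda>x. \<eta> j x - w x)) \<longlonglongrightarrow> 0"
        "(\<lambda>j. L2norm_sq S (\<lambda>x. grad (\<eta> j) x - G x)) \<longlonglongrightarrow> 0"
    using w by (auto simp: H01_def)
  have L: "in_L2 S w" "in_L2 S G" using w by (auto simp: H01_def)
  have oC: "open (cylinder S)" unfolding cylinder_def using S by (intro open_Times) auto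
  have sm: "smooth (\<eta> j)" for j by (rule test_function_smooth[OF \<eta>(1)])
  have c1: "continuous_on (cylinder S) (\<lambda>z. f (fst z) * E (snd z))"
    if "continuous_on UNIV f" "continuous_on {0<..} E" for f :: "real ^ 'n \<Rightarrow> real" and E :: "real \<Rightarrow> real"
    unfolding cylinder_def
    by (intro continuous_intros continuous_on_compose2[OF that(1)] continuous_on_compose2[OF that(2)]) auto
  define gi where "gi j x = grad (\<eta> j) x $ i" for j x
  have gi: "frechet_derivative (\<eta> j) (at x) (axis i 1) = gi j x" for j x
  proof -
    have lin: "linear (frechet_derivative (\<eta> j) (at x))"
      using smooth_differentiable[OF sm] by (metis frechet_derivative_works has_derivative_linear)
    have "gi j x = grad (\<eta> j) x \<bullet> axis i 1" by (simp add: gi_def inner_axis)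
    also have "\<dots> = (\<Sum>b\<in>Basis. frechet_derivative (\<eta> j) (at x) b * (b \<bullet> axis i 1))"
      unfolding grad_def by (simp add: inner_sum_left)
    also have "\<dots> = frechet_derivative (\<eta> j) (at x) (\<Sum>b\<in>Basis. (axis i 1 \<bullet> b) *\<^sub>R b)"
      by (simp add: linear_sum[OF lin] linear_scale[OF lin] mult.commute inner_commute)
    also have "(\<Sum>b\<in>Basis. (axis i 1 \<bullet> b) *\<^sub>R b) = axis i (1::real)" by (rule euclidean_representation)
    finally show ?thesis by simp
  qed
  have giL2: "in_L2 S (gi j)" and GiL2: "in_L2 S (\<lambda>x. G x $ i)"
    and gilim: "(\<lambda>j. L2norm_sq S (\<lambda>x. gi j x - G x $ i)) \<longlonglongrightarrow> 0" for j
  proof -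
    note g = test_function_in_L2(2)[OF Sb \<eta>(1)]
    show "in_L2 S (gi j)" using in_L2_component[OF g] by (simp add: gi_def[abs_def])
    show "in_L2 S (\<lambda>x. G x $ i)" by (rule in_L2_component[OF L(2)])
    show "(\<lambda>j. L2norm_sq S (\<lambda>x. gi j x - G x $ i)) \<longlonglongrightarrow> 0"
    proof (rule tendsto_sandwich[OF _ _ tendsto_const \<eta>(3)])
      show "\<forall>\<^sub>F j in sequentially. L2norm_sq S (\<lambda>x. gi j x - G x $ i) \<le> L2norm_sq S (\<lambda>x. grad (\<eta> j) x - G x)"
        using L2norm_sq_component_le[of S "\<lambda>x. grad (\<eta> j) x - G x" i for j] by (simp add: gi_def)
    qed simp
  qed
  note \<eta>L2 = test_function_in_L2(1)[OF Sb \<eta>(1)]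
  show "weak_deriv (cylinder S) [dir_y] (\<lambda>z. w (fst z) * D (snd z)) (\<lambda>z. w (fst z) * D' (snd z))"
  proof (rule weak_deriv_limit)
    fix j
    show "weak_deriv (cylinder S) [dir_y] (\<lambda>z. \<eta> j (fst z) * D (snd z)) (\<lambda>z. \<eta> j (fst z) * D' (snd z))"
    proof (rule weak_deriv_classical[OF oC])
      fix z :: "(real ^ 'n) \<times> real" assume "z \<in> cylinder S"
      then have z: "0 < snd z" by (auto simp: cylinder_def)
      let ?f' = "\<lambda>z e. \<eta> j (fst z) * (D' (snd z) * snd e) + frechet_derivative (\<eta> j) (at (fst z)) (fst e) * D (snd z)"
      show "((\<lambda>z. \<eta> j (fst z) * D (snd z)) has_derivative ?f' z) (at z)"
        using tensor_has_derivative[OF sm D[OF z], of j "fst z"] by simp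
      have "linear (frechet_derivative (\<eta> j) (at (fst z)))"
        using smooth_differentiable[OF sm] by (metis frechet_derivative_works has_derivative_linear)
      then show "?f' z dir_y = \<eta> j (fst z) * D' (snd z)" by (simp add: linear_0)
    qed (intro c1 smooth_continuous sm Dc D')+
  qed (auto simp: cylinder_def intro: tensor_measurable tensor_in_L2_local[OF Sb] tensor_local_limit[OF Sb] \<eta>L2 L \<eta> Dc D'
      intro!: tensor_measurable L[unfolded in_wL2_def, THEN conjunct1])
  show "weak_deriv (cylinder S) [(axis i 1, 0)] (\<lambda>z. w (fst z) * D (snd z)) (\<lambda>z. G (fst z) $ i * D (snd z))"
  proof (rule weak_deriv_limit)
    fix j
    show "weak_deriv (cylinder S) [(axis i 1, 0)] (\<lambda>z. \<eta> j (fst z) * D (snd z)) (\<lambda>z. gi j (fst z) * D (snd z))"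
    proof (rule weak_deriv_classical[OF oC])
      fix z :: "(real ^ 'n) \<times> real" assume "z \<in> cylinder S"
      then have z: "0 < snd z" by (auto simp: cylinder_def)
      let ?f' = "\<lambda>z e. \<eta> j (fst z) * (D' (snd z) * snd e) + frechet_derivative (\<eta> j) (at (fst z)) (fst e) * D (snd z)"
      show "((\<lambda>z. \<eta> j (fst z) * D (snd z)) has_derivative ?f' z) (at z)"
        using tensor_has_derivative[OF sm D[OF z], of j "fst z"] by simp
      show "?f' z (axis i 1, 0) = gi j (fst z) * D (snd z)" by (simp add: gi)
    next
      have "continuous_on UNIV (gi j)" unfolding gi_def using grad_continuous[OF sm] by (intro continuous_intros)
      then show "continuous_on (cylinder S) (\<lambda>z. gi j (fst z) * D (snd z))" by (intro c1 Dc)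
    qed (intro c1 smooth_continuous sm Dc)
  qed (auto simp: cylinder_def intro: tensor_in_L2_local[OF Sb] tensor_local_limit[OF Sb] \<eta>L2 L \<eta> Dc giL2 GiL2 gilim
      intro!: tensor_measurable L[unfolded in_wL2_def, THEN conjunct1] GiL2[unfolded in_wL2_def, THEN conjunct1])
qed

section \<open>The eigenfunctions and their gradients as Bessel systems\<close>

lemma bounded_bilinear_matrix_vector_mult:
  "bounded_bilinear ((*v) :: real ^ 'n ^ 'm \<Rightarrow> real ^ 'n \<Rightarrow> real ^ 'm)"
  unfolding bilinear_conv_bounded_bilinear[symmetric] bilinear_def
  by (auto intro!: linearI simp: matrix_vector_mult_add_rdistrib matrix_vector_right_distrib
      scaleR_matrix_vector_assoc[symmetric] matrix_vector_mult_scaleR)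

lemma L2_inner_sum_left:
  fixes f :: "'i \<Rightarrow> 'a::euclidean_space \<Rightarrow> 'b::euclidean_space"
  assumes f: "\<And>i. i \<in> I \<Longrightarrow> in_L2 S (f i)" and g: "in_L2 S g"
  shows "(LINT x:S|lborel. (\<Sum>i\<in>I. b i *\<^sub>R f i x) \<bullet> g x) = (\<Sum>i\<in>I. b i * (LINT x:S|lborel. f i x \<bullet> g x))"
proof -
  have "(LINT x:S|lborel. (\<Sum>i\<in>I. b i *\<^sub>R f i x) \<bullet> g x)
     = (\<integral>x. (\<Sum>i\<in>I. b i * (indicator S x *\<^sub>R (f i x \<bullet> g x))) \<partial>lborel)"
    unfolding set_lebesgue_integral_def
    by (intro Bochner_Integration.integral_cong) (auto simp: inner_sum_left scaleR_sum_right sum_distrib_left mult_ac)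
  also have "\<dots> = (\<Sum>i\<in>I. (\<integral>x. b i * (indicator S x *\<^sub>R (f i x \<bullet> g x)) \<partial>lborel))"
    using L2_cauchy_schwarz(1)[OF f g]
    by (intro Bochner_Integration.integral_sum) (auto simp: set_integrable_def)
  finally show ?thesis by (simp add: set_lebesgue_integral_def)
qed

locale dirichlet_eigen =
  fixes \<Omega> :: "(real ^ 'n) set" and A :: "real ^ 'n \<Rightarrow> real ^ 'n ^ 'n" and c :: "real ^ 'n \<Rightarrow> real"
    and lam :: "nat \<Rightarrow> real" and \<phi> :: "nat \<Rightarrow> real ^ 'n \<Rightarrow> real"
  assumes open_dom: "open \<Omega>" and bounded_dom: "bounded \<Omega>"
    and coeffs: "coeff_A \<Omega> A" "coeff_c \<Omega> c" and eigen: "eigensystem \<Omega> A c lam \<phi>"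
begin

lemma dom_borel: "\<Omega> \<in> sets borel" using open_dom by simp

lemma A_mult_L2:
  assumes g: "in_L2 \<Omega> g" shows "in_L2 \<Omega> (\<lambda>x. A x *v g x)"
proof -
  obtain L where L: "L-lipschitz_on \<Omega> A" using coeffs(1) by (auto simp: coeff_A_def)
  have "bounded (A ` \<Omega>)"
    by (rule bounded_uniformly_continuous_image[OF lipschitz_on_uniformly_continuous[OF L] bounded_dom])
  then obtain M where M: "\<And>x. x \<in> \<Omega> \<Longrightarrow> norm (A x) \<le> M" by (auto simp: bounded_iff)
  obtain K where K: "K > 0" "\<And>(X :: real ^ 'n ^ 'n) v. norm (X *v v) \<le> norm X * norm v * K"
    using bounded_bilinear.pos_bounded[OF bounded_bilinear_matrix_vector_mult] by metis
  have Am: "(\<lambda>x. indicator \<Omega> x *\<^sub>R A x) \<in> borel_measurable lborel"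
    using borel_measurable_continuous_on_indicator[OF dom_borel lipschitz_on_continuous_on[OF L]] by simp
  have gm: "(\<lambda>x. indicator \<Omega> x *\<^sub>R g x) \<in> borel_measurable lborel"
    using g by (simp add: in_wL2_def set_borel_measurable_def)
  have "(\<lambda>x. (indicator \<Omega> x *\<^sub>R A x) *v (indicator \<Omega> x *\<^sub>R g x)) \<in> borel_measurable lborel"
    by (rule borel_measurable_continuous_Pair[OF Am gm])
      (intro bounded_bilinear.continuous_on[OF bounded_bilinear_matrix_vector_mult] continuous_intros)
  moreover have "(\<lambda>x. (indicator \<Omega> x *\<^sub>R A x) *v (indicator \<Omega> x *\<^sub>R g x)) = (\<lambda>x. indicator \<Omega> x *\<^sub>R (A x *v g x))"
    by (auto simp: indicator_def fun_eq_iff)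
  ultimately have m: "set_borel_measurable lborel \<Omega> (\<lambda>x. A x *v g x)" by (simp add: set_borel_measurable_def)
  have "L2norm_sq \<Omega> (\<lambda>x. A x *v g x) \<le> L2norm_sq \<Omega> (\<lambda>x. (M * K) *\<^sub>R g x)"
    unfolding wnorm_sq_def
  proof (intro nn_integral_mono)
    fix x
    show "ennreal (1 * (norm (A x *v g x))\<^sup>2) * indicator \<Omega> x \<le> ennreal (1 * (norm ((M * K) *\<^sub>R g x))\<^sup>2) * indicator \<Omega> x"
    proof (cases "x \<in> \<Omega>")
      case True
      have M0: "0 \<le> M" using M[OF True] norm_ge_zero order_trans by blast
      have "norm (A x *v g x) \<le> norm (A x) * norm (g x) * K" by (rule K)
      also have "\<dots> \<le> M * norm (g x) * K" using M[OF True] K by (intro mult_right_mono) auto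
      also have "\<dots> = norm ((M * K) *\<^sub>R g x)" using M0 K by (simp add: abs_mult)
      finally have "(norm (A x *v g x))\<^sup>2 \<le> (norm ((M * K) *\<^sub>R g x))\<^sup>2" by (intro power_mono) auto
      then show ?thesis by (intro mult_right_mono ennreal_leI) auto
    qed simp
  qed
  also have "\<dots> < \<infinity>" using in_L2_scaleR[OF g] by (simp add: in_wL2_def)
  finally show ?thesis using m by (simp add: in_wL2_def)
qed

lemma c_mult_L2:
  assumes v: "in_L2 \<Omega> v" shows "in_L2 \<Omega> (\<lambda>x. c x * v x)"
proof -
  obtain M where M: "AE x in lborel. x \<in> \<Omega> \<longrightarrow> 0 \<le> c x \<and> c x \<le> M" using coeffs(2) by (auto simp: coeff_c_def)
  have [measurable]: "(\<lambda>x. indicator \<Omega> x *\<^sub>R c x) \<in> borel_measurable lborel" "(\<lambda>x. indicator \<Omega> x *\<^sub>R v x) \<in> borel_measurable lborel"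
    using coeffs(2) v by (auto simp: coeff_c_def in_wL2_def set_borel_measurable_def)
  have "(\<lambda>x. (indicator \<Omega> x *\<^sub>R c x) * (indicator \<Omega> x *\<^sub>R v x)) \<in> borel_measurable lborel" by measurable
  moreover have "(\<lambda>x. (indicator \<Omega> x *\<^sub>R c x) * (indicator \<Omega> x *\<^sub>R v x)) = (\<lambda>x. indicator \<Omega> x *\<^sub>R (c x * v x))"
    by (auto simp: indicator_def fun_eq_iff)
  ultimately have m: "set_borel_measurable lborel \<Omega> (\<lambda>x. c x * v x)" by (simp add: set_borel_measurable_def)
  have "L2norm_sq \<Omega> (\<lambda>x. c x * v x) \<le> L2norm_sq \<Omega> (\<lambda>x. M *\<^sub>R v x)"
    unfolding wnorm_sq_def
  proof (intro nn_integral_mono_AE)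
    show "AE x in lborel. ennreal (1 * (norm (c x * v x))\<^sup>2) * indicator \<Omega> x \<le> ennreal (1 * (norm (M *\<^sub>R v x))\<^sup>2) * indicator \<Omega> x"
      using M
    proof eventually_elim
      case (elim x)
      show ?case
      proof (cases "x \<in> \<Omega>")
        case True
        then have "norm (c x * v x) \<le> norm (M *\<^sub>R v x)" using elim by (auto simp: abs_mult intro!: mult_right_mono)
        then have "(norm (c x * v x))\<^sup>2 \<le> (norm (M *\<^sub>R v x))\<^sup>2" by (intro power_mono) auto
        then show ?thesis by (intro mult_right_mono ennreal_leI) auto
      qed simp
    qed
  qed
  also have "\<dots> < \<infinity>" using in_L2_scaleR[OF v] by (simp add: in_wL2_def)
  finally show ?thesis using m by (simp add: in_wL2_def)
qed

lemma A_symmetric: "x \<in> \<Omega> \<Longrightarrow> (A x *v p) \<bullet> q = p \<bullet> (A x *v q)"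
proof -
  assume "x \<in> \<Omega>"
  then have "transpose (A x) = A x" using coeffs(1) by (auto simp: coeff_A_def)
  then have "A x *v p = p v* A x" by (metis transpose_matrix_vector)
  then show ?thesis by (simp add: dot_lmul_matrix)
qed

text \<open>
  By symmetry of the matrix the bilinear form is a sum of two \<open>L2\<close> pairings with fixed second
  arguments, so it is linear and continuous in the pair \<open>(w, G)\<close>.
\<close>

lemma form_eq:
  assumes "in_L2 \<Omega> w" "in_L2 \<Omega> G" "in_L2 \<Omega> v" "in_L2 \<Omega> H"
  shows "(LINT x:\<Omega>|lborel. (A x *v G x) \<bullet> H x + c x * w x * v x)
     = (LINT x:\<Omega>|lborel. G x \<bullet> (A x *v H x)) + (LINT x:\<Omega>|lborel. w x \<bullet> (c x * v x))"
proof -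
  have "(LINT x:\<Omega>|lborel. (A x *v G x) \<bullet> H x + c x * w x * v x)
     = (LINT x:\<Omega>|lborel. G x \<bullet> (A x *v H x) + w x \<bullet> (c x * v x))"
    using dom_borel by (intro set_lebesgue_integral_cong) (auto simp: A_symmetric mult_ac)
  also have "\<dots> = (LINT x:\<Omega>|lborel. G x \<bullet> (A x *v H x)) + (LINT x:\<Omega>|lborel. w x \<bullet> (c x * v x))"
    by (intro set_integral_add L2_cauchy_schwarz A_mult_L2 c_mult_L2 assms)
  finally show ?thesis .
qed

definition weak_form :: "(real ^ 'n \<Rightarrow> real) \<Rightarrow> (real ^ 'n \<Rightarrow> real ^ 'n) \<Rightarrow> (real ^ 'n \<Rightarrow> real) \<Rightarrow> bool" where
  "weak_form w G z \<longleftrightarrow> (\<forall>v Gv. H01 \<Omega> v Gv \<longrightarrow>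
     (LINT x:\<Omega>|lborel. (A x *v G x) \<bullet> Gv x + c x * w x * v x) = L2_inner \<Omega> z v)"

lemma weak_form_sum:
  assumes k: "\<And>k. in_L2 \<Omega> (w k)" "\<And>k. in_L2 \<Omega> (G k)" "\<And>k. in_L2 \<Omega> (z k)" "\<And>k. weak_form (w k) (G k) (z k)"
  shows "weak_form (\<lambda>x. \<Sum>k\<in>I. b k *\<^sub>R w k x) (\<lambda>x. \<Sum>k\<in>I. b k *\<^sub>R G k x) (\<lambda>x. \<Sum>k\<in>I. b k *\<^sub>R z k x)"
  unfolding weak_form_def
proof (intro allI impI)
  fix v H assume v: "H01 \<Omega> v H"
  then have L: "in_L2 \<Omega> v" "in_L2 \<Omega> H" by (auto simp: H01_def)
  have "(LINT x:\<Omega>|lborel. (A x *v (\<Sum>k\<in>I. b k *\<^sub>R G k x)) \<bullet> H x + c x * (\<Sum>k\<in>I. b k *\<^sub>R w k x) * v x)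
     = (\<Sum>k\<in>I. b k * (LINT x:\<Omega>|lborel. G k x \<bullet> (A x *v H x))) + (\<Sum>k\<in>I. b k * (LINT x:\<Omega>|lborel. w k x \<bullet> (c x * v x)))"
    by (subst form_eq) (auto intro!: in_L2_sum in_L2_scaleR k L arg_cong2[where f = "(+)"]
        L2_inner_sum_left A_mult_L2 c_mult_L2 simp del: real_scaleR_def inner_real_def)
  also have "\<dots> = (\<Sum>k\<in>I. b k * L2_inner \<Omega> (z k) v)"
  proof -
    have "(LINT x:\<Omega>|lborel. G k x \<bullet> (A x *v H x)) + (LINT x:\<Omega>|lborel. w k x \<bullet> (c x * v x)) = L2_inner \<Omega> (z k) v" for k
      using k(4)[of k, unfolded weak_form_def, rule_format, OF v] by (simp only: form_eq[OF k(1,2) L])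
    then show ?thesis by (simp only: sum.distrib[symmetric] distrib_left[symmetric])
  qed
  also have "\<dots> = L2_inner \<Omega> (\<lambda>x. \<Sum>k\<in>I. b k *\<^sub>R z k x) v"
    using L2_inner_sum_left[of I \<Omega> z v b] k(3) L(1) by (simp add: L2_inner_def)
  finally show "(LINT x:\<Omega>|lborel. (A x *v (\<Sum>k\<in>I. b k *\<^sub>R G k x)) \<bullet> H x + c x * (\<Sum>k\<in>I. b k *\<^sub>R w k x) * v x)
     = L2_inner \<Omega> (\<lambda>x. \<Sum>k\<in>I. b k *\<^sub>R z k x) v" .
qed

lemma weak_form_limit:
  assumes N: "\<And>N. in_L2 \<Omega> (wN N)" "\<And>N. in_L2 \<Omega> (GN N)" "\<And>N. in_L2 \<Omega> (zN N)" "\<And>N. weak_form (wN N) (GN N) (zN N)"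
    and L: "in_L2 \<Omega> w" "in_L2 \<Omega> G" "in_L2 \<Omega> z"
    and lim: "(\<lambda>N. L2norm_sq \<Omega> (\<lambda>x. wN N x - w x)) \<longlonglongrightarrow> 0" "(\<lambda>N. L2norm_sq \<Omega> (\<lambda>x. GN N x - G x)) \<longlonglongrightarrow> 0"
      "(\<lambda>N. L2norm_sq \<Omega> (\<lambda>x. zN N x - z x)) \<longlonglongrightarrow> 0"
  shows "weak_form w G z"
  unfolding weak_form_def
proof (intro allI impI)
  fix v H assume v: "H01 \<Omega> v H"
  then have Lv: "in_L2 \<Omega> v" "in_L2 \<Omega> H" by (auto simp: H01_def)
  have "(\<lambda>N. (LINT x:\<Omega>|lborel. GN N x \<bullet> (A x *v H x)) + (LINT x:\<Omega>|lborel. wN N x \<bullet> (c x * v x)))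
     \<longlonglongrightarrow> (LINT x:\<Omega>|lborel. G x \<bullet> (A x *v H x)) + (LINT x:\<Omega>|lborel. w x \<bullet> (c x * v x))"
    by (intro tendsto_add L2_inner_tendsto N L lim A_mult_L2 c_mult_L2 Lv)
  moreover have "(LINT x:\<Omega>|lborel. GN N x \<bullet> (A x *v H x)) + (LINT x:\<Omega>|lborel. wN N x \<bullet> (c x * v x))
     = (LINT x:\<Omega>|lborel. zN N x \<bullet> v x)" for N
    using N(4)[of N] v form_eq[OF N(1,2) Lv, of N N] by (simp add: weak_form_def L2_inner_def)
  moreover have "(\<lambda>N. LINT x:\<Omega>|lborel. zN N x \<bullet> v x) \<longlonglongrightarrow> (LINT x:\<Omega>|lborel. z x \<bullet> v x)"
    by (intro L2_inner_tendsto N L lim Lv)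
  ultimately have "(LINT x:\<Omega>|lborel. G x \<bullet> (A x *v H x)) + (LINT x:\<Omega>|lborel. w x \<bullet> (c x * v x)) = (LINT x:\<Omega>|lborel. z x \<bullet> v x)"
    using LIMSEQ_unique by (simp only:)
  then show "(LINT x:\<Omega>|lborel. (A x *v G x) \<bullet> H x + c x * w x * v x) = L2_inner \<Omega> z v"
    by (simp add: form_eq[OF L(1,2) Lv] L2_inner_def)
qed

lemma lam_pos: "0 < lam k" and lam_ge: "lam 0 \<le> lam k"
  using eigen by (auto simp: eigensystem_def)

lemma eigen_complete: "in_L2 \<Omega> w \<Longrightarrow>
    (\<lambda>N. L2norm_sq \<Omega> (\<lambda>x. w x - (\<Sum>k<N. L2_inner \<Omega> w (\<phi> k) * \<phi> k x))) \<longlonglongrightarrow> 0"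
  using eigen by (auto simp: eigensystem_def)

text \<open>
  A gradient is part of the data of an eigenfunction only up to null sets; one is chosen for each \<open>k\<close>.
\<close>

definition eigen_grad :: "nat \<Rightarrow> real ^ 'n \<Rightarrow> real ^ 'n" where
  "eigen_grad k = (SOME G. H01 \<Omega> (\<phi> k) G \<and> weak_form (\<phi> k) G (\<lambda>x. lam k * \<phi> k x))"

lemma eigen_H01: "H01 \<Omega> (\<phi> k) (eigen_grad k)"
  and eigen_weak_form: "weak_form (\<phi> k) (eigen_grad k) (\<lambda>x. lam k * \<phi> k x)"
proof -
  have "\<exists>G. H01 \<Omega> (\<phi> k) G \<and> weak_form (\<phi> k) G (\<lambda>x. lam k * \<phi> k x)"
    using eigen by (auto simp: eigensystem_def dirichlet_op_def weak_form_def)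
  then have "H01 \<Omega> (\<phi> k) (eigen_grad k) \<and> weak_form (\<phi> k) (eigen_grad k) (\<lambda>x. lam k * \<phi> k x)"
    unfolding eigen_grad_def by (rule someI_ex)
  then show "H01 \<Omega> (\<phi> k) (eigen_grad k)" "weak_form (\<phi> k) (eigen_grad k) (\<lambda>x. lam k * \<phi> k x)" by auto
qed

lemma eigen_L2: "in_L2 \<Omega> (\<phi> k)" "in_L2 \<Omega> (eigen_grad k)" "in_L2 \<Omega> (\<lambda>x. lam k * \<phi> k x)"
proof -
  show "in_L2 \<Omega> (\<phi> k)" "in_L2 \<Omega> (eigen_grad k)" using eigen_H01[of k] by (auto simp: H01_def)
  then show "in_L2 \<Omega> (\<lambda>x. lam k * \<phi> k x)" using in_L2_scaleR[of \<Omega> "\<phi> k" "lam k"] by simp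
qed

lemma eigen_orthonormal: "(LINT x:\<Omega>|lborel. \<phi> j x \<bullet> \<phi> k x) = (if j = k then 1 else 0)"
  using eigen by (auto simp: eigensystem_def L2_inner_def)

lemma eigen_inner_sums:
  assumes "finite I"
  shows "(LINT x:\<Omega>|lborel. (\<Sum>j\<in>I. a j *\<^sub>R \<phi> j x) \<bullet> (\<Sum>k\<in>I. b k *\<^sub>R \<phi> k x)) = (\<Sum>k\<in>I. a k * b k)"
proof -
  have B: "in_L2 \<Omega> (\<lambda>x. \<Sum>k\<in>I. b k *\<^sub>R \<phi> k x)" by (intro in_L2_sum in_L2_scaleR eigen_L2)
  have "(LINT x:\<Omega>|lborel. (\<Sum>j\<in>I. a j *\<^sub>R \<phi> j x) \<bullet> (\<Sum>k\<in>I. b k *\<^sub>R \<phi> k x))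
     = (\<Sum>j\<in>I. a j * (LINT x:\<Omega>|lborel. \<phi> j x \<bullet> (\<Sum>k\<in>I. b k *\<^sub>R \<phi> k x)))"
    by (rule L2_inner_sum_left[OF eigen_L2(1) B])
  also have "\<dots> = (\<Sum>j\<in>I. a j * b j)"
  proof (intro sum.cong refl)
    fix j assume j: "j \<in> I"
    have "(LINT x:\<Omega>|lborel. \<phi> j x \<bullet> (\<Sum>k\<in>I. b k *\<^sub>R \<phi> k x)) = (LINT x:\<Omega>|lborel. (\<Sum>k\<in>I. b k *\<^sub>R \<phi> k x) \<bullet> \<phi> j x)"
      by (simp only: inner_commute)
    also have "\<dots> = (\<Sum>k\<in>I. b k * (LINT x:\<Omega>|lborel. \<phi> k x \<bullet> \<phi> j x))"
      by (rule L2_inner_sum_left[OF eigen_L2(1) eigen_L2(1)])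
    also have "\<dots> = b j" using j assms by (simp only: eigen_orthonormal) (simp add: if_distrib cong: if_cong)
    finally show "a j * (LINT x:\<Omega>|lborel. \<phi> j x \<bullet> (\<Sum>k\<in>I. b k *\<^sub>R \<phi> k x)) = a j * b j" by (simp only:)
  qed
  finally show ?thesis .
qed

lemma eigen_parseval:
  assumes "finite I"
  shows "L2norm_sq \<Omega> (\<lambda>x. \<Sum>k\<in>I. b k *\<^sub>R \<phi> k x) = ennreal (\<Sum>k\<in>I. (b k)\<^sup>2)"
proof -
  have "in_L2 \<Omega> (\<lambda>x. \<Sum>k\<in>I. b k *\<^sub>R \<phi> k x)" by (intro in_L2_sum in_L2_scaleR eigen_L2)
  from L2norm_sq_inner[OF this] show ?thesis
    by (simp only: eigen_inner_sums[OF assms] power2_eq_square)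
qed

lemma bessel_eigenfunctions: "bessel_system \<Omega> \<phi> (\<lambda>_. 1)"
  unfolding bessel_system_def using eigen_parseval eigen_L2 by simp

lemma bessel_operator: "bessel_system \<Omega> (\<lambda>k x. lam k * \<phi> k x) (\<lambda>k. (lam k)\<^sup>2)"
proof -
  have "L2norm_sq \<Omega> (\<lambda>x. \<Sum>k\<in>I. b k *\<^sub>R (lam k * \<phi> k x)) = ennreal (\<Sum>k\<in>I. (lam k)\<^sup>2 * (b k)\<^sup>2)" if "finite I" for I b
    using eigen_parseval[OF that, of "\<lambda>k. lam k * b k"] by (simp add: mult_ac power_mult_distrib)
  then show ?thesis unfolding bessel_system_def using eigen_L2(3) by simp
qed

text \<open>
  By ellipticity and \<open>c \<ge> 0\<close> the \<open>L2\<close> norm of the gradient is bounded by the energy, and the weak form of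
  the eigenvalue equation, tested with the combination itself, diagonalises the energy.
\<close>

lemma bessel_gradients:
  obtains a where "0 < a" "bessel_system \<Omega> eigen_grad (\<lambda>k. lam k / a)"
proof -
  obtain a where a: "a > 0" "\<And>x \<xi>. x \<in> \<Omega> \<Longrightarrow> a * (norm \<xi>)\<^sup>2 \<le> \<xi> \<bullet> (A x *v \<xi>)"
    using coeffs(1) by (auto simp: coeff_A_def)
  obtain M where M: "AE x in lborel. x \<in> \<Omega> \<longrightarrow> 0 \<le> c x \<and> c x \<le> M" using coeffs(2) by (auto simp: coeff_c_def)
  have "L2norm_sq \<Omega> (\<lambda>x. \<Sum>k\<in>I. b k *\<^sub>R eigen_grad k x) \<le> ennreal (\<Sum>k\<in>I. lam k / a * (b k)\<^sup>2)" if I: "finite I" for I b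
  proof -
    define w where "w x = (\<Sum>k\<in>I. b k *\<^sub>R \<phi> k x)" for x
    define G where "G x = (\<Sum>k\<in>I. b k *\<^sub>R eigen_grad k x)" for x
    have w: "in_L2 \<Omega> w" and G: "in_L2 \<Omega> G"
      unfolding w_def G_def by (intro in_L2_sum in_L2_scaleR eigen_L2)+
    have H: "H01 \<Omega> w G" unfolding w_def G_def real_scaleR_def
      by (rule H01_sum[OF dom_borel eigen_H01 I])
    have int: "set_integrable lborel \<Omega> (\<lambda>x. G x \<bullet> (A x *v G x) + w x \<bullet> (c x * w x))"
      by (intro set_integral_add L2_cauchy_schwarz A_mult_L2 c_mult_L2 w G)
    have "a * (LINT x:\<Omega>|lborel. G x \<bullet> G x) = (LINT x:\<Omega>|lborel. a * (G x \<bullet> G x))" by simp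
    also have "\<dots> \<le> (LINT x:\<Omega>|lborel. G x \<bullet> (A x *v G x) + w x \<bullet> (c x * w x))"
    proof (rule set_integral_mono_AE[OF _ int])
      show "set_integrable lborel \<Omega> (\<lambda>x. a * (G x \<bullet> G x))" using L2_cauchy_schwarz(1)[OF G G] by simp
      show "AE x \<in> \<Omega> in lborel. a * (G x \<bullet> G x) \<le> G x \<bullet> (A x *v G x) + w x \<bullet> (c x * w x)"
        using M
      proof eventually_elim
        case (elim x)
        show ?case
        proof
          assume x: "x \<in> \<Omega>"
          have "0 \<le> c x * (w x * w x)" using elim x by (intro mult_nonneg_nonneg[OF _ zero_le_square]) auto
          then show "a * (G x \<bullet> G x) \<le> G x \<bullet> (A x *v G x) + w x \<bullet> (c x * w x)"
            using a(2)[OF x, of "G x"] by (simp add: power2_norm_eq_inner mult_ac)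
        qed
      qed
    qed
    also have "\<dots> = (LINT x:\<Omega>|lborel. (A x *v G x) \<bullet> G x + c x * w x * w x)"
      unfolding form_eq[OF w G w G] by (intro set_integral_add L2_cauchy_schwarz A_mult_L2 c_mult_L2 w G)
    also have "\<dots> = L2_inner \<Omega> (\<lambda>x. \<Sum>k\<in>I. b k *\<^sub>R (lam k * \<phi> k x)) w"
      using weak_form_sum[where w = \<phi> and G = eigen_grad and z = "\<lambda>k x. lam k * \<phi> k x" and b = b and I = I,
          OF eigen_L2(1,2,3) eigen_weak_form, unfolded weak_form_def, rule_format, OF H]
      by (simp only: w_def[symmetric] G_def[symmetric])
    also have "\<dots> = (LINT x:\<Omega>|lborel. (\<Sum>k\<in>I. (lam k * b k) *\<^sub>R \<phi> k x) \<bullet> (\<Sum>k\<in>I. b k *\<^sub>R \<phi> k x))"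
      by (simp add: L2_inner_def w_def mult_ac)
    also have "\<dots> = (\<Sum>k\<in>I. lam k * (b k)\<^sup>2)"
      unfolding eigen_inner_sums[OF I] by (simp add: power2_eq_square mult_ac)
    finally have "(LINT x:\<Omega>|lborel. G x \<bullet> G x) \<le> (\<Sum>k\<in>I. lam k / a * (b k)\<^sup>2)"
      using a(1) by (simp add: sum_divide_distrib[symmetric] field_simps)
    then have "L2norm_sq \<Omega> G \<le> ennreal (\<Sum>k\<in>I. lam k / a * (b k)\<^sup>2)"
      unfolding L2norm_sq_inner[OF G] by (rule ennreal_leI)
    then show ?thesis by (simp only: G_def[abs_def])
  qed
  then have "bessel_system \<Omega> eigen_grad (\<lambda>k. lam k / a)"
    unfolding bessel_system_def using a(1) lam_pos by (auto simp: eigen_L2 less_imp_le)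
  then show ?thesis using that a(1) by blast
qed

lemma fourier_coefficients_summable:
  assumes w: "in_L2 \<Omega> w" shows "summable (\<lambda>k. (L2_inner \<Omega> w (\<phi> k))\<^sup>2)"
proof -
  let ?b = "\<lambda>k. L2_inner \<Omega> w (\<phi> k)"
  obtain N0 where N0: "\<And>N. N \<ge> N0 \<Longrightarrow> L2norm_sq \<Omega> (\<lambda>x. w x - (\<Sum>k<N. ?b k * \<phi> k x)) < 1"
    using order_tendstoD(2)[OF eigen_complete[OF w], of 1] by (auto simp: eventually_sequentially)
  define R where "R = enn2real (2 * L2norm_sq \<Omega> w + 2)"
  have fin: "2 * L2norm_sq \<Omega> w + 2 < \<infinity>" using w by (simp add: in_wL2_def ennreal_mult_less_top)
  have le: "(\<Sum>k<N. (?b k)\<^sup>2) \<le> R" if N: "N \<ge> N0" for N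
  proof -
    let ?S = "\<lambda>x. \<Sum>k<N. ?b k *\<^sub>R \<phi> k x"
    have S: "in_L2 \<Omega> ?S" by (intro in_L2_sum in_L2_scaleR eigen_L2)
    have "ennreal (\<Sum>k<N. (?b k)\<^sup>2) = L2norm_sq \<Omega> ?S" by (rule eigen_parseval[symmetric]) simp
    also have "\<dots> = L2norm_sq \<Omega> (\<lambda>x. w x + (?S x - w x))" by simp
    also have "\<dots> \<le> 2 * L2norm_sq \<Omega> w + 2 * L2norm_sq \<Omega> (\<lambda>x. ?S x - w x)"
      using w in_L2_diff[OF S w] by (intro L2norm_sq_add_le) (auto simp: in_wL2_def)
    also have "L2norm_sq \<Omega> (\<lambda>x. ?S x - w x) = L2norm_sq \<Omega> (\<lambda>x. w x - (\<Sum>k<N. ?b k * \<phi> k x))"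
      by (subst L2norm_sq_minus) simp
    also have "2 * L2norm_sq \<Omega> w + 2 * \<dots> \<le> 2 * L2norm_sq \<Omega> w + 2 * 1"
      using N0[OF N] by (intro add_left_mono mult_left_mono) auto
    also have "\<dots> = ennreal R" using fin by (simp add: R_def)
    finally show ?thesis by (simp add: R_def)
  qed
  show ?thesis
  proof (rule bounded_imp_summable[of _ R])
    fix n
    have "(\<Sum>k\<le>n. (?b k)\<^sup>2) \<le> (\<Sum>k<max N0 (Suc n). (?b k)\<^sup>2)"
      by (intro sum_mono2) auto
    also have "\<dots> \<le> R" by (rule le) simp
    finally show "(\<Sum>k\<le>n. (?b k)\<^sup>2) \<le> R" .
  qed simp
qed

end

section \<open>Series of eigenfunctions in the cylinder\<close>

text \<open>
  Tonelli's theorem on the cylinder, followed by exchanging the series with the integral in \<open>y\<close>.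
\<close>

lemma wnorm_sq_series_bound:
  fixes E :: "(real ^ 'n) \<times> real \<Rightarrow> 'b::euclidean_space"
  assumes E: "set_borel_measurable lborel (S \<times> {0<..}) E"
    and w: "\<And>k. continuous_on {0<..} (w k)" and \<Lambda>: "\<And>k. 0 \<le> \<Lambda> k"
    and slice: "\<And>y. 0 < y \<Longrightarrow> L2norm_sq S (\<lambda>x. E (x, y)) \<le> (\<Sum>k. ennreal (\<Lambda> k * (u k * w k y)\<^sup>2))"
    and J: "\<And>k. (\<integral>\<^sup>+y\<in>{0<..}. ennreal (y powr \<beta> * exp (\<theta> * y) * (w k y)\<^sup>2) \<partial>lborel) \<le> ennreal (J k)"
    and J0: "\<And>k. 0 \<le> J k" and sm: "summable (\<lambda>k. \<Lambda> k * (u k)\<^sup>2 * J k)"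
  shows "wnorm_sq (weight \<beta> \<theta>) (S \<times> {0<..}) E \<le> ennreal (\<Sum>k. \<Lambda> k * (u k)\<^sup>2 * J k)"
proof -
  define \<omega> where "\<omega> y = y powr \<beta> * exp (\<theta> * y)" for y
  have \<omega>m[measurable]: "\<omega> \<in> borel_measurable borel" unfolding \<omega>_def by measurable
  have \<omega>0: "0 \<le> \<omega> y" for y by (simp add: \<omega>_def)
  have wm[measurable]: "(\<lambda>y. indicator {0<..} y * w k y) \<in> borel_measurable borel" for k
    using borel_measurable_continuous_on_indicator[OF _ w[of k]] by simp
  have "weight \<beta> \<theta> = (\<lambda>z :: (real ^ 'n) \<times> real. \<omega> (snd z))" by (simp add: weight_def \<omega>_def fun_eq_iff)
  then have "wnorm_sq (weight \<beta> \<theta>) (S \<times> {0<..}) E = (\<integral>\<^sup>+y\<in>{0<..}. ennreal (\<omega> y) * L2norm_sq S (\<lambda>x. E (x, y)) \<partial>lborel)"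
    using wnorm_sq_slices[OF E \<omega>m \<omega>0] by simp
  also have "\<dots> \<le> (\<integral>\<^sup>+y. (\<Sum>k. ennreal (\<Lambda> k * (u k)\<^sup>2) * ennreal (\<omega> y * (indicator {0<..} y * w k y)\<^sup>2)) \<partial>lborel)"
  proof (intro nn_integral_mono)
    fix y :: real
    show "ennreal (\<omega> y) * L2norm_sq S (\<lambda>x. E (x, y)) * indicator {0<..} y
       \<le> (\<Sum>k. ennreal (\<Lambda> k * (u k)\<^sup>2) * ennreal (\<omega> y * (indicator {0<..} y * w k y)\<^sup>2))"
    proof (cases "0 < y")
      case True
      have "ennreal (\<omega> y) * L2norm_sq S (\<lambda>x. E (x, y)) \<le> ennreal (\<omega> y) * (\<Sum>k. ennreal (\<Lambda> k * (u k * w k y)\<^sup>2))"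
        by (intro mult_left_mono slice True) auto
      also have "\<dots> = (\<Sum>k. ennreal (\<omega> y) * ennreal (\<Lambda> k * (u k * w k y)\<^sup>2))" by simp
      also have "\<dots> = (\<Sum>k. ennreal (\<Lambda> k * (u k)\<^sup>2) * ennreal (\<omega> y * (w k y)\<^sup>2))"
        using \<Lambda> \<omega>0 by (simp add: power_mult_distrib mult_ac flip: ennreal_mult)
      finally show ?thesis using True by simp
    qed simp
  qed
  also have "\<dots> = (\<Sum>k. \<integral>\<^sup>+y. ennreal (\<Lambda> k * (u k)\<^sup>2) * ennreal (\<omega> y * (indicator {0<..} y * w k y)\<^sup>2) \<partial>lborel)"
    by (intro nn_integral_suminf) measurable
  also have "\<dots> \<le> (\<Sum>k. ennreal (\<Lambda> k * (u k)\<^sup>2 * J k))"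
  proof (intro suminf_le)
    fix k
    have "(\<integral>\<^sup>+y. ennreal (\<Lambda> k * (u k)\<^sup>2) * ennreal (\<omega> y * (indicator {0<..} y * w k y)\<^sup>2) \<partial>lborel)
       = ennreal (\<Lambda> k * (u k)\<^sup>2) * (\<integral>\<^sup>+y. ennreal (\<omega> y * (indicator {0<..} y * w k y)\<^sup>2) \<partial>lborel)"
      by (intro nn_integral_cmult) measurable
    also have "(\<integral>\<^sup>+y. ennreal (\<omega> y * (indicator {0<..} y * w k y)\<^sup>2) \<partial>lborel)
       = (\<integral>\<^sup>+y\<in>{0<..}. ennreal (y powr \<beta> * exp (\<theta> * y) * (w k y)\<^sup>2) \<partial>lborel)"
      by (intro nn_integral_cong) (auto simp: indicator_def \<omega>_def)
    also have "ennreal (\<Lambda> k * (u k)\<^sup>2) * \<dots> \<le> ennreal (\<Lambda> k * (u k)\<^sup>2) * ennreal (J k)"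
      by (intro mult_left_mono J) auto
    also have "\<dots> = ennreal (\<Lambda> k * (u k)\<^sup>2 * J k)" using \<Lambda> J0 by (simp flip: ennreal_mult)
    finally show "(\<integral>\<^sup>+y. ennreal (\<Lambda> k * (u k)\<^sup>2) * ennreal (\<omega> y * (indicator {0<..} y * w k y)\<^sup>2) \<partial>lborel)
       \<le> ennreal (\<Lambda> k * (u k)\<^sup>2 * J k)" .
  qed auto
  also have "\<dots> = ennreal (\<Sum>k. \<Lambda> k * (u k)\<^sup>2 * J k)"
    using \<Lambda> J0 by (intro suminf_ennreal2 sm) auto
  finally show ?thesis .
qed

context dirichlet_eigen
begin

lemma eigen_tensor_weak_deriv:
  assumes p: "profile s (lam k) (\<psi> k)"
  shows "weak_deriv (cylinder \<Omega>) (replicate (Suc l) dir_y) (\<lambda>z. \<phi> k (fst z) * \<psi> k (snd z))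
     (\<lambda>z. \<phi> k (fst z) * profile_deriv_seq s (lam k) (\<psi> k) (Suc l) (snd z))"
proof (induction l)
  have D: "(profile_deriv_seq s (lam k) (\<psi> k) m has_real_derivative profile_deriv_seq s (lam k) (\<psi> k) (Suc m) y) (at y)"
    if "0 < y" for m y by (rule profile_deriv_seq_deriv[OF p that])
  have c: "continuous_on {0<..} (profile_deriv_seq s (lam k) (\<psi> k) m)" for m
    by (intro continuous_at_imp_continuous_on ballI DERIV_isCont[OF D]) auto
  note step = tensor_weak_deriv(1)[OF open_dom eigen_H01 D c]
  {
    case 0
    show ?case using step[of k 0] by simp
  next
    case (Suc l)
    have "replicate (Suc (Suc l)) dir_y = replicate (Suc l) (dir_y :: (real ^ 'n) \<times> real) @ [dir_y]"
      by (simp add: replicate_append_same)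
    then show ?case using weak_deriv_comp[OF Suc step[of k "Suc l"]] by (simp only:)
  }
qed

text \<open>
  The limit \<open>v\<close> is approached by the partial sums themselves, so its distance to one of them is
  bounded, up to the factor 2 of \<open>|a + b|\<^sup>2 \<le> 2 |a|\<^sup>2 + 2 |b|\<^sup>2\<close>, by the supremum of their mutual distances.
\<close>

lemma series_tail_bound:
  assumes u: "summable (\<lambda>k. (u k)\<^sup>2)" and \<psi>: "\<And>k. \<bar>p k\<bar> \<le> 1"
    and m: "set_borel_measurable lborel \<Omega> v"
    and lim: "(\<lambda>N. L2norm_sq \<Omega> (\<lambda>x. v x - (\<Sum>k<N. u k * \<phi> k x * p k))) \<longlonglongrightarrow> 0"
  shows "L2norm_sq \<Omega> (\<lambda>x. (\<Sum>k<N. (u k * p k) *\<^sub>R \<phi> k x) - v x) \<le> ennreal (2 * (\<Sum>k. (u (k + N))\<^sup>2))"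
proof -
  define P where "P N x = (\<Sum>k<N. (u k * p k) *\<^sub>R \<phi> k x)" for N x
  define t where "t = (\<Sum>k. (u (k + N))\<^sup>2)"
  have su: "summable (\<lambda>k. (u (k + N))\<^sup>2)" using u by (subst summable_iff_shift)
  have P: "in_L2 \<Omega> (P N)" for N unfolding P_def by (intro in_L2_sum in_L2_scaleR eigen_L2)
  have lim': "(\<lambda>M. L2norm_sq \<Omega> (\<lambda>x. P M x - v x)) \<longlonglongrightarrow> 0"
  proof -
    have "L2norm_sq \<Omega> (\<lambda>x. P M x - v x) = L2norm_sq \<Omega> (\<lambda>x. v x - (\<Sum>k<M. u k * \<phi> k x * p k))" for M
      by (subst L2norm_sq_minus) (simp add: P_def mult_ac)
    then show ?thesis using lim by simp
  qed
  have diff: "L2norm_sq \<Omega> (\<lambda>x. P N x - P M x) \<le> ennreal t" if "N \<le> M" for M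
  proof -
    have "L2norm_sq \<Omega> (\<lambda>x. P N x - P M x) = L2norm_sq \<Omega> (\<lambda>x. \<Sum>k\<in>{N..<M}. (u k * p k) *\<^sub>R \<phi> k x)"
      by (subst L2norm_sq_minus, rule L2norm_sq_cong)
        (use that in \<open>simp add: P_def lessThan_atLeast0 sum_diff_nat_ivl\<close>)
    also have "\<dots> = ennreal (\<Sum>k\<in>{N..<M}. (u k * p k)\<^sup>2)" by (intro eigen_parseval) auto
    also have "\<dots> \<le> ennreal t"
    proof (intro ennreal_leI)
      have "(\<Sum>k\<in>{N..<M}. (u k * p k)\<^sup>2) \<le> (\<Sum>k\<in>{N..<M}. (u k)\<^sup>2)"
      proof (intro sum_mono)
        fix k
        have "(p k)\<^sup>2 \<le> 1" using \<psi>[of k] by (simp add: abs_square_le_1)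
        then show "(u k * p k)\<^sup>2 \<le> (u k)\<^sup>2" by (simp add: power_mult_distrib mult_left_le)
      qed
      also have "\<dots> \<le> t" unfolding t_def by (rule square_tail_sum_le[OF u])
      finally show "(\<Sum>k\<in>{N..<M}. (u k * p k)\<^sup>2) \<le> t" .
    qed
    finally show ?thesis .
  qed
  have "L2norm_sq \<Omega> (\<lambda>x. P N x - v x) \<le> 2 * ennreal t + 2 * 0"
  proof (rule tendsto_lowerbound)
    show "(\<lambda>M. 2 * ennreal t + 2 * L2norm_sq \<Omega> (\<lambda>x. P M x - v x)) \<longlonglongrightarrow> 2 * ennreal t + 2 * 0"
      by (intro tendsto_add tendsto_const tendsto_mult_ennreal lim') auto
    show "\<forall>\<^sub>F M in sequentially. L2norm_sq \<Omega> (\<lambda>x. P N x - v x) \<le> 2 * ennreal t + 2 * L2norm_sq \<Omega> (\<lambda>x. P M x - v x)"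
      using eventually_ge_at_top[of N]
    proof eventually_elim
      case (elim M)
      have "L2norm_sq \<Omega> (\<lambda>x. (P N x - P M x) + (P M x - v x)) \<le> 2 * L2norm_sq \<Omega> (\<lambda>x. P N x - P M x) + 2 * L2norm_sq \<Omega> (\<lambda>x. P M x - v x)"
        using P m by (intro L2norm_sq_add_le set_borel_measurable_add) (auto simp: in_wL2_def)
      also have "\<dots> \<le> 2 * ennreal t + 2 * L2norm_sq \<Omega> (\<lambda>x. P M x - v x)"
        by (intro add_right_mono mult_left_mono diff elim) auto
      finally show ?case by simp
    qed
  qed simp
  also have "\<dots> = ennreal (2 * t)"
    unfolding t_def by (subst ennreal_mult) (auto intro!: suminf_nonneg su)
  finally show ?thesis by (simp add: P_def t_def)
qed

end

text \<open>
  Local \<open>L2\<close> convergence of both series, obtained from their slices, makes term-by-term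
  differentiation legitimate.
\<close>

lemma weak_deriv_series:
  fixes e e' :: "nat \<Rightarrow> 'a::euclidean_space \<Rightarrow> real" and w w' :: "nat \<Rightarrow> real \<Rightarrow> real" and u :: "nat \<Rightarrow> real"
  assumes S: "S \<in> sets borel"
    and e: "\<And>k. in_L2 S (e k)" "\<And>k. in_L2 S (e' k)"
    and w: "\<And>k. continuous_on {0<..} (w k)" "\<And>k. continuous_on {0<..} (w' k)"
    and wd: "\<And>k. weak_deriv (S \<times> {0<..}) bs (\<lambda>z. e k (fst z) * w k (snd z)) (\<lambda>z. e' k (fst z) * w' k (snd z))"
    and E: "set_borel_measurable lborel (S \<times> {0<..}) E" "set_borel_measurable lborel (S \<times> {0<..}) E'"
    and le: "\<And>N. AE y in lborel. 0 < y \<longrightarrow> L2norm_sq S (\<lambda>x. (\<Sum>k<N. (u k * w k y) *\<^sub>R e k x) - E (x, y)) \<le> ennreal (m y * t N)"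
      "\<And>N. AE y in lborel. 0 < y \<longrightarrow> L2norm_sq S (\<lambda>x. (\<Sum>k<N. (u k * w' k y) *\<^sub>R e' k x) - E' (x, y)) \<le> ennreal (m' y * t N)"
    and m: "\<And>a b. 0 < a \<Longrightarrow> \<exists>B. \<forall>y\<in>{a..b}. m y \<le> B" "\<And>a b. 0 < a \<Longrightarrow> \<exists>B. \<forall>y\<in>{a..b}. m' y \<le> B"
    and t: "\<And>N. 0 \<le> t N" "t \<longlonglongrightarrow> 0"
  shows "weak_deriv (S \<times> {0<..}) bs E E'"
proof -
  define P where "P f v N z = (\<Sum>k<N. u k * (f k (fst z) * v k (snd z)))"
    for f :: "nat \<Rightarrow> 'a \<Rightarrow> real" and v :: "nat \<Rightarrow> real \<Rightarrow> real" and N :: nat and z :: "'a \<times> real"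
  have P_L2: "in_L2 K (P f v N)"
    if "\<And>k. in_L2 S (f k)" "\<And>k. continuous_on {0<..} (v k)" "compact K" "K \<subseteq> S \<times> {0<..}" for f v N K
    unfolding P_def[abs_def] real_scaleR_def[symmetric, of "u _"]
    by (intro in_L2_sum in_L2_scaleR tensor_in_L2_local[OF S] that)
  have P_lim: "(\<lambda>N. L2norm_sq K (\<lambda>z. P f v N z - F z)) \<longlonglongrightarrow> 0"
    if f: "\<And>k. in_L2 S (f k)" and v: "\<And>k. continuous_on {0<..} (v k)" and K: "compact K" "K \<subseteq> S \<times> {0<..}"
      and F: "set_borel_measurable lborel (S \<times> {0<..}) F"
      and le: "\<And>N. AE y in lborel. 0 < y \<longrightarrow> L2norm_sq S (\<lambda>x. (\<Sum>k<N. (u k * v k y) *\<^sub>R f k x) - F (x, y)) \<le> ennreal (q y * t N)"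
      and q: "\<And>a b. 0 < a \<Longrightarrow> \<exists>B. \<forall>y\<in>{a..b}. q y \<le> B"
    for f v F q K
  proof (rule L2norm_sq_local_limit[OF S _ _ q t K])
    have "set_borel_measurable lborel (S \<times> {0<..}) (P f v N)" for N
      unfolding P_def[abs_def] real_scaleR_def[symmetric, of "u _"]
      using f by (intro set_borel_measurable_sum set_borel_measurable_scaleR tensor_measurable v) (auto simp: in_wL2_def)
    then show "set_borel_measurable lborel (S \<times> {0<..}) (\<lambda>z. P f v N z - F z)" for N
      using F by (intro set_borel_measurable_add)
    show "AE y in lborel. 0 < y \<longrightarrow> L2norm_sq S (\<lambda>x. P f v N (x, y) - F (x, y)) \<le> ennreal (q y * t N)" for N
      using le[of N] by (simp add: P_def mult_ac)
  qed
  show ?thesis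
  proof (rule weak_deriv_limit[where wN = "P e w" and vN = "P e' w'", OF _ E])
    show "weak_deriv (S \<times> {0<..}) bs (P e w N) (P e' w' N)" for N
      unfolding P_def[abs_def] by (intro weak_deriv_sum weak_deriv_cmult wd)
  qed (intro P_L2 P_lim[OF e(1) w(1) _ _ E(1) le(1) m(1)] P_lim[OF e(2) w(2) _ _ E(2) le(2) m(2)] e w; assumption)+
qed

context dirichlet_eigen
begin

text \<open>
  The three functions exist for every square-integrable \<open>v\<close>: on the slice at height \<open>y\<close> the coefficients are
  damped by the profiles, uniformly for \<open>y\<close> in compact sets. In particular a single \<open>V\<close> serves all three
  estimates, and the operator can be applied to \<open>V\<close> on every slice.
\<close>

lemma derivative_series:
  fixes l :: nat and \<psi> :: "nat \<Rightarrow> real \<Rightarrow> real" and v :: "real ^ 'n \<Rightarrow> real" and U :: "(real ^ 'n) \<times> real \<Rightarrow> real"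
  assumes s: "0 < s" "s < 1" and p: "\<And>k. profile s (lam k) (\<psi> k)" and v: "in_L2 \<Omega> v"
    and U: "set_borel_measurable lborel (cylinder \<Omega>) U"
    and conv: "AE y in lborel. 0 < y \<longrightarrow>
      (\<lambda>N. L2norm_sq \<Omega> (\<lambda>x. U (x, y) - (\<Sum>k<N. L2_inner \<Omega> v (\<phi> k) * \<phi> k x * \<psi> k y))) \<longlonglongrightarrow> 0"
    and a: "0 < a" "bessel_system \<Omega> eigen_grad (\<lambda>k. lam k / a)"
  defines "u \<equiv> \<lambda>k. L2_inner \<Omega> v (\<phi> k)" and "D \<equiv> \<lambda>k. profile_deriv_seq s (lam k) (\<psi> k) (Suc l)"
  obtains V G W where
    "weak_deriv (cylinder \<Omega>) (replicate (Suc l) dir_y) U V"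
    "weak_grad_x (cylinder \<Omega>) V G" "dirichlet_op_x \<Omega> A c V W"
    "set_borel_measurable lborel (\<Omega> \<times> {0<..}) V" "set_borel_measurable lborel (\<Omega> \<times> {0<..}) G"
    "set_borel_measurable lborel (\<Omega> \<times> {0<..}) W"
    "\<And>y. 0 < y \<Longrightarrow> L2norm_sq \<Omega> (\<lambda>x. V (x, y)) \<le> (\<Sum>k. ennreal (1 * (u k * D k y)\<^sup>2))"
    "\<And>y. 0 < y \<Longrightarrow> L2norm_sq \<Omega> (\<lambda>x. G (x, y)) \<le> (\<Sum>k. ennreal (lam k / a * (u k * D k y)\<^sup>2))"
    "\<And>y. 0 < y \<Longrightarrow> L2norm_sq \<Omega> (\<lambda>x. W (x, y)) \<le> (\<Sum>k. ennreal ((lam k)\<^sup>2 * (u k * D k y)\<^sup>2))"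
proof -
  have usum: "summable (\<lambda>k. (u k)\<^sup>2)" unfolding u_def by (rule fourier_coefficients_summable[OF v])
  define t where "t N = (\<Sum>k. (u (k + N))\<^sup>2)" for N
  have t_lim: "t \<longlonglongrightarrow> 0" unfolding t_def by (rule suminf_exist_split2[OF usum])
  have su: "summable (\<lambda>k. (u (k + N))\<^sup>2)" for N using usum by (subst summable_iff_shift)
  have t0: "0 \<le> t N" for N unfolding t_def by (intro suminf_nonneg su) auto
  have Dd: "(profile_deriv_seq s (lam k) (\<psi> k) m has_real_derivative profile_deriv_seq s (lam k) (\<psi> k) (Suc m) y) (at y)"
    if "0 < y" for k m y by (rule profile_deriv_seq_deriv[OF p that])
  have Dc': "continuous_on {0<..} (profile_deriv_seq s (lam k) (\<psi> k) m)" for k m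
    by (intro continuous_at_imp_continuous_on ballI DERIV_isCont[OF Dd]) auto
  have Dc: "continuous_on {0<..} (D k)" for k unfolding D_def by (rule Dc')
  have \<psi>c: "continuous_on {0<..} (\<psi> k)" for k using Dc'[of k 0] by simp
  obtain C where C: "\<And>j. C j > 0" "\<And>j k y. 0 < y \<Longrightarrow> (lam k) ^ j * (D k y)\<^sup>2 \<le> C j / y ^ (2 * (Suc l + j))"
  proof -
    have "\<forall>j. \<exists>C>0. \<forall>k y. 0 < y \<longrightarrow> (lam k) ^ j * (D k y)\<^sup>2 \<le> C / y ^ (2 * (Suc l + j))"
      using profile_deriv_seq_uniform_bound[OF s, of _ l] lam_pos p unfolding D_def by meson
    then show ?thesis using that by metis
  qed
  have bdd: "\<exists>B. \<forall>y\<in>{a..b}. K / y ^ n \<le> B" if "0 < a" "0 < K" for a b K :: real and n :: nat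
  proof (intro exI ballI)
    fix y assume "y \<in> {a..b}"
    then show "K / y ^ n \<le> K / a ^ n" using that by (intro divide_left_mono power_mono mult_pos_pos) auto
  qed
  define mV mG mW where "mV y = C 0 / y ^ (2 * (Suc l + 0))" and "mG y = (C 1 / a) / y ^ (2 * (Suc l + 1))"
    and "mW y = C 2 / y ^ (2 * (Suc l + 2))" for y :: real
  have bV: "1 * (D k y)\<^sup>2 \<le> mV y" if "0 < y" for k y using C(2)[OF that, of k 0] by (simp add: mV_def)
  have bG: "lam k / a * (D k y)\<^sup>2 \<le> mG y" if "0 < y" for k y
    using divide_right_mono[OF C(2)[OF that, of k 1], of a] a(1) by (simp add: mG_def field_simps)
  have bW: "(lam k)\<^sup>2 * (D k y)\<^sup>2 \<le> mW y" if "0 < y" for k y using C(2)[OF that, of k 2] by (simp add: mW_def)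
  obtain V where Vm: "set_borel_measurable lborel (\<Omega> \<times> {0<..}) V"
    and Vt: "\<And>y N. 0 < y \<Longrightarrow> L2norm_sq \<Omega> (\<lambda>x. (\<Sum>k<N. (u k * D k y) *\<^sub>R \<phi> k x) - V (x, y)) \<le> ennreal (mV y * t N)"
    and Vb: "\<And>y. 0 < y \<Longrightarrow> L2norm_sq \<Omega> (\<lambda>x. V (x, y)) \<le> (\<Sum>k. ennreal (1 * (u k * D k y)\<^sup>2))"
    unfolding t_def by (rule bessel_system_series[where w = D, OF dom_borel bessel_eigenfunctions Dc usum bV]) blast+
  obtain G where Gm: "set_borel_measurable lborel (\<Omega> \<times> {0<..}) G"
    and Gt: "\<And>y N. 0 < y \<Longrightarrow> L2norm_sq \<Omega> (\<lambda>x. (\<Sum>k<N. (u k * D k y) *\<^sub>R eigen_grad k x) - G (x, y)) \<le> ennreal (mG y * t N)"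
    and Gb: "\<And>y. 0 < y \<Longrightarrow> L2norm_sq \<Omega> (\<lambda>x. G (x, y)) \<le> (\<Sum>k. ennreal (lam k / a * (u k * D k y)\<^sup>2))"
    unfolding t_def by (rule bessel_system_series[where w = D, OF dom_borel a(2) Dc usum bG]) blast+
  obtain W where Wm: "set_borel_measurable lborel (\<Omega> \<times> {0<..}) W"
    and Wt: "\<And>y N. 0 < y \<Longrightarrow> L2norm_sq \<Omega> (\<lambda>x. (\<Sum>k<N. (u k * D k y) *\<^sub>R (lam k * \<phi> k x)) - W (x, y)) \<le> ennreal (mW y * t N)"
    and Wb: "\<And>y. 0 < y \<Longrightarrow> L2norm_sq \<Omega> (\<lambda>x. W (x, y)) \<le> (\<Sum>k. ennreal ((lam k)\<^sup>2 * (u k * D k y)\<^sup>2))"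
    unfolding t_def by (rule bessel_system_series[where w = D, OF dom_borel bessel_operator Dc usum bW]) blast+
  have cyl: "cylinder \<Omega> = \<Omega> \<times> {0<..}" by (simp add: cylinder_def)
  have Ut: "AE y in lborel. 0 < y \<longrightarrow> L2norm_sq \<Omega> (\<lambda>x. (\<Sum>k<N. (u k * \<psi> k y) *\<^sub>R \<phi> k x) - U (x, y)) \<le> ennreal (2 * t N)" for N
    using conv
  proof eventually_elim
    case (elim y)
    show ?case
      unfolding t_def
    proof (intro impI series_tail_bound[OF usum])
      assume y: "0 < y"
      show "\<bar>\<psi> k y\<bar> \<le> 1" for k
        using profile_nonneg[OF p lam_pos, of y k] profile_le_1[OF p lam_pos, of y k] y by simp
      show "set_borel_measurable lborel \<Omega> (\<lambda>x. U (x, y))"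
        using slice_measurable[OF U[unfolded cyl]] y by simp
      show "(\<lambda>N. L2norm_sq \<Omega> (\<lambda>x. U (x, y) - (\<Sum>k<N. u k * \<phi> k x * \<psi> k y))) \<longlonglongrightarrow> 0"
        using elim y by (simp add: u_def)
    qed
  qed
  have Vt': "AE y in lborel. 0 < y \<longrightarrow> L2norm_sq \<Omega> (\<lambda>x. (\<Sum>k<N. (u k * D k y) *\<^sub>R \<phi> k x) - V (x, y)) \<le> ennreal (mV y * t N)" for N
    using Vt by (intro AE_I2 impI)
  have Gt': "AE y in lborel. 0 < y \<longrightarrow> L2norm_sq \<Omega> (\<lambda>x. (\<Sum>k<N. (u k * D k y) *\<^sub>R (eigen_grad k x $ i)) - G (x, y) $ i)
      \<le> ennreal (mG y * t N)" for N i
  proof (intro AE_I2 impI)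
    fix y :: real assume y: "0 < y"
    have "L2norm_sq \<Omega> (\<lambda>x. (\<Sum>k<N. (u k * D k y) *\<^sub>R (eigen_grad k x $ i)) - G (x, y) $ i)
        = L2norm_sq \<Omega> (\<lambda>x. ((\<Sum>k<N. (u k * D k y) *\<^sub>R eigen_grad k x) - G (x, y)) $ i)"
      by simp
    also have "\<dots> \<le> ennreal (mG y * t N)" by (rule order_trans[OF L2norm_sq_component_le Gt[OF y]])
    finally show "L2norm_sq \<Omega> (\<lambda>x. (\<Sum>k<N. (u k * D k y) *\<^sub>R (eigen_grad k x $ i)) - G (x, y) $ i) \<le> ennreal (mG y * t N)" .
  qed
  have mV: "\<exists>B. \<forall>y\<in>{a..b}. mV y \<le> B" if "0 < a" for a b unfolding mV_def by (rule bdd[OF that C(1)])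
  have mG: "\<exists>B. \<forall>y\<in>{a'..b}. mG y \<le> B" if "0 < a'" for a' b
    unfolding mG_def by (rule bdd[OF that divide_pos_pos[OF C(1) a(1)]])
  show ?thesis
  proof (rule that[OF _ _ _ Vm Gm Wm Vb Gb Wb])
    have "weak_deriv (\<Omega> \<times> {0<..}) (replicate (Suc l) dir_y) (\<lambda>z. \<phi> k (fst z) * \<psi> k (snd z)) (\<lambda>z. \<phi> k (fst z) * D k (snd z))" for k
      using eigen_tensor_weak_deriv[where \<psi> = \<psi>, OF p] unfolding D_def cyl .
    from weak_deriv_series[OF dom_borel eigen_L2(1) eigen_L2(1) \<psi>c Dc this U[unfolded cyl] Vm Ut Vt' _ mV t0 t_lim]
    show "weak_deriv (cylinder \<Omega>) (replicate (Suc l) dir_y) U V" unfolding cyl by blast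
    show "weak_grad_x (cylinder \<Omega>) V G" unfolding weak_grad_x_def
    proof
      fix i
      have "weak_deriv (\<Omega> \<times> {0<..}) [(axis i 1, 0)] (\<lambda>z. \<phi> k (fst z) * D k (snd z)) (\<lambda>z. eigen_grad k (fst z) $ i * D k (snd z))" for k
        using tensor_weak_deriv(2)[OF open_dom eigen_H01 Dd Dc'] unfolding D_def cyl .
      from weak_deriv_series[OF dom_borel eigen_L2(1) in_L2_component[OF eigen_L2(2)] Dc Dc this Vm
          set_borel_measurable_component[OF Gm] Vt' Gt' mV mG t0 t_lim]
      show "weak_deriv (cylinder \<Omega>) [(axis i 1, 0)] V (\<lambda>z. G z $ i)" unfolding cyl .
    qed
    show "dirichlet_op_x \<Omega> A c V W" unfolding dirichlet_op_x_def cyl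
    proof (intro conjI Wm AE_I2 impI)
      fix y :: real assume y: "0 < y"
      let ?b = "\<lambda>k. u k * D k y"
      have fin: "in_L2 \<Omega> (\<lambda>x. E (x, y))"
        if "set_borel_measurable lborel (\<Omega> \<times> {0<..}) E" "L2norm_sq \<Omega> (\<lambda>x. (\<Sum>k<0. ?b k *\<^sub>R e k x) - E (x, y)) \<le> ennreal r"
        for E :: "(real ^ 'n) \<times> real \<Rightarrow> 'c::euclidean_space" and e :: "nat \<Rightarrow> real ^ 'n \<Rightarrow> 'c" and r
      proof -
        have "L2norm_sq \<Omega> (\<lambda>x. (\<Sum>k<0. ?b k *\<^sub>R e k x) - E (x, y)) = L2norm_sq \<Omega> (\<lambda>x. E (x, y))"
          by (rule L2norm_sq_cong) simp
        with that(2) have "L2norm_sq \<Omega> (\<lambda>x. E (x, y)) < \<infinity>" using ennreal_less_top le_less_trans by (metis infinity_ennreal_def)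
        then show ?thesis using slice_measurable[OF that(1)] y by (simp add: in_wL2_def)
      qed
      have lim: "(\<lambda>N. L2norm_sq \<Omega> (f N)) \<longlonglongrightarrow> 0" if "\<And>N. L2norm_sq \<Omega> (f N) \<le> ennreal (M * t N)"
        for f :: "nat \<Rightarrow> real ^ 'n \<Rightarrow> 'c::euclidean_space" and M
      proof (rule tendsto_sandwich[OF _ _ tendsto_const])
        have "(\<lambda>N. ennreal (M * t N)) \<longlonglongrightarrow> ennreal (M * 0)" by (intro tendsto_intros t_lim)
        then show "(\<lambda>N. ennreal (M * t N)) \<longlonglongrightarrow> 0" by simp
      qed (use that in \<open>auto intro!: always_eventually\<close>)
      note L = fin[OF Vm Vt[OF y, of 0]] fin[OF Gm Gt[OF y, of 0]] fin[OF Wm Wt[OF y, of 0]]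
      note lims = lim[OF Vt[OF y]] lim[OF Gt[OF y]] lim[OF Wt[OF y]]
      have "H01 \<Omega> (\<lambda>x. \<Sum>k<N. ?b k *\<^sub>R \<phi> k x) (\<lambda>x. \<Sum>k<N. ?b k *\<^sub>R eigen_grad k x)" for N
        using H01_sum[OF dom_borel eigen_H01, of "{..<N}" ?b] by simp
      then have H: "H01 \<Omega> (\<lambda>x. V (x, y)) (\<lambda>x. G (x, y))"
        by (rule H01_closed[OF dom_borel _ L(1,2) lims(1,2)])
      have "weak_form (\<lambda>x. V (x, y)) (\<lambda>x. G (x, y)) (\<lambda>x. W (x, y))"
        by (rule weak_form_limit[OF _ _ _ _ L lims]; (intro in_L2_sum in_L2_scaleR eigen_L2 weak_form_sum eigen_weak_form)?)
      then show "dirichlet_op \<Omega> A c (\<lambda>x. V (x, y)) (\<lambda>x. W (x, y))"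
        using H L(3) unfolding dirichlet_op_def weak_form_def by blast
    qed
  qed
qed

lemma weighted_Hr_bound:
  fixes E :: "(real ^ 'n) \<times> real \<Rightarrow> 'b::euclidean_space"
  assumes E: "set_borel_measurable lborel (\<Omega> \<times> {0<..}) E"
    and w: "\<And>k. continuous_on {0<..} (w k)" and \<Lambda>: "\<And>k. 0 \<le> \<Lambda> k"
    and slice: "\<And>y. 0 < y \<Longrightarrow> L2norm_sq \<Omega> (\<lambda>x. E (x, y)) \<le> (\<Sum>k. ennreal (\<Lambda> k * (L2_inner \<Omega> v (\<phi> k) * w k y)\<^sup>2))"
    and J: "\<And>k. (\<integral>\<^sup>+y\<in>{0<..}. ennreal (y powr \<beta> * exp (\<theta> * y) * (w k y)\<^sup>2) \<partial>lborel) \<le> ennreal (J k)"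
    and J0: "\<And>k. 0 \<le> J k" and r: "\<And>k. \<Lambda> k * J k = B * lam k powr r" and Hr: "in_Hr \<Omega> lam \<phi> r v"
  shows "wnorm_sq (weight \<beta> \<theta>) (cylinder \<Omega>) E \<le> ennreal (B * (Hr_norm \<Omega> lam \<phi> r v)\<^sup>2)"
proof -
  have eq: "\<Lambda> k * (L2_inner \<Omega> v (\<phi> k))\<^sup>2 * J k = B * (lam k powr r * (L2_inner \<Omega> v (\<phi> k))\<^sup>2)" for k
    using r[of k] by (simp add: mult_ac)
  have sm: "summable (\<lambda>k. lam k powr r * (L2_inner \<Omega> v (\<phi> k))\<^sup>2)" using Hr by (simp add: in_Hr_def)
  have "wnorm_sq (weight \<beta> \<theta>) (cylinder \<Omega>) E \<le> ennreal (\<Sum>k. \<Lambda> k * (L2_inner \<Omega> v (\<phi> k))\<^sup>2 * J k)"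
    unfolding cylinder_def
    by (rule wnorm_sq_series_bound[OF E w \<Lambda> slice J J0]) (simp_all add: eq sm summable_mult)
  also have "(\<Sum>k. \<Lambda> k * (L2_inner \<Omega> v (\<phi> k))\<^sup>2 * J k) = B * (Hr_norm \<Omega> lam \<phi> r v)\<^sup>2"
    unfolding eq Hr_norm_def using sm by (simp add: suminf_mult suminf_nonneg)
  finally show ?thesis .
qed

end

section \<open>The weighted estimates\<close>

theorem theorem4p5:
  fixes \<Omega> :: "(real ^ 'n) set"
    and A :: "real ^ 'n \<Rightarrow> real ^ 'n ^ 'n"
    and c :: "real ^ 'n \<Rightarrow> real"
    and lam :: "nat \<Rightarrow> real"
    and \<phi> :: "nat \<Rightarrow> real ^ 'n \<Rightarrow> real"
    and \<psi> :: "nat \<Rightarrow> real \<Rightarrow> real"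
    and s \<gamma> T \<theta> \<sigma> \<nu> :: real
  assumes "open \<Omega>" "bounded \<Omega>" "convex \<Omega>"
    and "coeff_A \<Omega> A" "coeff_c \<Omega> c"
    and "eigensystem \<Omega> A c lam \<phi>"
    and "0 < s" "s < 1" "1 < \<gamma>" "\<gamma> \<le> 2" "0 < T"
    and "\<And>k. profile s (lam k) (\<psi> k)"
    and "0 \<le> \<theta>" "\<theta> < 2 * sqrt (lam 0)"
    and "0 \<le> \<sigma>" "\<sigma> < s"
    and "0 \<le> \<nu>" "\<nu> < 1 + s"
  shows "\<exists>\<kappa>>1. \<exists>C>0. \<forall>f g h U u.
    extended_solution \<Omega> A c \<phi> s \<gamma> T f g h U u \<longrightarrow>
    series_representation \<Omega> \<phi> \<psi> T U u \<longrightarrow>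
    (\<forall>l::nat. AE t in lborel. t \<in> {0<..<T} \<longrightarrow>
      (\<exists>V. weak_deriv (cylinder \<Omega>) (replicate (l + 1) dir_y) (U t) V \<and>
        (in_Hr \<Omega> lam \<phi> (\<sigma> + s) (u t) \<longrightarrow>
          wnorm_sq (weight (1 - 2 * s + 2 * real l - 2 * \<sigma>) \<theta>) (cylinder \<Omega>) V
            \<le> ennreal (C * \<kappa> ^ (2 * (l + 1)) * (fact (l + 1))\<^sup>2
                          * (Hr_norm \<Omega> lam \<phi> (\<sigma> + s) (u t))\<^sup>2)) \<and>
        (in_Hr \<Omega> lam \<phi> (\<nu> + s) (u t) \<longrightarrow>
          (\<exists>G. weak_grad_x (cylinder \<Omega>) V G \<and>
            wnorm_sq (weight (1 - 2 * s + 2 * real (l + 1) - 2 * \<nu>) \<theta>) (cylinder \<Omega>) G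
              \<le> ennreal (C * \<kappa> ^ (2 * (l + 1)) * (fact (l + 1))\<^sup>2
                            * (Hr_norm \<Omega> lam \<phi> (\<nu> + s) (u t))\<^sup>2))) \<and>
        (in_Hr \<Omega> lam \<phi> (1 + \<nu> + s) (u t) \<longrightarrow>
          (\<exists>W. dirichlet_op_x \<Omega> A c V W \<and>
            wnorm_sq (weight (1 - 2 * s + 2 * real (l + 1) - 2 * \<nu>) \<theta>) (cylinder \<Omega>) W
              \<le> ennreal (C * \<kappa> ^ (2 * (l + 1)) * (fact (l + 1))\<^sup>2
                            * (Hr_norm \<Omega> lam \<phi> (1 + \<nu> + s) (u t))\<^sup>2)))))"
proof -
  interpret dirichlet_eigen \<Omega> A c lam \<phi>
    using assms by unfold_locales auto
  note s = \<open>0 < s\<close> \<open>s < 1\<close> and p = \<open>\<And>k. profile s (lam k) (\<psi> k)\<close>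
  define \<theta>\<^sub>0 where "\<theta>\<^sub>0 = \<theta> / sqrt (lam 0)"
  have l0: "0 < sqrt (lam 0)" using lam_pos[of 0] by simp
  have \<theta>\<^sub>0: "0 \<le> \<theta>\<^sub>0" "\<theta>\<^sub>0 < 2" using \<open>0 \<le> \<theta>\<close> \<open>\<theta> < 2 * sqrt (lam 0)\<close> l0 by (auto simp: \<theta>\<^sub>0_def pos_divide_less_eq)
  have \<theta>_le: "\<theta> \<le> \<theta>\<^sub>0 * sqrt (lam k)" for k
  proof -
    have "\<theta> = \<theta>\<^sub>0 * sqrt (lam 0)" using l0 by (simp add: \<theta>\<^sub>0_def)
    also have "\<dots> \<le> \<theta>\<^sub>0 * sqrt (lam k)" using \<theta>\<^sub>0 lam_ge[of k] by (intro mult_left_mono) auto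
    finally show ?thesis .
  qed
  obtain \<kappa> where \<kappa>: "\<kappa> > 1" and bound: "\<And>\<rho>. \<rho> < 1 + s \<Longrightarrow> \<exists>C>0. \<forall>\<mu>>0. \<forall>\<psi> \<theta> l. profile s \<mu> \<psi> \<longrightarrow> \<theta> \<le> \<theta>\<^sub>0 * sqrt \<mu> \<longrightarrow>
     profile_energy s \<theta> \<rho> \<mu> \<psi> l \<le> ennreal (C * \<kappa> ^ (2 * (l + 1)) * (fact (l + 1))\<^sup>2 * \<mu> powr (s + \<rho> - 1))"
    using profile_deriv_seq_weighted_bound[OF s \<theta>\<^sub>0] by blast
  have "\<sigma> + 1 < 1 + s" using \<open>\<sigma> < s\<close> by simp
  \<comment> \<open>The weight of the first estimate is the one of \<open>profile_energy\<close> with \<open>\<rho> = \<sigma> + 1\<close>.\<close>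
  from bound[OF this] obtain C1 where C1: "C1 > 0" "\<And>k l.
     profile_energy s \<theta> (\<sigma> + 1) (lam k) (\<psi> k) l \<le> ennreal (C1 * \<kappa> ^ (2 * (l + 1)) * (fact (l + 1))\<^sup>2 * lam k powr (s + (\<sigma> + 1) - 1))"
    using lam_pos p \<theta>_le by meson
  from bound[OF \<open>\<nu> < 1 + s\<close>] obtain C2 where C2: "C2 > 0" "\<And>k l.
     profile_energy s \<theta> \<nu> (lam k) (\<psi> k) l \<le> ennreal (C2 * \<kappa> ^ (2 * (l + 1)) * (fact (l + 1))\<^sup>2 * lam k powr (s + \<nu> - 1))"
    using lam_pos p \<theta>_le by meson
  obtain a where a: "0 < a" "bessel_system \<Omega> eigen_grad (\<lambda>k. lam k / a)" by (rule bessel_gradients)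
  define C where "C = C1 + C2 / a + C2"
  have C: "C > 0" "C1 \<le> C" "C2 / a \<le> C" "C2 \<le> C"
    using C1(1) C2(1) a(1) by (auto simp: C_def add_pos_pos)
  have Dc: "continuous_on {0<..} (profile_deriv_seq s (lam k) (\<psi> k) m)" for k m
    by (intro continuous_at_imp_continuous_on ballI DERIV_isCont[OF profile_deriv_seq_deriv[OF p]]) auto
  show ?thesis
  proof (rule exI[of _ \<kappa>], intro conjI \<kappa>, rule exI[of _ C], intro conjI C(1) allI impI)
    fix f g h U u and l :: nat
    assume sol: "extended_solution \<Omega> A c \<phi> s \<gamma> T f g h U u" and ser: "series_representation \<Omega> \<phi> \<psi> T U u"
    let ?F = "\<kappa> ^ (2 * (l + 1)) * (fact (l + 1))\<^sup>2"
    have F: "0 \<le> ?F" using \<kappa> by simp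
    have uL2: "in_L2 \<Omega> (u t)" if "t \<in> {0<..<T}" for t using sol that by (auto simp: extended_solution_def)
    have en: "AE t in lborel. t \<in> {0<..<T} \<longrightarrow> (\<exists>G. energy_space \<Omega> (1 - 2 * s) (U t) G (u t))"
      using sol unfolding extended_solution_def by (auto elim!: eventually_mono)
    have sr: "AE t in lborel. t \<in> {0<..<T} \<longrightarrow> (AE y in lborel. 0 < y \<longrightarrow>
        (\<lambda>N. L2norm_sq \<Omega> (\<lambda>x. U t (x, y) - (\<Sum>k<N. L2_inner \<Omega> (u t) (\<phi> k) * \<phi> k x * \<psi> k y))) \<longlonglongrightarrow> 0)"
      using ser by (simp add: series_representation_def)
    show "AE t in lborel. t \<in> {0<..<T} \<longrightarrow>
      (\<exists>V. weak_deriv (cylinder \<Omega>) (replicate (l + 1) dir_y) (U t) V \<and>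
        (in_Hr \<Omega> lam \<phi> (\<sigma> + s) (u t) \<longrightarrow>
          wnorm_sq (weight (1 - 2 * s + 2 * real l - 2 * \<sigma>) \<theta>) (cylinder \<Omega>) V
            \<le> ennreal (C * \<kappa> ^ (2 * (l + 1)) * (fact (l + 1))\<^sup>2
                          * (Hr_norm \<Omega> lam \<phi> (\<sigma> + s) (u t))\<^sup>2)) \<and>
        (in_Hr \<Omega> lam \<phi> (\<nu> + s) (u t) \<longrightarrow>
          (\<exists>G. weak_grad_x (cylinder \<Omega>) V G \<and>
            wnorm_sq (weight (1 - 2 * s + 2 * real (l + 1) - 2 * \<nu>) \<theta>) (cylinder \<Omega>) G
              \<le> ennreal (C * \<kappa> ^ (2 * (l + 1)) * (fact (l + 1))\<^sup>2
                            * (Hr_norm \<Omega> lam \<phi> (\<nu> + s) (u t))\<^sup>2))) \<and>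
        (in_Hr \<Omega> lam \<phi> (1 + \<nu> + s) (u t) \<longrightarrow>
          (\<exists>W. dirichlet_op_x \<Omega> A c V W \<and>
            wnorm_sq (weight (1 - 2 * s + 2 * real (l + 1) - 2 * \<nu>) \<theta>) (cylinder \<Omega>) W
              \<le> ennreal (C * \<kappa> ^ (2 * (l + 1)) * (fact (l + 1))\<^sup>2
                            * (Hr_norm \<Omega> lam \<phi> (1 + \<nu> + s) (u t))\<^sup>2))))"
      using en sr
    proof eventually_elim
      case (elim t)
      show ?case (is "_ \<longrightarrow> ?R")
      proof
        assume t: "t \<in> {0<..<T}"
        have Um: "set_borel_measurable lborel (cylinder \<Omega>) (U t)"
          using elim(1) t by (auto simp: energy_space_def in_wL2_def)
        note conv = elim(2)[rule_format, OF t]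
        obtain V G W where wd: "weak_deriv (cylinder \<Omega>) (replicate (Suc l) dir_y) (U t) V"
          "weak_grad_x (cylinder \<Omega>) V G" "dirichlet_op_x \<Omega> A c V W"
          and m: "set_borel_measurable lborel (\<Omega> \<times> {0<..}) V" "set_borel_measurable lborel (\<Omega> \<times> {0<..}) G"
            "set_borel_measurable lborel (\<Omega> \<times> {0<..}) W"
          and b: "\<And>y. 0 < y \<Longrightarrow> L2norm_sq \<Omega> (\<lambda>x. V (x, y))
              \<le> (\<Sum>k. ennreal (1 * (L2_inner \<Omega> (u t) (\<phi> k) * profile_deriv_seq s (lam k) (\<psi> k) (Suc l) y)\<^sup>2))"
            "\<And>y. 0 < y \<Longrightarrow> L2norm_sq \<Omega> (\<lambda>x. G (x, y))
              \<le> (\<Sum>k. ennreal (lam k / a * (L2_inner \<Omega> (u t) (\<phi> k) * profile_deriv_seq s (lam k) (\<psi> k) (Suc l) y)\<^sup>2))"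
            "\<And>y. 0 < y \<Longrightarrow> L2norm_sq \<Omega> (\<lambda>x. W (x, y))
              \<le> (\<Sum>k. ennreal ((lam k)\<^sup>2 * (L2_inner \<Omega> (u t) (\<phi> k) * profile_deriv_seq s (lam k) (\<psi> k) (Suc l) y)\<^sup>2))"
          by (rule derivative_series[OF s p uL2[OF t] Um conv a, where l = l]) blast
        have le: "x \<le> ennreal (C * \<kappa> ^ (2 * (l + 1)) * (fact (l + 1))\<^sup>2 * (Hr_norm \<Omega> lam \<phi> r (u t))\<^sup>2)"
          if "x \<le> ennreal (K * ?F * (Hr_norm \<Omega> lam \<phi> r (u t))\<^sup>2)" "K \<le> C" for x K r
        proof -
          have "K * ?F * (Hr_norm \<Omega> lam \<phi> r (u t))\<^sup>2 \<le> C * ?F * (Hr_norm \<Omega> lam \<phi> r (u t))\<^sup>2"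
            using that(2) F by (intro mult_right_mono) auto
          from order_trans[OF that(1) ennreal_leI[OF this]] show ?thesis by (simp only: mult.assoc)
        qed
        have powr_le: "lam k powr (r + 1) = lam k * lam k powr r" for k r
          using lam_pos[of k] by (simp add: powr_add)
        have V: "wnorm_sq (weight (1 - 2 * s + 2 * real l - 2 * \<sigma>) \<theta>) (cylinder \<Omega>) V
            \<le> ennreal (C * \<kappa> ^ (2 * (l + 1)) * (fact (l + 1))\<^sup>2 * (Hr_norm \<Omega> lam \<phi> (\<sigma> + s) (u t))\<^sup>2)"
          if "in_Hr \<Omega> lam \<phi> (\<sigma> + s) (u t)"
        proof (rule le[OF _ C(2)], rule weighted_Hr_bound[OF m(1) Dc _ b(1) _ _ _ that])
          fix k
          let ?J = "C1 * \<kappa> ^ (2 * (l + 1)) * (fact (l + 1))\<^sup>2 * lam k powr (s + (\<sigma> + 1) - 1)"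
          have "1 - 2 * s + 2 * real l - 2 * \<sigma> = 1 - 2 * s + 2 * real (l + 1) - 2 * (\<sigma> + 1)" by simp
          then show "(\<integral>\<^sup>+y\<in>{0<..}. ennreal (y powr (1 - 2 * s + 2 * real l - 2 * \<sigma>) * exp (\<theta> * y)
              * (profile_deriv_seq s (lam k) (\<psi> k) (Suc l) y)\<^sup>2) \<partial>lborel) \<le> ennreal ?J"
            using C1(2)[of k l] by (simp only: Suc_eq_plus1 profile_energy_def)
          show "0 \<le> ?J" using C1(1) \<kappa> by simp
          have "s + (\<sigma> + 1) - 1 = \<sigma> + s" by simp
          then show "1 * ?J = C1 * ?F * lam k powr (\<sigma> + s)" by (simp only: mult.assoc mult_1_left)
        qed simp
        have G: "wnorm_sq (weight (1 - 2 * s + 2 * real (l + 1) - 2 * \<nu>) \<theta>) (cylinder \<Omega>) G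
            \<le> ennreal (C * \<kappa> ^ (2 * (l + 1)) * (fact (l + 1))\<^sup>2 * (Hr_norm \<Omega> lam \<phi> (\<nu> + s) (u t))\<^sup>2)"
          if "in_Hr \<Omega> lam \<phi> (\<nu> + s) (u t)"
        proof (rule le[OF _ C(3)], rule weighted_Hr_bound[OF m(2) Dc _ b(2) _ _ _ that])
          fix k
          let ?J = "C2 * \<kappa> ^ (2 * (l + 1)) * (fact (l + 1))\<^sup>2 * lam k powr (s + \<nu> - 1)"
          show "(\<integral>\<^sup>+y\<in>{0<..}. ennreal (y powr (1 - 2 * s + 2 * real (l + 1) - 2 * \<nu>) * exp (\<theta> * y)
              * (profile_deriv_seq s (lam k) (\<psi> k) (Suc l) y)\<^sup>2) \<partial>lborel) \<le> ennreal ?J"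
            using C2(2)[of k l] by (simp only: Suc_eq_plus1 profile_energy_def)
          show "0 \<le> ?J" using C2(1) \<kappa> by simp
          have "lam k powr (\<nu> + s) = lam k * lam k powr (s + \<nu> - 1)"
            using powr_le[of k "s + \<nu> - 1"] by (simp add: add.commute)
          then show "lam k / a * ?J = C2 / a * ?F * lam k powr (\<nu> + s)" by simp
          show "0 \<le> lam k / a" using lam_pos[of k] a(1) by simp
        qed
        have W: "wnorm_sq (weight (1 - 2 * s + 2 * real (l + 1) - 2 * \<nu>) \<theta>) (cylinder \<Omega>) W
            \<le> ennreal (C * \<kappa> ^ (2 * (l + 1)) * (fact (l + 1))\<^sup>2 * (Hr_norm \<Omega> lam \<phi> (1 + \<nu> + s) (u t))\<^sup>2)"
          if "in_Hr \<Omega> lam \<phi> (1 + \<nu> + s) (u t)"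
        proof (rule le[OF _ C(4)], rule weighted_Hr_bound[OF m(3) Dc _ b(3) _ _ _ that])
          fix k
          let ?J = "C2 * \<kappa> ^ (2 * (l + 1)) * (fact (l + 1))\<^sup>2 * lam k powr (s + \<nu> - 1)"
          show "(\<integral>\<^sup>+y\<in>{0<..}. ennreal (y powr (1 - 2 * s + 2 * real (l + 1) - 2 * \<nu>) * exp (\<theta> * y)
              * (profile_deriv_seq s (lam k) (\<psi> k) (Suc l) y)\<^sup>2) \<partial>lborel) \<le> ennreal ?J"
            using C2(2)[of k l] by (simp only: Suc_eq_plus1 profile_energy_def)
          show "0 \<le> ?J" using C2(1) \<kappa> by simp
          have "lam k powr (1 + \<nu> + s) = lam k * lam k powr (\<nu> + s)"
            using powr_le[of k "\<nu> + s"] by (simp add: add_ac)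
          also have "lam k powr (\<nu> + s) = lam k * lam k powr (s + \<nu> - 1)"
            using powr_le[of k "s + \<nu> - 1"] by (simp add: add.commute)
          finally show "(lam k)\<^sup>2 * ?J = C2 * ?F * lam k powr (1 + \<nu> + s)" by (simp add: power2_eq_square)
        qed simp
        show ?R
          using wd V G W unfolding Suc_eq_plus1 by (intro exI[of _ V]) blast
      qed
    qed
  qed
qed

end
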